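(* Let $0<p\le\infty$ and $\alpha>0$. A set $\Lambda\subset\mathbb{C}_0$ is complete interpolating for the two-sided small Fock space $\mathcal{F}^p_{\alpha}$ if and only if the following three conditions are satisfied: (i) $\Lambda$ is $d_{\log}$-separated; and $\Lambda$ can be enumerated (by its distinct elements) as $\Lambda=(\lambda_k)_{k\in\mathbb{Z}}$ with $|\lambda_k|\le|\lambda_{k+1}|$ for all $k\in\mathbb{Z}$, such that, writing $$\lambda_k=e^{\frac{k+2/p+\delta_k}{2\alpha}}e^{i\theta_k},\qquad \delta_k,\theta_k\in\mathbb{R},$$ one has (ii) $(\delta_k)_{k\in\mathbb{Z}}\in\ell^\infty(\mathbb{Z})$; (iii) up to a shift in the numeration (that is, after replacing $(\lambda_k)_{k\in\mathbb{Z}}$ by $(\lambda_{k+s})_{k\in\mathbb{Z}}$ for some $s\in\mathbb{Z}$ and redefining the $\delta_k$ accordingly), there exist $N\in\mathbb{N}$ and $\varepsilon>0$ such that $$\sup_{n\in\mathbb{Z}}\left|\frac1N\sum_{k=n}^{n+N-1}\delta_k\right|\le\frac12-\varepsilon .$$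
   Context: Notation: $\mathbb{C}_0=\mathbb{C}\setminus\{0\}$, $\mathbb{N}=\{1,2,\dots\}$, and $2/p=0$ when $p=\infty$. Two-sided small Fock space: for $\alpha>0$ and $0<p\le\infty$, $\mathcal{F}^p_\alpha$ is the space of functions $f$ holomorphic on $\mathbb{C}_0$ with $\|f\|_{\mathcal{F}^p_\alpha}=\big\|f(z)e^{-\alpha\log^2|z|}\big\|_{L^p(\mathbb{C})}<\infty$ (with respect to two-dimensional Lebesgue measure). Complete interpolating: for a set $\Lambda\subset\mathbb{C}_0$ consider the restriction operator $R_\Lambda: f\mapsto\big(f(\lambda)|\lambda|^{2/p}e^{-\alpha\log^2|\lambda|}\big)_{\lambda\in\Lambda}$ on $\mathcal{F}^p_\alpha$. The set $\Lambda$ is complete interpolating for $\mathcal{F}^p_\alpha$ if $R_\Lambda$ is an isomorphism (bounded linear bijection with bounded inverse) between $\mathcal{F}^p_\alpha$ and $\ell^p(\Lambda)$. Separation: for $z,w\in\mathbb{C}_0$ let $d_{\log}(z,w)=\big|\log|z|-\log|w|\big|+\left|\frac{z}{|z|}-\frac{w}{|w|}\right|$. A set $\Lambda\subset\mathbb{C}_0$ is $d_{\log}$-separated if there is $d_\Lambda>0$ such that $d_{\log}(\lambda,\lambda')\ge d_\Lambda$ for all distinct $\lambda,\lambda'\in\Lambda$. *)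

theory Defs
  imports "HOL-Complex_Analysis.Complex_Analysis" "HOL-Probability.Essential_Supremum"
begin

text \<open>
  Exponents \<open>p\<close> range over \<^typ>\<open>ennreal\<close>, where \<open>p = \<infinity>\<close> is allowed.
\<close>

definition Lp_norm :: "ennreal \<Rightarrow> 'a measure \<Rightarrow> ('a \<Rightarrow> complex) \<Rightarrow> ennreal" where
  "Lp_norm p M f =
     (if p = \<infinity> then esssup M (\<lambda>x. ennreal (cmod (f x)))
      else (let I = (\<integral>\<^sup>+ x. ennreal (cmod (f x) powr enn2real p) \<partial>M)
            in if I = \<infinity> then \<infinity> else ennreal (enn2real I powr (1 / enn2real p))))"

definition two_over :: "ennreal \<Rightarrow> real" where
  "two_over p = (if p = \<infinity> then 0 else 2 / enn2real p)"

definition fock_norm :: "real \<Rightarrow> ennreal \<Rightarrow> (complex \<Rightarrow> complex) \<Rightarrow> ennreal" where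
  "fock_norm \<alpha> p f =
     Lp_norm p lborel (\<lambda>z. f z * of_real (exp (- \<alpha> * (ln (cmod z))\<^sup>2)))"

text \<open>
  Functions on the punctured plane are represented as total functions with value \<open>0\<close> at the
  origin, so that equality of functions on the punctured plane is equality in HOL.
  This prescribes no behaviour near the origin.
\<close>

definition fock_space :: "real \<Rightarrow> ennreal \<Rightarrow> (complex \<Rightarrow> complex) set" where
  "fock_space \<alpha> p = {f. f holomorphic_on (- {0}) \<and> f 0 = 0 \<and> fock_norm \<alpha> p f < \<infinity>}"

text \<open>Likewise, families indexed by \<open>A\<close> are total functions vanishing outside \<open>A\<close>.\<close>

definition lp_norm :: "ennreal \<Rightarrow> 'a set \<Rightarrow> ('a \<Rightarrow> complex) \<Rightarrow> ennreal" where
  "lp_norm p A a = Lp_norm p (count_space A) a"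

definition lp_space :: "ennreal \<Rightarrow> 'a set \<Rightarrow> ('a \<Rightarrow> complex) set" where
  "lp_space p A = {a. (\<forall>x. x \<notin> A \<longrightarrow> a x = 0) \<and> lp_norm p A a < \<infinity>}"

definition restriction_op ::
    "complex set \<Rightarrow> real \<Rightarrow> ennreal \<Rightarrow> (complex \<Rightarrow> complex) \<Rightarrow> complex \<Rightarrow> complex" where
  "restriction_op \<Lambda> \<alpha> p f =
     (\<lambda>z. if z \<in> \<Lambda>
          then f z * of_real (cmod z powr two_over p * exp (- \<alpha> * (ln (cmod z))\<^sup>2))
          else 0)"

text \<open>
  Isomorphisms between spaces \<open>V\<close>, \<open>W\<close> of complex-valued functions with (quasi-)norms
  \<open>nV\<close>, \<open>nW\<close>. For \<open>p < 1\<close> the spaces below are only quasi-normed, so the library notions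
  for normed vector spaces do not apply.
\<close>

definition linear_between ::
    "('a \<Rightarrow> complex) set \<Rightarrow> (('a \<Rightarrow> complex) \<Rightarrow> ('b \<Rightarrow> complex)) \<Rightarrow> bool" where
  "linear_between V T \<longleftrightarrow>
     (\<forall>f\<in>V. \<forall>g\<in>V. T (\<lambda>x. f x + g x) = (\<lambda>y. T f y + T g y)) \<and>
     (\<forall>c. \<forall>f\<in>V. T (\<lambda>x. c * f x) = (\<lambda>y. c * T f y))"

definition bounded_between ::
    "'v set \<Rightarrow> ('v \<Rightarrow> ennreal) \<Rightarrow> ('w \<Rightarrow> ennreal) \<Rightarrow> ('v \<Rightarrow> 'w) \<Rightarrow> bool" where
  "bounded_between V nV nW T \<longleftrightarrow> (\<exists>C::real. \<forall>f\<in>V. nW (T f) \<le> ennreal C * nV f)"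

definition isomorphism_between ::
    "('a \<Rightarrow> complex) set \<Rightarrow> (('a \<Rightarrow> complex) \<Rightarrow> ennreal) \<Rightarrow>
     ('b \<Rightarrow> complex) set \<Rightarrow> (('b \<Rightarrow> complex) \<Rightarrow> ennreal) \<Rightarrow>
     (('a \<Rightarrow> complex) \<Rightarrow> ('b \<Rightarrow> complex)) \<Rightarrow> bool" where
  "isomorphism_between V nV W nW T \<longleftrightarrow>
     linear_between V T \<and> bij_betw T V W \<and>
     bounded_between V nV nW T \<and> bounded_between W nW nV (inv_into V T)"

definition complete_interpolating :: "real \<Rightarrow> ennreal \<Rightarrow> complex set \<Rightarrow> bool" where
  "complete_interpolating \<alpha> p \<Lambda> \<longleftrightarrow>
     isomorphism_between (fock_space \<alpha> p) (fock_norm \<alpha> p)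
       (lp_space p \<Lambda>) (lp_norm p \<Lambda>) (restriction_op \<Lambda> \<alpha> p)"

definition dlog :: "complex \<Rightarrow> complex \<Rightarrow> real" where
  "dlog z w = \<bar>ln (cmod z) - ln (cmod w)\<bar> + cmod (z / of_real (cmod z) - w / of_real (cmod w))"

definition dlog_separated :: "complex set \<Rightarrow> bool" where
  "dlog_separated \<Lambda> \<longleftrightarrow> (\<exists>d>0. \<forall>z\<in>\<Lambda>. \<forall>w\<in>\<Lambda>. z \<noteq> w \<longrightarrow> d \<le> dlog z w)"

definition monotone_enumeration :: "complex set \<Rightarrow> (int \<Rightarrow> complex) \<Rightarrow> bool" where
  "monotone_enumeration \<Lambda> l \<longleftrightarrow>
     bij_betw l UNIV \<Lambda> \<and> (\<forall>k. cmod (l k) \<le> cmod (l (k + 1)))"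

definition log_polar_form ::
    "real \<Rightarrow> ennreal \<Rightarrow> (int \<Rightarrow> complex) \<Rightarrow> (int \<Rightarrow> real) \<Rightarrow> (int \<Rightarrow> real) \<Rightarrow> bool" where
  "log_polar_form \<alpha> p l \<delta> \<theta> \<longleftrightarrow>
     (\<forall>k. l k = of_real (exp ((of_int k + two_over p + \<delta> k) / (2 * \<alpha>))) * exp (\<i> * of_real (\<theta> k)))"

text \<open>The supremum is taken in \<^typ>\<open>ereal\<close>, so that it is meaningful for every \<open>\<delta>\<close>.\<close>

definition averages_below_half :: "(int \<Rightarrow> real) \<Rightarrow> bool" where
  "averages_below_half \<delta> \<longleftrightarrow>
     (\<exists>(N::nat) (\<epsilon>::real). N \<ge> 1 \<and> \<epsilon> > 0 \<and>
        (SUP n::int. ereal \<bar>(1 / real N) * (\<Sum>k = n..n + int N - 1. \<delta> k)\<bar>) \<le> ereal (1/2 - \<epsilon>))"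

end

theory Submission
  imports Defs
begin

text \<open>In the coordinate \<open>lx z = 2 * \<alpha> * ln |z| - 2/p\<close> the weighted modulus
  \<open>V f z = |f z| * |z| powr (2/p) * exp (- \<alpha> * (ln |z|)\<^sup>2)\<close> of \<open>z powi n\<close> is a Gaussian centred at \<open>n\<close>,
  and the function \<open>g k\<close> with \<open>g k (l k) = 1\<close> that vanishes at the other \<open>l j\<close> is explicit: up to a
  constant it is \<open>z powi k\<close> times the canonical products over the zeros beyond and before \<open>l k\<close>.
  Its size relative to its value at \<open>l k\<close> is, up to bounded factors,
  \<open>exp ((- |k - m| / 2 \<plusminus> S) / (2 * \<alpha>))\<close> near \<open>lx z = m\<close>, where \<open>S\<close> is the sum of the \<open>\<delta> j\<close> between \<open>k\<close>
  and \<open>m\<close>. If the averages of \<open>\<delta>\<close> stay below \<open>1/2 - \<epsilon>\<close>, these functions decay exponentially and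
  interpolation is solved by the series over the \<open>g k\<close>; uniqueness follows because a function
  vanishing on \<open>\<Lambda>\<close> is divisible by the generating function \<open>G\<close>, and the quotient is
  \<open>o(|z|)\<close> at infinity and \<open>o(1)\<close> at the origin along suitable circles, hence zero.

  Conversely, for a complete interpolating set the functions with values \<open>0\<close> and a single \<open>1\<close> are
  bounded in norm. This gives separation; testing with monomials gives points in every long
  annulus, hence an enumeration by \<open>int\<close>. After a shift each \<open>g k\<close> lies in the space, so it is a
  multiple of the corresponding dual function. Boundedness of the latter bounds \<open>\<delta>\<close>, and bounded
  sums over \<open>m\<close> for fixed \<open>k\<close> (or over \<open>k\<close> for fixed \<open>m\<close>, when \<open>p = \<infinity>\<close>) force exponential
  decay, that is, averages below \<open>1/2\<close> by a fixed amount.\<close>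

section \<open>Laurent functions\<close>

text \<open>The bound 1/2 in (iii) is what survives an exact cancellation. For
  \<open>\<delta> = 0\<close> and in units of \<open>1 / (2 * \<alpha>)\<close>, moving
  \<open>n\<close> steps away from \<open>l k\<close> costs \<open>n^2 / 2\<close> in the Gaussian,
  while the \<open>n\<close> zeros passed give back
  \<open>0 + 1 + ... + (n - 1) = n^2 / 2 - n / 2\<close>. Only the linear term
  \<open>- n / 2\<close> is left, and the partial sums of \<open>\<delta>\<close> compete with it.

  For \<open>p < 1\<close> there is neither a triangle inequality nor duality. Hence the
  interpolation series is dominated by a constant times one of its majorant terms, at half the
  exponential rate, and norms are compared through p-th powers, alike for all finite exponents.

  Lower bounds for products fail near zeros, so comparisons are made on circles that keep away from
  every zero. Bounded density provides one such circle in each unit annulus, and the maximum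
  principle fills in between.

  An abstract complete interpolating set has no preferred numbering. The right index shift is read
  off from a dual function: its quotient by the product is a Laurent function, and the exponent of a
  monomial below it gives the shift.\<close>

lemma contour_integral_zero_of_geometric_steps:
  fixes h :: "complex \<Rightarrow> complex" and q :: "complex \<Rightarrow> complex"
  assumes r: "r > 0" and I: "(f has_contour_integral I) (circlepath 0 r)"
    and step: "\<And>N. ((\<lambda>z. f z * q z ^ N * (1 - q z)) has_contour_integral 0) (circlepath 0 r)"
    and B: "\<And>z. cmod z = r \<Longrightarrow> cmod (f z) \<le> B" "B \<ge> 0"
    and q: "\<And>z. cmod z = r \<Longrightarrow> cmod (q z) \<le> 1/2"
  shows "I = 0"
proof -
  \<comment> \<open>The step integrals telescope, so inserting \<open>q ^ N\<close> never changes
    \<open>I\<close>; geometric decay then forces \<open>I = 0\<close>. This replaces integrating a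
    geometric series termwise.\<close>
  have int: "((\<lambda>z. f z * q z ^ N) has_contour_integral I) (circlepath 0 r)" for N
  proof (induction N)
    case 0
    then show ?case using I by simp
  next
    case (Suc N)
    from has_contour_integral_diff[OF this step[of N]]
    show ?case by (simp add: algebra_simps)
  qed
  have "cmod I \<le> (B * (1/2) ^ N) * (2 * pi * r)" for N
  proof (rule has_contour_integral_bound_circlepath[OF int[of N]])
    fix z assume z: "cmod (z - 0) = r"
    have "cmod (f z * q z ^ N) = cmod (f z) * cmod (q z) ^ N" by (simp add: norm_mult norm_power)
    also have "\<dots> \<le> B * (1/2) ^ N"
      using z B q by (intro mult_mono power_mono) auto
    finally show "cmod (f z * q z ^ N) \<le> B * (1/2) ^ N" .
  qed (use r B in auto)
  moreover have "(\<lambda>N. (B * (1/2) ^ N) * (2 * pi * r)) \<longlonglongrightarrow> (B * 0) * (2 * pi * r)"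
    by (intro tendsto_intros LIMSEQ_power_zero) auto
  ultimately have "cmod I \<le> 0"
    using LIMSEQ_le_const by fastforce
  then show ?thesis by simp
qed

text \<open>Some Laurent coefficient of a nonzero function is nonzero, and the Cauchy estimate for
  it, read backwards, bounds the maximum on every circle from below. If all coefficients vanished,
  Cauchy's formula on one circle outside and one inside \<open>w\<close> would give
  \<open>h w = 0\<close>.\<close>

lemma laurent_lower_bound:
  assumes h: "h holomorphic_on -{0}" and w: "w \<noteq> 0" and hw: "h w \<noteq> 0"
  obtains j :: int and c where "c > 0"
    "\<And>r. r > 0 \<Longrightarrow> \<exists>z. cmod z = r \<and> c * r powi j \<le> cmod (h z)"
proof -
  have res: "((\<lambda>z. g z) has_contour_integral 2 * pi * \<i> * residue g 0) (circlepath 0 r)"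
    if "g holomorphic_on -{0}" "r > 0" for g r
    using base_residue[of UNIV 0 r g] that by (simp add: Compl_eq_Diff_UNIV)
  have hol: "(\<lambda>z. h z * z powi j) holomorphic_on -{0}" for j
    by (intro holomorphic_intros h) auto
  have "\<exists>j. residue (\<lambda>z. h z * z powi j) 0 \<noteq> 0"
  proof (rule ccontr)
    assume "\<not> ?thesis"
    then have zero: "((\<lambda>z. h z * z powi j) has_contour_integral 0) (circlepath 0 r)" if "r > 0" for j r
      using res[OF hol[of j] that] by simp
    \<comment> \<open>The difference quotient extends over \<open>w\<close>, so its integral is the
      same on circles inside and outside of \<open>w\<close>.\<close>
    define \<phi> where "\<phi> = (\<lambda>z. if z = w then deriv h w else (h z - h w) / (z - w))"
    have \<phi>: "\<phi> holomorphic_on -{0}"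
      unfolding \<phi>_def by (rule pole_lemma_open[OF h]) auto
    have cmp: "\<exists>B\<ge>0. \<forall>z. cmod z = r \<longrightarrow> cmod (h z / (z - w)) \<le> B" if "r > 0" "r \<noteq> cmod w" for r
    proof -
      have "compact ((\<lambda>z. h z / (z - w)) ` sphere 0 r)"
        using that by (intro compact_continuous_image continuous_intros holomorphic_on_imp_continuous_on
            holomorphic_on_subset[OF h]) auto
      then obtain B where "\<forall>x\<in>(\<lambda>z. h z / (z - w)) ` sphere 0 r. cmod x \<le> B"
        using compact_imp_bounded bounded_iff by metis
      then show ?thesis by (intro exI[of _ "max B 0"]) (auto simp: le_max_iff_disj)
    qed
    have split: "((\<lambda>z. h z / (z - w)) has_contour_integral 2 * pi * \<i> * residue \<phi> 0 + h w * J) (circlepath 0 r)"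
      if r: "r > 0" "r \<noteq> cmod w" and J: "((\<lambda>z. 1 / (z - w)) has_contour_integral J) (circlepath 0 r)" for r J
    proof (rule has_contour_integral_eq)
      show "((\<lambda>z. \<phi> z + h w * (1 / (z - w))) has_contour_integral 2 * pi * \<i> * residue \<phi> 0 + h w * J) (circlepath 0 r)"
        by (intro has_contour_integral_add has_contour_integral_lmul res \<phi> r J)
    qed (use r in \<open>auto simp: \<phi>_def diff_divide_distrib\<close>)
    \<comment> \<open>Inside \<open>|w|\<close> the Cauchy kernel expands in powers of
      \<open>z / w\<close>, outside (fact \<open>2\<close> below) in powers of \<open>w / z\<close>;
      each term is a Laurent coefficient, assumed zero.\<close>
    have 1: "2 * pi * \<i> * residue \<phi> 0 + h w * 0 = 0"
    proof -
      define r where "r = cmod w / 2"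
      have r: "r > 0" "r \<noteq> cmod w" using w by (auto simp: r_def)
      obtain B where B: "B \<ge> 0" "\<And>z. cmod z = r \<Longrightarrow> cmod (h z / (z - w)) \<le> B" using cmp[OF r] by blast
      have J: "((\<lambda>z. 1 / (z - w)) has_contour_integral 0) (circlepath 0 r)"
      proof (rule Cauchy_theorem_convex_simple[of _ "cball 0 r"])
        show "(\<lambda>z. 1 / (z - w)) holomorphic_on cball 0 r"
          using w by (intro holomorphic_intros) (auto simp: r_def)
      qed (use r in auto)
      show ?thesis
      proof (rule contour_integral_zero_of_geometric_steps[OF r(1) split[OF r J], where q = "\<lambda>z. z / w"])
        show "((\<lambda>z. h z / (z - w) * (z / w) ^ N * (1 - z / w)) has_contour_integral 0) (circlepath 0 r)" for N
        proof (rule has_contour_integral_eq)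
          show "((\<lambda>z. (- 1 / w ^ Suc N) * (h z * z powi int N)) has_contour_integral 0) (circlepath 0 r)"
            using has_contour_integral_lmul[OF zero[OF r(1), of "int N"], of "- 1 / w ^ Suc N"] by simp
        next
          fix z assume "z \<in> path_image (circlepath 0 r)"
          then have "z \<noteq> w" using r by auto
          then have "(1 - z / w) / (z - w) = - 1 / w" using w by (simp add: divide_simps)
          then have "h z / (z - w) * (z / w) ^ N * (1 - z / w) = h z * (z / w) ^ N * (- 1 / w)"
            using times_divide_eq_right[of "h z * (z / w) ^ N" "1 - z / w" "z - w"] by simp
          then show "- 1 / w ^ Suc N * (h z * z powi int N) = h z / (z - w) * (z / w) ^ N * (1 - z / w)"
            by (simp add: power_divide)
        qed
      qed (use B w in \<open>auto simp: r_def norm_divide\<close>)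
    qed
    have 2: "2 * pi * \<i> * residue \<phi> 0 + h w * (2 * pi * \<i>) = 0"
    proof -
      define r where "r = cmod w * 2"
      have r: "r > 0" "r \<noteq> cmod w" using w by (auto simp: r_def)
      obtain B where B: "B \<ge> 0" "\<And>z. cmod z = r \<Longrightarrow> cmod (h z / (z - w)) \<le> B" using cmp[OF r] by blast
      have J: "((\<lambda>z. 1 / (z - w)) has_contour_integral 2 * pi * \<i>) (circlepath 0 r)"
        using Cauchy_integral_circlepath_simple[of "\<lambda>z. 1" 0 r w] w by (auto simp: r_def)
      show ?thesis
      proof (rule contour_integral_zero_of_geometric_steps[OF r(1) split[OF r J], where q = "\<lambda>z. w / z"])
        show "((\<lambda>z. h z / (z - w) * (w / z) ^ N * (1 - w / z)) has_contour_integral 0) (circlepath 0 r)" for N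
        proof (rule has_contour_integral_eq)
          show "((\<lambda>z. w ^ N * (h z * z powi (- int (Suc N)))) has_contour_integral 0) (circlepath 0 r)"
            using has_contour_integral_lmul[OF zero[OF r(1), of "- int (Suc N)"], of "w ^ N"] by simp
        next
          fix z assume "z \<in> path_image (circlepath 0 r)"
          then have "z \<noteq> 0" "z \<noteq> w" using r by auto
          then show "w ^ N * (h z * z powi (- int (Suc N))) = h z / (z - w) * (w / z) ^ N * (1 - w / z)"
            by (simp add: power_int_minus field_simps power_int_def nat_add_distrib)
        qed
      qed (use B w in \<open>auto simp: r_def norm_divide\<close>)
    qed
    from 1 2 have "h w * (2 * pi * \<i>) = 0" by simp
    then show False using hw by simp
  qed
  then obtain i where i: "residue (\<lambda>z. h z * z powi i) 0 \<noteq> 0" by blast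
  define c where "c = cmod (residue (\<lambda>z. h z * z powi i) 0)"
  \<comment> \<open>The exponent is \<open>- i - 1\<close>: the length of the circle adds one power
    of \<open>r\<close> to \<open>r powi i\<close>.\<close>
  have "\<exists>z. cmod z = r \<and> c * r powi (- i - 1) \<le> cmod (h z)" if r: "r > 0" for r
  proof -
    have "continuous_on (sphere 0 r) (\<lambda>z. cmod (h z))"
      using r by (intro continuous_intros holomorphic_on_imp_continuous_on
            holomorphic_on_subset[OF h]) auto
    then obtain x where x: "x \<in> sphere 0 r" "\<And>z. z \<in> sphere 0 r \<Longrightarrow> cmod (h z) \<le> cmod (h x)"
      using continuous_attains_sup[of "sphere 0 r"] r by (metis compact_sphere less_le_not_le sphere_eq_empty)
    have "cmod (2 * pi * \<i> * residue (\<lambda>z. h z * z powi i) 0) \<le> (cmod (h x) * r powi i) * (2 * pi * r)"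
    proof (rule has_contour_integral_bound_circlepath[OF res[OF hol r]])
      fix z assume z: "cmod (z - 0) = r"
      show "cmod (h z * z powi i) \<le> cmod (h x) * r powi i"
        using z x(2)[of z] r by (auto simp: norm_mult norm_power_int intro!: mult_right_mono)
    qed (use r in auto)
    then have "c \<le> (cmod (h x) * r powi i) * r"
      by (simp add: c_def norm_mult)
    also have "\<dots> = cmod (h x) * r powi (i + 1)"
      using r by (simp add: power_int_add)
    finally have "c * r powi (- i - 1) \<le> cmod (h x) * r powi (i + 1) * r powi (- i - 1)"
      using r by (intro mult_right_mono) auto
    also have "\<dots> = cmod (h x) * r powi ((i + 1) + (- i - 1))"
      using power_int_add[of r "i + 1" "- i - 1"] r by simp
    finally have "c * r powi (- i - 1) \<le> cmod (h x)" by simp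
    then show ?thesis using x by auto
  qed
  moreover have "c > 0" using i by (simp add: c_def)
  ultimately show ?thesis using that by blast
qed

text \<open>At a common zero \<open>a\<close> both functions are \<open>z - a\<close> times their
  difference quotients, and the one of \<open>g\<close> does not vanish at \<open>a\<close>; the
  quotient of these continues \<open>f / g\<close>.\<close>

lemma holomorphic_divide_simple_zeros:
  assumes f: "f holomorphic_on S" and g: "g holomorphic_on S" and S: "open S"
    and zero: "\<And>z. z \<in> S \<Longrightarrow> g z = 0 \<Longrightarrow> f z = 0 \<and> deriv g z \<noteq> 0"
  obtains h where "h holomorphic_on S" "\<And>z. z \<in> S \<Longrightarrow> f z = g z * h z"
proof -
  define h where "h = (\<lambda>z. if g z = 0 then deriv f z / deriv g z else f z / g z)"
  have "h field_differentiable at a" if a: "a \<in> S" for a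
  proof -
    define F where "F = (\<lambda>z. if z = a then deriv f a else (f z - f a) / (z - a))"
    define G where "G = (\<lambda>z. if z = a then deriv g a else (g z - g a) / (z - a))"
    have F: "F holomorphic_on S" and G: "G holomorphic_on S"
      unfolding F_def G_def by (auto intro!: pole_lemma_open f g S)
    consider "g a \<noteq> 0" | "g a = 0" by blast
    then show ?thesis
    proof cases
      case 1
      have "open (S \<inter> g -` (-{0}))"
        using continuous_open_preimage[OF holomorphic_on_imp_continuous_on[OF g] S, of "-{0}"] by auto
      moreover have "(\<lambda>z. f z / g z) holomorphic_on (S \<inter> g -` (-{0}))"
        using f g by (intro holomorphic_intros) (auto intro: holomorphic_on_subset)
      then have "h holomorphic_on (S \<inter> g -` (-{0}))"
        by (rule holomorphic_transform) (auto simp: h_def)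
      ultimately show ?thesis using 1 a
        by (auto intro: holomorphic_on_imp_differentiable_at)
    next
      case 2
      have z: "f a = 0" "deriv g a \<noteq> 0" using zero[OF a 2] by auto
      have o: "open (S \<inter> G -` (-{0}))"
        using continuous_open_preimage[OF holomorphic_on_imp_continuous_on[OF G] S, of "-{0}"] by auto
      moreover have "(\<lambda>z. F z / G z) holomorphic_on (S \<inter> G -` (-{0}))"
        using F G by (intro holomorphic_intros) (auto intro: holomorphic_on_subset)
      then have "h holomorphic_on (S \<inter> G -` (-{0}))"
        by (rule holomorphic_transform) (auto simp: h_def F_def G_def 2 z)
      ultimately show ?thesis using 2 a z
        by (auto intro!: holomorphic_on_imp_differentiable_at[OF _ o] simp: G_def)
    qed
  qed
  then have "h holomorphic_on S"
    by (auto simp: holomorphic_on_def field_differentiable_at_within)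
  moreover have "f z = g z * h z" if "z \<in> S" for z
    using zero[OF that] by (auto simp: h_def)
  ultimately show ?thesis using that by blast
qed

section \<open>Mean value inequalities for powers\<close>

text \<open>Cauchy's formula at \<open>z0\<close> is used on circles of one fixed radius whose
  centres \<open>c\<close> fill a small disc. Averaging over \<open>c\<close> turns the curve
  integrals into area integrals by translation invariance alone, without polar coordinates.\<close>

lemma set_nn_integral_norm_ge_norm_centre:
  fixes f :: "complex \<Rightarrow> complex"
  assumes S: "open S" "cball z0 R \<subseteq> S" and f: "f holomorphic_on S" and R: "R > 0"
  shows "ennreal (R\<^sup>2 * cmod (f z0)) \<le> ennreal 6 * (\<integral>\<^sup>+z\<in>ball z0 R. ennreal (cmod (f z)) \<partial>lborel)"
proof -
  \<comment> \<open>\<open>s + s / 2 = R\<close> keeps the circles inside the ball, and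
    \<open>z0\<close> stays at distance at least \<open>s / 2\<close> from them.\<close>
  define s where "s = 2 * R / 3"
  have s: "s > 0" using R by (simp add: s_def)
  define \<gamma> where "\<gamma> = (\<lambda>t::real. of_real s * exp (2 * of_real pi * \<i> * of_real t))"
  have n\<gamma>: "cmod (\<gamma> t) = s" for t
    using s by (simp add: \<gamma>_def norm_mult)
  \<comment> \<open>Extension by zero makes the integrand measurable on the whole plane.\<close>
  define F where "F = (\<lambda>z. if z \<in> ball z0 R then f z else 0)"
  have F[measurable]: "F \<in> borel_measurable borel"
    unfolding F_def by (intro borel_measurable_continuous_on_if continuous_intros
        holomorphic_on_imp_continuous_on holomorphic_on_subset[OF f]) (use S in auto)
  have [measurable]: "\<gamma> \<in> borel_measurable borel"
    unfolding \<gamma>_def by (intro borel_measurable_continuous_onI continuous_intros)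
  have in_ball: "c + \<gamma> t \<in> ball z0 R" if "c \<in> ball z0 (s/2)" for c t
  proof -
    have "dist z0 (c + \<gamma> t) \<le> dist z0 c + cmod (\<gamma> t)"
      using norm_triangle_ineq4[of "z0 - c" "\<gamma> t"] by (simp add: dist_norm algebra_simps)
    then show ?thesis using that n\<gamma>[of t] by (simp add: s_def)
  qed
  have circ: "ennreal (cmod (f z0)) \<le> 2 * (\<integral>\<^sup>+t. ennreal (cmod (F (c + \<gamma> t))) * indicator {0..1} t \<partial>lborel)"
    if c: "c \<in> ball z0 (s/2)" for c
  proof -
    have sub: "cball c s \<subseteq> S"
    proof
      fix z assume "z \<in> cball c s"
      then have "dist z0 z \<le> R" using c dist_triangle[of z0 z c] by (simp add: s_def)
      then show "z \<in> S" using S by auto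
    qed
    have "((\<lambda>u. f u / (u - z0)) has_contour_integral (2 * of_real pi * \<i> * f z0)) (circlepath c s)"
      using c s by (intro Cauchy_integral_circlepath_simple holomorphic_on_subset[OF f sub]) (auto simp: dist_norm)
    then have I: "((\<lambda>t. f (c + \<gamma> t) / (c + \<gamma> t - z0) * (2 * pi * \<i> * \<gamma> t)) has_integral (2 * of_real pi * \<i> * f z0)) {0..1}"
    proof -
      have "circlepath c s t = c + \<gamma> t" for t
        by (simp add: circlepath \<gamma>_def)
      moreover have "vector_derivative (circlepath c s) (at t within {0..1}) = 2 * pi * \<i> * \<gamma> t"
        if "t \<in> {0..1}" for t
        using that by (simp add: vector_derivative_circlepath01 \<gamma>_def)
      ultimately show ?thesis
        using \<open>(_ has_contour_integral _) _\<close> unfolding has_contour_integral_def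
        by (subst has_integral_cong[where g = "\<lambda>t. f (circlepath c s t) / (circlepath c s t - z0) *
            vector_derivative (circlepath c s) (at t within {0..1})"]) auto
    qed
    have cont: "continuous_on {0..1} (\<lambda>t. cmod (f (c + \<gamma> t)))"
    proof -
      have "continuous_on {0..1} (\<lambda>t. c + \<gamma> t)" unfolding \<gamma>_def by (intro continuous_intros)
      moreover have "(\<lambda>t. c + \<gamma> t) ` {0..1} \<subseteq> S"
        using sub by (auto simp: dist_norm n\<gamma>)
      ultimately show ?thesis
        by (rule continuous_on_norm[OF continuous_on_compose2[OF holomorphic_on_imp_continuous_on[OF f]]])
    qed
    define J where "J = integral {0..1} (\<lambda>t. cmod (f (c + \<gamma> t)))"
    have J: "((\<lambda>t. cmod (f (c + \<gamma> t))) has_integral J) {0..1}"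
      unfolding J_def using cont by (intro integrable_integral integrable_continuous_real)
    have "cmod (2 * of_real pi * \<i> * f z0) \<le> 4 * pi * J"
    proof -
      have "norm (integral {0..1} (\<lambda>t. f (c + \<gamma> t) / (c + \<gamma> t - z0) * (2 * pi * \<i> * \<gamma> t)))
          \<le> integral {0..1} (\<lambda>t. 4 * pi * cmod (f (c + \<gamma> t)))"
      proof (rule integral_norm_bound_integral)
        fix t :: real
        have "s - s / 2 \<le> cmod (\<gamma> t) - cmod (z0 - c)"
          using c by (simp add: n\<gamma> dist_norm)
        also have "\<dots> \<le> cmod (c + \<gamma> t - z0)"
          using norm_triangle_ineq2[of "\<gamma> t" "z0 - c"] by (simp add: algebra_simps)
        finally have "s / 2 \<le> cmod (c + \<gamma> t - z0)" by simp
        moreover from this have "cmod (c + \<gamma> t - z0) > 0" using s by linarith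
        ultimately have "cmod (f (c + \<gamma> t)) / cmod (c + \<gamma> t - z0) \<le> cmod (f (c + \<gamma> t)) / (s / 2)"
          using s by (intro divide_left_mono) (auto intro!: mult_pos_pos)
        then have "cmod (f (c + \<gamma> t)) / cmod (c + \<gamma> t - z0) * (2 * pi * s)
            \<le> cmod (f (c + \<gamma> t)) / (s / 2) * (2 * pi * s)"
          using s by (intro mult_right_mono) auto
        also have "\<dots> = 4 * pi * cmod (f (c + \<gamma> t))" using s by simp
        finally show "norm (f (c + \<gamma> t) / (c + \<gamma> t - z0) * (2 * pi * \<i> * \<gamma> t)) \<le> 4 * pi * cmod (f (c + \<gamma> t))"
          by (simp add: norm_mult norm_divide n\<gamma>)
      qed (use I J in \<open>auto intro!: integrable_on_mult_right\<close>)
      also have "\<dots> = 4 * pi * J" by (simp add: J_def)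
      finally show ?thesis using I by (simp add: integral_unique)
    qed
    then have le: "cmod (f z0) \<le> 2 * J" by (simp add: norm_mult)
    have "ennreal J = (\<integral>\<^sup>+t. ennreal (cmod (f (c + \<gamma> t))) * indicator {0..1} t \<partial>lborel)"
      by (rule nn_integral_has_integral_lebesgue'[symmetric, OF _ J]) simp
    also have "\<dots> = (\<integral>\<^sup>+t. ennreal (cmod (F (c + \<gamma> t))) * indicator {0..1} t \<partial>lborel)"
      using in_ball[OF c] by (intro nn_integral_cong) (auto simp: F_def)
    finally have "ennreal J = \<dots>" .
    moreover have "ennreal (cmod (f z0)) \<le> 2 * ennreal J"
    proof -
      have "J \<ge> 0" using J by (rule has_integral_nonneg) simp
      have "ennreal (cmod (f z0)) \<le> ennreal (2 * J)" using le by (rule ennreal_leI)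
      also have "\<dots> = 2 * ennreal J" using \<open>J \<ge> 0\<close> by (simp add: ennreal_mult')
      finally show ?thesis .
    qed
    ultimately show ?thesis by simp
  qed
  define K where "K = (\<integral>\<^sup>+z\<in>ball z0 R. ennreal (cmod (f z)) \<partial>lborel)"
  have KF: "(\<integral>\<^sup>+z. ennreal (cmod (F z)) \<partial>lborel) = K"
    unfolding K_def by (intro nn_integral_cong) (auto simp: F_def indicator_def)
  have area: "emeasure lborel (ball z0 (s/2)) = ennreal (pi * (s/2)\<^sup>2)"
    using s by (simp add: emeasure_ball unit_ball_vol_2 ennreal_mult)
  have "ennreal (cmod (f z0)) * ennreal (pi * (s/2)\<^sup>2) = (\<integral>\<^sup>+c. ennreal (cmod (f z0)) * indicator (ball z0 (s/2)) c \<partial>lborel)"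
    by (subst nn_integral_cmult_indicator) (auto simp: area)
  also have "\<dots> \<le> (\<integral>\<^sup>+c. 2 * (\<integral>\<^sup>+t. ennreal (cmod (F (c + \<gamma> t))) * indicator {0..1} t \<partial>lborel) \<partial>lborel)"
    using circ by (intro nn_integral_mono) (auto simp: indicator_def)
  also have "\<dots> = 2 * (\<integral>\<^sup>+c. (\<integral>\<^sup>+t. ennreal (cmod (F (c + \<gamma> t))) * indicator {0..1} t \<partial>lborel) \<partial>lborel)"
    by (intro nn_integral_cmult) measurable
  also have "(\<integral>\<^sup>+c. (\<integral>\<^sup>+t. ennreal (cmod (F (c + \<gamma> t))) * indicator {0..1} t \<partial>lborel) \<partial>lborel)
      = (\<integral>\<^sup>+t. (\<integral>\<^sup>+c. ennreal (cmod (F (c + \<gamma> t))) * indicator {0..1} t \<partial>lborel) \<partial>lborel)"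
    by (rule lborel_pair.Fubini'[symmetric]) measurable
  \<comment> \<open>For fixed \<open>t\<close> the inner integral is that of \<open>F\<close>
    translated by \<open>\<gamma> t\<close>.\<close>
  also have "\<dots> = (\<integral>\<^sup>+t. K * indicator {0..1::real} t \<partial>lborel)"
  proof (intro nn_integral_cong)
    fix t :: real
    have "(\<integral>\<^sup>+c. ennreal (cmod (F (c + \<gamma> t))) * indicator {0..1} t \<partial>lborel)
       = (\<integral>\<^sup>+c. ennreal (cmod (F (c + \<gamma> t))) \<partial>lborel) * indicator {0..1} t"
      by (intro nn_integral_multc) measurable
    also have "(\<integral>\<^sup>+c. ennreal (cmod (F (c + \<gamma> t))) \<partial>lborel) = (\<integral>\<^sup>+c. ennreal (cmod (F c)) \<partial>distr lborel borel ((+) (\<gamma> t)))"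
      by (subst nn_integral_distr) (auto simp: add.commute)
    also have "\<dots> = K" by (simp add: lborel_distr_plus KF)
    finally show "(\<integral>\<^sup>+c. ennreal (cmod (F (c + \<gamma> t))) * indicator {0..1} t \<partial>lborel) = K * indicator {0..1} t" .
  qed
  also have "\<dots> = K" by (simp add: nn_integral_cmult_indicator)
  finally have "ennreal (cmod (f z0)) * ennreal (pi * (s/2)\<^sup>2) \<le> 2 * K" .
  then have "ennreal 3 * (ennreal (cmod (f z0)) * ennreal (pi * (s/2)\<^sup>2)) \<le> ennreal 3 * (2 * K)"
    by (intro mult_left_mono) auto
  \<comment> \<open>\<open>pi / 3 \<ge> 1\<close> absorbs the area \<open>pi * R^2 / 9\<close> after
    the multiplication by 3.\<close>
  moreover have "ennreal (R\<^sup>2 * cmod (f z0)) \<le> ennreal 3 * (ennreal (cmod (f z0)) * ennreal (pi * (s/2)\<^sup>2))"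
  proof -
    have "R\<^sup>2 * 1 \<le> R\<^sup>2 * (pi / 3)" using pi_ge_two pi_gt3 by (intro mult_left_mono) auto
    then have "R\<^sup>2 * cmod (f z0) \<le> R\<^sup>2 * (pi / 3) * cmod (f z0)" by (intro mult_right_mono) auto
    also have "\<dots> = 3 * (cmod (f z0) * (pi * (s/2)\<^sup>2))" by (simp add: s_def power2_eq_square)
    finally have "ennreal (R\<^sup>2 * cmod (f z0)) \<le> ennreal (3 * (cmod (f z0) * (pi * (s/2)\<^sup>2)))"
      by (rule ennreal_leI)
    also have "\<dots> = ennreal 3 * (ennreal (cmod (f z0)) * ennreal (pi * (s/2)\<^sup>2))"
      by (subst ennreal_mult, simp, simp, subst ennreal_mult) auto
    finally show ?thesis .
  qed
  moreover have "ennreal 3 * (2 * K) = ennreal 6 * K"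
    by (simp add: mult.assoc[symmetric] ennreal_mult[symmetric] ennreal_numeral[symmetric] del: ennreal_numeral)
  ultimately show ?thesis unfolding K_def by order
qed


text \<open>The case \<open>q = 1\<close> suffices: \<open>|f|\<close> is at most \<open>K\<close>
  plus \<open>K powr (1 - q) * |f| powr q\<close>, and a small height \<open>K\<close> is absorbed
  by the left side.\<close>

lemma holomorphic_submean_powr_ge_1:
  fixes f :: "complex \<Rightarrow> complex"
  assumes S: "open S" "cball z0 R \<subseteq> S" and f: "f holomorphic_on S" and R: "R > 0" and q: "q \<ge> 1"
  shows "ennreal (R\<^sup>2 * cmod (f z0) powr q)
    \<le> ennreal (12 * (12 * pi) powr (q - 1)) * (\<integral>\<^sup>+z\<in>ball z0 R. ennreal (cmod (f z) powr q) \<partial>lborel)"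
proof (cases "f z0 = 0")
  case False
  \<comment> \<open>With this height the constant part contributes \<open>6 * K * pi * R^2\<close>,
    exactly half of \<open>R^2 * |f z0|\<close>.\<close>
  define K where "K = cmod (f z0) / (12 * pi)"
  have K: "K > 0" using False by (simp add: K_def)
  have [measurable]: "(\<lambda>z. if z \<in> ball z0 R then f z else 0) \<in> borel_measurable borel"
    by (intro borel_measurable_continuous_on_if continuous_intros
        holomorphic_on_imp_continuous_on holomorphic_on_subset[OF f]) (use S in auto)
  define P where "P = (\<integral>\<^sup>+z\<in>ball z0 R. ennreal (cmod (f z) powr q) \<partial>lborel)"
  have P: "P = (\<integral>\<^sup>+z. ennreal (cmod (if z \<in> ball z0 R then f z else 0) powr q) \<partial>lborel)"
    unfolding P_def using q by (intro nn_integral_cong) (auto simp: indicator_def)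
  have pt: "x \<le> K + x powr q * K powr (1 - q)" if "x \<ge> 0" for x
  proof (cases "x \<le> K")
    case True then show ?thesis by (simp add: add_increasing2)
  next
    case False
    have "x = x powr q * x powr (1 - q)" using False K by (simp add: powr_add[symmetric])
    also have "\<dots> \<le> x powr q * K powr (1 - q)"
      using False K q by (intro mult_left_mono powr_mono2') auto
    finally show ?thesis using K by simp
  qed
  have "ennreal (R\<^sup>2 * cmod (f z0)) \<le> ennreal 6 * (\<integral>\<^sup>+z\<in>ball z0 R. ennreal (cmod (f z)) \<partial>lborel)"
    by (rule set_nn_integral_norm_ge_norm_centre[OF S f R])
  also have "(\<integral>\<^sup>+z\<in>ball z0 R. ennreal (cmod (f z)) \<partial>lborel)
      \<le> (\<integral>\<^sup>+z. ennreal K * indicator (ball z0 R) z + ennreal (K powr (1 - q)) * ennreal (cmod (if z \<in> ball z0 R then f z else 0) powr q) \<partial>lborel)"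
  proof (intro nn_integral_mono)
    fix z
    have "ennreal (cmod (f z)) \<le> ennreal (K + cmod (f z) powr q * K powr (1 - q))"
      by (intro ennreal_leI pt) simp
    also have "\<dots> = ennreal K + ennreal (K powr (1 - q)) * ennreal (cmod (f z) powr q)"
      using K by (simp add: ennreal_mult mult.commute)
    finally show "ennreal (cmod (f z)) * indicator (ball z0 R) z
       \<le> ennreal K * indicator (ball z0 R) z + ennreal (K powr (1 - q)) * ennreal (cmod (if z \<in> ball z0 R then f z else 0) powr q)"
      by (auto simp: indicator_def)
  qed
  also have "\<dots> = ennreal K * ennreal (pi * R\<^sup>2) + ennreal (K powr (1 - q)) * P"
  proof -
    define G where "G = (\<lambda>z. ennreal (cmod (if z \<in> ball z0 R then f z else 0) powr q))"
    have G: "G \<in> borel_measurable lborel" unfolding G_def by measurable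
    have "(\<integral>\<^sup>+z. ennreal K * indicator (ball z0 R) z + ennreal (K powr (1 - q)) * G z \<partial>lborel)
       = (\<integral>\<^sup>+z. ennreal K * indicator (ball z0 R) z \<partial>lborel) + (\<integral>\<^sup>+z. ennreal (K powr (1 - q)) * G z \<partial>lborel)"
      using G by (intro nn_integral_add borel_measurable_times_ennreal borel_measurable_indicator) auto
    also have "(\<integral>\<^sup>+z. ennreal K * indicator (ball z0 R) z \<partial>lborel) = ennreal K * ennreal (pi * R\<^sup>2)"
      using R by (subst nn_integral_cmult_indicator) (simp_all add: emeasure_ball unit_ball_vol_2)
    also have "(\<integral>\<^sup>+z. ennreal (K powr (1 - q)) * G z \<partial>lborel) = ennreal (K powr (1 - q)) * P"
      using nn_integral_cmult[OF G] by (simp add: P G_def)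
    finally show ?thesis unfolding G_def .
  qed
  finally have main: "ennreal (R\<^sup>2 * cmod (f z0)) \<le> ennreal 6 * (ennreal K * ennreal (pi * R\<^sup>2) + ennreal (K powr (1 - q)) * P)"
    by (simp add: mult_left_mono)
  show ?thesis
  proof (cases "P = \<infinity>")
    case True
    then show ?thesis unfolding P_def[symmetric] by (simp add: ennreal_mult_top)
  next
    case False
    then obtain i where i: "P = ennreal i" "i \<ge> 0" by (cases P) auto
    have "ennreal (R\<^sup>2 * cmod (f z0)) \<le> ennreal (6 * (K * (pi * R\<^sup>2) + K powr (1 - q) * i))"
      using main i K by (simp add: ennreal_mult)
    then have "R\<^sup>2 * cmod (f z0) \<le> 6 * (K * (pi * R\<^sup>2) + K powr (1 - q) * i)"
      using K R i by (subst (asm) ennreal_le_iff) auto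
    also have "\<dots> = 6 * (K * (pi * R\<^sup>2)) + 6 * K powr (1 - q) * i"
      by (simp only: distrib_left mult.assoc)
    also have "6 * (K * (pi * R\<^sup>2)) = R\<^sup>2 * cmod (f z0) / 2"
      by (simp add: K_def)
    finally have "R\<^sup>2 * cmod (f z0) \<le> 12 * K powr (1 - q) * i" by simp
    then have "R\<^sup>2 * cmod (f z0) * cmod (f z0) powr (q - 1) \<le> 12 * K powr (1 - q) * i * cmod (f z0) powr (q - 1)"
      by (intro mult_right_mono) auto
    also have "\<dots> = 12 * (K powr (1 - q) * cmod (f z0) powr (q - 1)) * i" by simp
    also have "K powr (1 - q) * cmod (f z0) powr (q - 1) = (12 * pi) powr (q - 1)"
    proof -
      have "cmod (f z0) powr (q - 1) = K powr (q - 1) * (12 * pi) powr (q - 1)"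
        unfolding powr_mult[symmetric] by (simp add: K_def)
      moreover have "K powr (1 - q) * K powr (q - 1) = 1"
        using K by (simp add: powr_add[symmetric])
      ultimately show ?thesis by simp
    qed
    also have "R\<^sup>2 * cmod (f z0) * cmod (f z0) powr (q - 1) = R\<^sup>2 * cmod (f z0) powr q"
      using \<open>f z0 \<noteq> 0\<close> by (simp add: powr_mult_base)
    finally have "ennreal (R\<^sup>2 * cmod (f z0) powr q) \<le> ennreal (12 * (12 * pi) powr (q - 1) * i)"
      by (rule ennreal_leI)
    then show ?thesis using i unfolding P_def[symmetric] by (simp add: ennreal_mult)
  qed
qed auto

text \<open>For small exponents the plain mean value inequality is applied at a maximum point of
  \<open>(R - |z - z0|) powr (2 / q) * |f z|\<close>, in the ball of half the remaining radius: there
  \<open>|f|\<close> is controlled by this maximum, which absorbs the factor \<open>|f| powr (1 - q)\<close>.\<close>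

lemma holomorphic_submean_powr_le_1:
  fixes f :: "complex \<Rightarrow> complex"
  assumes S: "open S" "cball z0 R \<subseteq> S" and f: "f holomorphic_on S" and R: "R > 0" and q: "0 < q" "q \<le> 1"
  shows "ennreal (R\<^sup>2 * cmod (f z0) powr q)
    \<le> ennreal (6 * 2 powr (2 / q)) * (\<integral>\<^sup>+z\<in>ball z0 R. ennreal (cmod (f z) powr q) \<partial>lborel)"
proof (cases "(\<integral>\<^sup>+z\<in>ball z0 R. ennreal (cmod (f z) powr q) \<partial>lborel) = \<infinity>")
  case True
  then show ?thesis by (simp add: ennreal_mult_top)
next
  case False
  then obtain i where i: "(\<integral>\<^sup>+z\<in>ball z0 R. ennreal (cmod (f z) powr q) \<partial>lborel) = ennreal i" "i \<ge> 0"
    by (cases "(\<integral>\<^sup>+z\<in>ball z0 R. ennreal (cmod (f z) powr q) \<partial>lborel)") auto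
  define m where "m = (\<lambda>z. (R - dist z0 z) powr (2 / q) * cmod (f z))"
  have "continuous_on (cball z0 R) m"
    unfolding m_def using q
    by (intro continuous_intros continuous_on_powr' holomorphic_on_imp_continuous_on holomorphic_on_subset[OF f S(2)]) auto
  then obtain w where w: "w \<in> cball z0 R" "\<And>z. z \<in> cball z0 R \<Longrightarrow> m z \<le> m w"
    using continuous_attains_sup[of "cball z0 R" m] R by (metis cball_eq_empty compact_cball less_asym)
  define M where "M = m w"
  have Mz: "R powr (2 / q) * cmod (f z0) \<le> M"
    using w(2)[of z0] R by (simp add: m_def M_def)
  show ?thesis
  proof (cases "f z0 = 0")
    case True then show ?thesis by simp
  next
    case False
    then have M: "M > 0" using Mz R by (smt (verit) mult_pos_pos powr_gt_zero zero_less_norm_iff)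
    \<comment> \<open>Half the distance from \<open>w\<close> to the sphere, positive because
      \<open>M > 0\<close> keeps the maximum point off the sphere.\<close>
    define r where "r = (R - dist z0 w) / 2"
    have r: "r > 0" using M w(1) by (auto simp: M_def m_def r_def less_le)
    have dr: "dist z0 w = R - 2 * r" by (simp add: r_def field_simps)
    have rle: "r \<le> R - dist z0 z" if "z \<in> cball w r" for z
      using that dist_triangle[of z0 z w] dr by simp
    have sub: "cball w r \<subseteq> cball z0 R"
      using rle r by force
    have bd: "cmod (f z) \<le> M * r powr - (2 / q)" if z: "z \<in> cball w r" for z
    proof -
      have "r powr (2 / q) * cmod (f z) \<le> m z"
        unfolding m_def using rle[OF z] r q by (intro mult_right_mono powr_mono2) auto
      also have "\<dots> \<le> M" using w(2) sub z by (auto simp: M_def)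
      finally show ?thesis using r by (simp add: powr_minus field_simps)
    qed
    \<comment> \<open>On the small ball \<open>|f| powr (1 - q)\<close> is at most \<open>A\<close>;
      since \<open>(1 - q) * (2 / q) = 2 / q - 2\<close>, the powers of \<open>r\<close> in
      \<open>A\<close> cancel those on the left.\<close>
    define A where "A = (M * r powr - (2 / q)) powr (1 - q)"
    have "ennreal (r\<^sup>2 * cmod (f w)) \<le> ennreal 6 * (\<integral>\<^sup>+z\<in>ball w r. ennreal (cmod (f z)) \<partial>lborel)"
      using sub S by (intro set_nn_integral_norm_ge_norm_centre[OF S(1) _ f r]) auto
    also have "(\<integral>\<^sup>+z\<in>ball w r. ennreal (cmod (f z)) \<partial>lborel)
        \<le> (\<integral>\<^sup>+z. ennreal A * (ennreal (cmod (f z) powr q) * indicator (ball z0 R) z) \<partial>lborel)"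
    proof (intro nn_integral_mono)
      fix z
      show "ennreal (cmod (f z)) * indicator (ball w r) z \<le> ennreal A * (ennreal (cmod (f z) powr q) * indicator (ball z0 R) z)"
      proof (cases "z \<in> ball w r")
        case True
        have zR: "z \<in> ball z0 R" using rle[of z] True r by auto
        have "cmod (f z) = cmod (f z) powr (1 - q) * cmod (f z) powr q"
          by (cases "f z = 0") (auto simp: powr_add[symmetric])
        also have "\<dots> \<le> A * cmod (f z) powr q"
          unfolding A_def using bd[of z] True q by (intro mult_right_mono powr_mono2) auto
        finally have "ennreal (cmod (f z)) \<le> ennreal (A * cmod (f z) powr q)" by (rule ennreal_leI)
        then show ?thesis using True zR by (simp add: ennreal_mult A_def)
      qed auto
    qed
    also have "\<dots> = ennreal A * ennreal i"
    proof -
      have [measurable]: "(\<lambda>z. if z \<in> ball z0 R then f z else 0) \<in> borel_measurable borel"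
        by (intro borel_measurable_continuous_on_if continuous_intros
            holomorphic_on_imp_continuous_on holomorphic_on_subset[OF f]) (use S in auto)
      have eq: "ennreal (cmod (f z) powr q) * indicator (ball z0 R) z
          = ennreal (cmod (if z \<in> ball z0 R then f z else 0) powr q)" for z
        using q by (auto simp: indicator_def)
      show ?thesis unfolding i(1)[symmetric] eq by (rule nn_integral_cmult) measurable
    qed
    finally have "ennreal (r\<^sup>2 * cmod (f w)) \<le> ennreal (6 * (A * i))"
      using i by (simp add: mult_left_mono ennreal_mult A_def)
    then have 1: "r\<^sup>2 * cmod (f w) \<le> 6 * (A * i)"
      using i by (subst (asm) ennreal_le_iff) (auto simp: A_def)
    have fw: "cmod (f w) = M * (2 * r) powr - (2 / q)"
    proof -
      have "M = (2 * r) powr (2 / q) * cmod (f w)" by (simp add: M_def m_def dr)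
      then have "M * (2 * r) powr - (2 / q) = ((2 * r) powr (2 / q) * (2 * r) powr - (2 / q)) * cmod (f w)"
        by (simp only: mult_ac)
      also have "(2 * r) powr (2 / q) * (2 * r) powr - (2 / q) = 1"
        using r by (simp add: powr_add[symmetric])
      finally show ?thesis by simp
    qed
    have r2: "r\<^sup>2 = r powr 2" using r by simp
    have e1: "r powr 2 * (M * (2 * r) powr - (2 / q)) = r powr (2 - 2 / q) * (M * 2 powr - (2 / q))"
    proof -
      have a: "(2 * r) powr - (2 / q) = 2 powr - (2 / q) * r powr - (2 / q)"
        by (rule powr_mult)
      have b: "r powr 2 * r powr - (2 / q) = r powr (2 - 2 / q)"
        by (simp only: powr_add[symmetric] diff_conv_add_uminus)
      have c: "r powr 2 * (M * (2 powr - (2 / q) * r powr - (2 / q)))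
          = (r powr 2 * r powr - (2 / q)) * (M * 2 powr - (2 / q))" by (simp only: mult_ac)
      show ?thesis unfolding a c b ..
    qed
    have e2: "A * i = M powr (1 - q) * r powr (2 - 2 / q) * i"
    proof -
      have "- (2 / q) * (1 - q) = 2 - 2 / q" using q by (simp add: field_simps)
      then show ?thesis unfolding A_def powr_mult powr_powr by simp
    qed
    have "r powr (2 - 2 / q) * (M * 2 powr - (2 / q)) \<le> 6 * (M powr (1 - q) * r powr (2 - 2 / q) * i)"
      using 1 unfolding fw r2 e1 e2 .
    also have "\<dots> = r powr (2 - 2 / q) * (6 * M powr (1 - q) * i)"
      by (simp only: mult_ac)
    finally have "M * 2 powr - (2 / q) \<le> 6 * M powr (1 - q) * i"
      by (rule mult_left_le_imp_le) (use r in simp)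
    then have "M * 2 powr - (2 / q) * (2 powr (2 / q) * M powr (q - 1)) \<le> 6 * M powr (1 - q) * i * (2 powr (2 / q) * M powr (q - 1))"
      by (intro mult_right_mono) auto
    moreover have "M * 2 powr - (2 / q) * (2 powr (2 / q) * M powr (q - 1)) = M powr q"
    proof -
      have "M * 2 powr - (2 / q) * (2 powr (2 / q) * M powr (q - 1))
          = (2 powr - (2 / q) * 2 powr (2 / q)) * (M * M powr (q - 1))" by (simp only: mult_ac)
      also have "2 powr - (2 / q) * 2 powr (2 / q) = (1::real)" by (simp add: powr_minus)
      finally show ?thesis using M by (simp add: powr_mult_base)
    qed
    moreover have "6 * M powr (1 - q) * i * (2 powr (2 / q) * M powr (q - 1)) = 6 * 2 powr (2 / q) * i"
    proof -
      have "6 * M powr (1 - q) * i * (2 powr (2 / q) * M powr (q - 1))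
          = 6 * 2 powr (2 / q) * i * (M powr (1 - q) * M powr (q - 1))" by (simp only: mult_ac)
      also have "M powr (1 - q) * M powr (q - 1) = 1" using M by (simp add: powr_add[symmetric])
      finally show ?thesis by simp
    qed
    ultimately have "M powr q \<le> 6 * 2 powr (2 / q) * i" by simp
    moreover have "R\<^sup>2 * cmod (f z0) powr q \<le> M powr q"
    proof -
      have "R\<^sup>2 * cmod (f z0) powr q = (R powr (2 / q) * cmod (f z0)) powr q"
        using R q by (simp add: powr_mult powr_powr)
      also have "\<dots> \<le> M powr q" using Mz q R by (intro powr_mono2) auto
      finally show ?thesis .
    qed
    ultimately have "ennreal (R\<^sup>2 * cmod (f z0) powr q) \<le> ennreal (6 * 2 powr (2 / q) * i)"
      by (intro ennreal_leI) linarith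
    then show ?thesis using i by (simp add: ennreal_mult)
  qed
qed

lemma holomorphic_submean_powr:
  fixes q :: real
  assumes q: "q > 0"
  obtains C where "C > 0"
    "\<And>S f z0 R. open S \<Longrightarrow> cball z0 R \<subseteq> S \<Longrightarrow> f holomorphic_on S \<Longrightarrow> R > 0 \<Longrightarrow>
      ennreal (R\<^sup>2 * cmod (f z0) powr q) \<le> ennreal C * (\<integral>\<^sup>+z\<in>ball z0 R. ennreal (cmod (f z) powr q) \<partial>lborel)"
proof (cases "q \<le> 1")
  case True
  then show ?thesis using holomorphic_submean_powr_le_1[OF _ _ _ _ q] by (intro that[of "6 * 2 powr (2 / q)"]) auto
next
  case False
  then show ?thesis using holomorphic_submean_powr_ge_1 by (intro that[of "12 * (12 * pi) powr (q - 1)"]) auto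
qed

section \<open>Exponential sums over locally bounded sequences\<close>

text \<open>Indices are counted, so equal values, such as nodes on a common circle, count
  separately.\<close>

definition window_bounded :: "'i set \<Rightarrow> ('i \<Rightarrow> real) \<Rightarrow> nat \<Rightarrow> bool" where
  "window_bounded I y K \<longleftrightarrow>
     (\<forall>t. finite {i\<in>I. t \<le> y i \<and> y i \<le> t + 1} \<and> card {i\<in>I. t \<le> y i \<and> y i \<le> t + 1} \<le> K)"

lemma window_boundedD:
  assumes "window_bounded I y K"
  shows "finite {i\<in>I. t \<le> y i \<and> y i \<le> t + 1}" "card {i\<in>I. t \<le> y i \<and> y i \<le> t + 1} \<le> K"
  using assms by (auto simp: window_bounded_def)

lemma window_bounded_near:
  fixes b :: real
  assumes w: "window_bounded I y K"
  shows "finite {i\<in>I. \<bar>y i - x\<bar> \<le> b}"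
    and "card {i\<in>I. \<bar>y i - x\<bar> \<le> b} \<le> K * (nat \<lceil>2 * b\<rceil> + 1)"
proof -
  define W where "W = (\<lambda>j::nat. {i\<in>I. x - b + real j \<le> y i \<and> y i \<le> x - b + real j + 1})"
  have sub: "{i\<in>I. \<bar>y i - x\<bar> \<le> b} \<subseteq> (\<Union>j\<in>{..nat \<lceil>2 * b\<rceil>}. W j)"
  proof
    fix i assume i: "i \<in> {i\<in>I. \<bar>y i - x\<bar> \<le> b}"
    define j where "j = nat \<lfloor>y i - (x - b)\<rfloor>"
    have "y i - (x - b) \<ge> 0" using i by auto
    then have "real j \<le> y i - (x - b)" "y i - (x - b) \<le> real j + 1" unfolding j_def by linarith+
    moreover have "j \<le> nat \<lceil>2 * b\<rceil>" using i unfolding j_def by (auto intro!: nat_mono) linarith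
    ultimately show "i \<in> (\<Union>j\<in>{..nat \<lceil>2 * b\<rceil>}. W j)" using i by (auto simp: W_def algebra_simps intro!: bexI[of _ j])
  qed
  have fin: "finite (\<Union>j\<in>{..nat \<lceil>2 * b\<rceil>}. W j)"
    using window_boundedD(1)[OF w] by (auto simp: W_def)
  then show "finite {i\<in>I. \<bar>y i - x\<bar> \<le> b}" using sub finite_subset by blast
  have "card {i\<in>I. \<bar>y i - x\<bar> \<le> b} \<le> card (\<Union>j\<in>{..nat \<lceil>2 * b\<rceil>}. W j)"
    by (rule card_mono[OF fin sub])
  also have "\<dots> \<le> (\<Sum>j\<in>{..nat \<lceil>2 * b\<rceil>}. card (W j))" by (rule card_UN_le) simp
  also have "\<dots> \<le> (\<Sum>j\<in>{..nat \<lceil>2 * b\<rceil>}. K)"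
    unfolding W_def by (intro sum_mono window_boundedD(2)[OF w])
  finally show "card {i\<in>I. \<bar>y i - x\<bar> \<le> b} \<le> K * (nat \<lceil>2 * b\<rceil> + 1)" by (simp add: mult.commute)
qed

lemma window_bounded_of_int: "window_bounded UNIV real_of_int 2"
  unfolding window_bounded_def
proof
  fix t :: real
  have s: "{i\<in>UNIV. t \<le> real_of_int i \<and> real_of_int i \<le> t + 1} \<subseteq> {\<lceil>t\<rceil>, \<lceil>t\<rceil> + 1}"
  proof
    fix i assume "i \<in> {i\<in>UNIV. t \<le> real_of_int i \<and> real_of_int i \<le> t + 1}"
    then have "\<lceil>t\<rceil> \<le> i" "i \<le> \<lceil>t\<rceil> + 1" by (auto simp: ceiling_le_iff) linarith
    then show "i \<in> {\<lceil>t\<rceil>, \<lceil>t\<rceil> + 1}" by auto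
  qed
  show "finite {i\<in>UNIV. t \<le> real_of_int i \<and> real_of_int i \<le> t + 1} \<and> card {i\<in>UNIV. t \<le> real_of_int i \<and> real_of_int i \<le> t + 1} \<le> 2"
    using finite_subset[OF s] card_mono[OF _ s] by auto
qed

lemma window_bounded_close:
  fixes y :: "int \<Rightarrow> real"
  assumes D: "\<And>i. \<bar>y i - of_int i\<bar> \<le> D"
  shows "window_bounded I y (2 * (nat \<lceil>2 * (D + 1)\<rceil> + 1))"
  unfolding window_bounded_def
proof
  fix t
  have s: "{i\<in>I. t \<le> y i \<and> y i \<le> t + 1} \<subseteq> {i\<in>UNIV. \<bar>real_of_int i - t\<bar> \<le> D + 1}"
    using D by (auto simp: abs_le_iff) (smt (verit))+
  show "finite {i\<in>I. t \<le> y i \<and> y i \<le> t + 1} \<and> card {i\<in>I. t \<le> y i \<and> y i \<le> t + 1} \<le> 2 * (nat \<lceil>2 * (D + 1)\<rceil> + 1)"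
    using window_bounded_near[OF window_bounded_of_int, where x = t and b = "D + 1"] finite_subset[OF s] card_mono[OF _ s]
    by (meson le_trans)
qed

lemma window_bounded_countable:
  assumes "window_bounded I y K"
  shows "countable I"
proof -
  have "I = (\<Union>n::nat. {i\<in>I. \<bar>y i - 0\<bar> \<le> real n})"
    using real_arch_simple by fastforce
  moreover have "countable (\<Union>n::nat. {i\<in>I. \<bar>y i - 0\<bar> \<le> real n})"
    by (rule countable_UN[OF countableI_type], rule countable_finite, rule window_bounded_near(1)[OF assms, of 0])
  ultimately show ?thesis by (rule ssubst)
qed

lemma sum_power_nat_abs_le:
  assumes \<rho>: "0 \<le> \<rho>" "\<rho> < (1::real)" and M: "finite (M::int set)"
  shows "(\<Sum>m\<in>M. \<rho> ^ nat \<bar>m\<bar>) \<le> 2 / (1 - \<rho>)"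
proof -
  \<comment> \<open>\<open>m \<mapsto> |m|\<close> is injective on either half line, which gives the
    factor 2.\<close>
  have *: "(\<Sum>m\<in>A. \<rho> ^ nat \<bar>m\<bar>) \<le> 1 / (1 - \<rho>)" if A: "finite A" "inj_on (\<lambda>m. nat \<bar>m\<bar>) A" for A :: "int set"
  proof -
    have "(\<Sum>m\<in>A. \<rho> ^ nat \<bar>m\<bar>) = (\<Sum>n\<in>(\<lambda>m. nat \<bar>m\<bar>) ` A. \<rho> ^ n)"
      using A by (simp add: sum.reindex)
    also have "\<dots> \<le> (\<Sum>n. \<rho> ^ n)"
      using A \<rho> by (intro sum_le_suminf summable_geometric) auto
    also have "\<dots> = 1 / (1 - \<rho>)" using \<rho> by (simp add: suminf_geometric)
    finally show ?thesis .
  qed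
  have "M = (M \<inter> {0..}) \<union> (M \<inter> {..<0})" by auto
  then have "(\<Sum>m\<in>M. \<rho> ^ nat \<bar>m\<bar>) = (\<Sum>m\<in>(M \<inter> {0..}) \<union> (M \<inter> {..<0}). \<rho> ^ nat \<bar>m\<bar>)" by simp
  also have "\<dots> = (\<Sum>m\<in>M \<inter> {0..}. \<rho> ^ nat \<bar>m\<bar>) + (\<Sum>m\<in>M \<inter> {..<0}. \<rho> ^ nat \<bar>m\<bar>)"
    using M by (intro sum.union_disjoint) auto
  also have "\<dots> \<le> 1 / (1 - \<rho>) + 1 / (1 - \<rho>)"
    using M by (intro add_mono *) (auto simp: inj_on_def)
  finally show ?thesis by simp
qed

definition exp_sum_bound :: "real \<Rightarrow> nat \<Rightarrow> real" where
  "exp_sum_bound \<eta> K = real K * exp \<eta> * (2 / (1 - exp (- \<eta>)))"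

lemma exp_sum_bound_nonneg: "\<eta> > 0 \<Longrightarrow> exp_sum_bound \<eta> K \<ge> 0"
  by (simp add: exp_sum_bound_def)

text \<open>Indices are grouped by the integer part of \<open>y i - x\<close>; each group has at
  most \<open>K\<close> members and the groups form a two-sided geometric series. The bound does not
  depend on \<open>x\<close> or \<open>F\<close>.\<close>

lemma exp_sum_le:
  assumes w: "window_bounded I y K" and \<eta>: "\<eta> > 0" and F: "finite F" "F \<subseteq> I"
  shows "(\<Sum>i\<in>F. exp (- \<eta> * \<bar>y i - x\<bar>)) \<le> exp_sum_bound \<eta> K"
proof -
  define m where "m = (\<lambda>i. \<lfloor>y i - x\<rfloor>)"
  have "(\<Sum>i\<in>F. exp (- \<eta> * \<bar>y i - x\<bar>)) \<le> (\<Sum>i\<in>F. exp \<eta> * exp (- \<eta>) ^ nat \<bar>m i\<bar>)"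
  proof (intro sum_mono)
    fix i
    have "of_int \<bar>m i\<bar> \<le> \<bar>y i - x\<bar> + 1" unfolding m_def by linarith
    then have "\<eta> * of_int \<bar>m i\<bar> \<le> \<eta> * (\<bar>y i - x\<bar> + 1)" using \<eta> by (intro mult_left_mono) auto
    then have "exp (- \<eta> * \<bar>y i - x\<bar>) \<le> exp (\<eta> + real (nat \<bar>m i\<bar>) * (- \<eta>))"
      by (simp add: algebra_simps)
    also have "\<dots> = exp \<eta> * exp (- \<eta>) ^ nat \<bar>m i\<bar>"
      by (simp only: exp_add exp_of_nat_mult)
    finally show "exp (- \<eta> * \<bar>y i - x\<bar>) \<le> exp \<eta> * exp (- \<eta>) ^ nat \<bar>m i\<bar>" .
  qed
  also have "\<dots> = (\<Sum>k\<in>m ` F. \<Sum>i\<in>{i\<in>F. m i = k}. exp \<eta> * exp (- \<eta>) ^ nat \<bar>m i\<bar>)"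
    by (rule sum.image_gen[OF F(1)])
  also have "\<dots> \<le> (\<Sum>k\<in>m ` F. real K * (exp \<eta> * exp (- \<eta>) ^ nat \<bar>k\<bar>))"
  proof (intro sum_mono)
    fix k
    have s: "{i\<in>F. m i = k} \<subseteq> {i\<in>I. x + of_int k \<le> y i \<and> y i \<le> x + of_int k + 1}"
      using F(2) unfolding m_def by (auto simp: le_floor_iff floor_le_iff) linarith+
    have "card {i\<in>F. m i = k} \<le> K"
      using card_mono[OF window_boundedD(1)[OF w] s] window_boundedD(2)[OF w] by (meson le_trans)
    then have "real (card {i\<in>F. m i = k}) * (exp \<eta> * exp (- \<eta>) ^ nat \<bar>k\<bar>) \<le> real K * (exp \<eta> * exp (- \<eta>) ^ nat \<bar>k\<bar>)"
      by (intro mult_right_mono) auto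
    moreover have "(\<Sum>i\<in>{i\<in>F. m i = k}. exp \<eta> * exp (- \<eta>) ^ nat \<bar>m i\<bar>) = (\<Sum>i\<in>{i\<in>F. m i = k}. exp \<eta> * exp (- \<eta>) ^ nat \<bar>k\<bar>)"
      by (intro sum.cong) auto
    ultimately show "(\<Sum>i\<in>{i\<in>F. m i = k}. exp \<eta> * exp (- \<eta>) ^ nat \<bar>m i\<bar>) \<le> real K * (exp \<eta> * exp (- \<eta>) ^ nat \<bar>k\<bar>)"
      by simp
  qed
  also have "\<dots> = real K * exp \<eta> * (\<Sum>k\<in>m ` F. exp (- \<eta>) ^ nat \<bar>k\<bar>)"
    by (simp add: sum_distrib_left mult.assoc)
  also have "\<dots> \<le> real K * exp \<eta> * (2 / (1 - exp (- \<eta>)))"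
    using F \<eta> by (intro mult_left_mono sum_power_nat_abs_le) auto
  finally show ?thesis by (simp add: exp_sum_bound_def)
qed

lemma exp_summable_on:
  assumes w: "window_bounded I y K" and \<eta>: "\<eta> > 0"
  shows "(\<lambda>i. exp (- \<eta> * \<bar>y i - x\<bar>)) summable_on I"
    and "(\<Sum>\<^sub>\<infinity>i\<in>I. exp (- \<eta> * \<bar>y i - x\<bar>)) \<le> exp_sum_bound \<eta> K"
proof -
  show s: "(\<lambda>i. exp (- \<eta> * \<bar>y i - x\<bar>)) summable_on I"
  proof (rule nonneg_bdd_above_summable_on)
    show "bdd_above (sum (\<lambda>i. exp (- \<eta> * \<bar>y i - x\<bar>)) ` {F. F \<subseteq> I \<and> finite F})"
      by (rule bdd_aboveI2[where M = "exp_sum_bound \<eta> K"]) (use exp_sum_le[OF w \<eta>] in auto)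
  qed auto
  show "(\<Sum>\<^sub>\<infinity>i\<in>I. exp (- \<eta> * \<bar>y i - x\<bar>)) \<le> exp_sum_bound \<eta> K"
    by (rule infsum_le_finite_sums[OF s]) (use exp_sum_le[OF w \<eta>] in auto)
qed

lemma nn_integral_count_space_le_finite_sums:
  fixes f :: "'i \<Rightarrow> ennreal"
  assumes I: "countable I" and B: "\<And>F. finite F \<Longrightarrow> F \<subseteq> I \<Longrightarrow> sum f F \<le> B"
  shows "(\<integral>\<^sup>+i. f i \<partial>count_space I) \<le> B"
proof (cases "finite I")
  case True
  then show ?thesis using B[of I] by (simp add: nn_integral_count_space_finite)
next
  case False
  then have g: "bij_betw (from_nat_into I) UNIV I"
    using I by (simp add: bij_betw_from_nat_into)
  have "(\<integral>\<^sup>+i. f i \<partial>count_space I) = (\<integral>\<^sup>+n. f (from_nat_into I n) \<partial>count_space UNIV)"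
    by (rule nn_integral_bij_count_space[OF g, symmetric])
  also have "\<dots> = (\<Sum>n. f (from_nat_into I n))" by (simp add: nn_integral_count_space_nat)
  also have "\<dots> = (SUP n. \<Sum>k<n. f (from_nat_into I k))" by (simp add: suminf_eq_SUP)
  also have "\<dots> \<le> B"
  proof (rule SUP_least)
    fix n
    have "(\<Sum>k<n. f (from_nat_into I k)) = sum f (from_nat_into I ` {..<n})"
      using g by (subst sum.reindex) (auto simp: bij_betw_def inj_on_def)
    also have "\<dots> \<le> B" using g by (intro B) (auto simp: bij_betw_def)
    finally show "(\<Sum>k<n. f (from_nat_into I k)) \<le> B" .
  qed
  finally show ?thesis .
qed

lemma exp_nn_integral_le:
  assumes w: "window_bounded I y K" and \<eta>: "\<eta> > 0"
  shows "(\<integral>\<^sup>+i. ennreal (exp (- \<eta> * \<bar>y i - x\<bar>)) \<partial>count_space I) \<le> ennreal (exp_sum_bound \<eta> K)"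
proof (rule nn_integral_count_space_le_finite_sums[OF window_bounded_countable[OF w]])
  fix F assume "finite F" "F \<subseteq> I"
  then show "(\<Sum>i\<in>F. ennreal (exp (- \<eta> * \<bar>y i - x\<bar>))) \<le> ennreal (exp_sum_bound \<eta> K)"
    using exp_sum_le[OF w \<eta>] by (auto simp: sum_ennreal intro: ennreal_leI)
qed

section \<open>Quasi-norms\<close>

lemma Lp_norm_finite_eq:
  assumes "p \<noteq> \<infinity>" "(\<integral>\<^sup>+x. ennreal (cmod (f x) powr enn2real p) \<partial>M) = ennreal i" "i \<ge> 0"
  shows "Lp_norm p M f = ennreal (i powr (1 / enn2real p))"
  using assms by (simp add: Lp_norm_def)

lemma enn2real_pos: "0 < p \<Longrightarrow> p \<noteq> \<infinity> \<Longrightarrow> enn2real p > 0"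
  by (simp add: enn2real_positive_iff less_top)

lemma Lp_norm_le_iff:
  assumes p: "0 < p" "p \<noteq> \<infinity>" and B: "B \<ge> 0"
  shows "Lp_norm p M f \<le> ennreal B \<longleftrightarrow>
    (\<integral>\<^sup>+x. ennreal (cmod (f x) powr enn2real p) \<partial>M) \<le> ennreal (B powr enn2real p)"
proof (cases "(\<integral>\<^sup>+x. ennreal (cmod (f x) powr enn2real p) \<partial>M) = \<infinity>")
  case True
  then show ?thesis using p by (simp add: Lp_norm_def top_unique)
next
  case False
  define q where "q = enn2real p"
  have q: "q > 0" using enn2real_pos[OF p] by (simp add: q_def)
  obtain i where i: "(\<integral>\<^sup>+x. ennreal (cmod (f x) powr q) \<partial>M) = ennreal i" "i \<ge> 0"
    using False by (cases "(\<integral>\<^sup>+x. ennreal (cmod (f x) powr enn2real p) \<partial>M)") (auto simp: q_def)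
  have "i powr (1 / q) \<le> B \<longleftrightarrow> i \<le> B powr q"
  proof
    assume "i powr (1 / q) \<le> B"
    then have "(i powr (1 / q)) powr q \<le> B powr q" using q by (intro powr_mono2) auto
    then show "i \<le> B powr q" using q i by (simp add: powr_powr)
  next
    assume "i \<le> B powr q"
    then have "i powr (1 / q) \<le> (B powr q) powr (1 / q)" using q i by (intro powr_mono2) auto
    then show "i powr (1 / q) \<le> B" using q B by (simp add: powr_powr)
  qed
  then show ?thesis
    using Lp_norm_finite_eq[OF p(2) i[unfolded q_def]] i B by (simp add: q_def)
qed

text \<open>Comparing integrals of p-th powers avoids any triangle inequality, so
  \<open>p < 1\<close> is included; the two measures may live on different spaces, which links
  planar and discrete norms.\<close>

lemma Lp_norm_le_multI:
  assumes p: "0 < p" "p \<noteq> \<infinity>" and C: "C > 0"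
    and le: "(\<integral>\<^sup>+x. ennreal (cmod (f x) powr enn2real p) \<partial>M)
      \<le> ennreal (C powr enn2real p) * (\<integral>\<^sup>+x. ennreal (cmod (g x) powr enn2real p) \<partial>N)"
  shows "Lp_norm p M f \<le> ennreal C * Lp_norm p N g"
proof (cases "(\<integral>\<^sup>+x. ennreal (cmod (g x) powr enn2real p) \<partial>N) = \<infinity>")
  case True
  then have "Lp_norm p N g = \<infinity>" using p by (simp add: Lp_norm_def)
  then show ?thesis using C by (simp add: ennreal_mult_top)
next
  case False
  define q where "q = enn2real p"
  have q: "q > 0" using enn2real_pos[OF p] by (simp add: q_def)
  obtain i where i: "(\<integral>\<^sup>+x. ennreal (cmod (g x) powr q) \<partial>N) = ennreal i" "i \<ge> 0"
    using False by (cases "(\<integral>\<^sup>+x. ennreal (cmod (g x) powr enn2real p) \<partial>N)") (auto simp: q_def)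
  have "ennreal C * Lp_norm p N g = ennreal (C * i powr (1 / q))"
    using Lp_norm_finite_eq[OF p(2) i[unfolded q_def]] C by (simp add: q_def ennreal_mult)
  moreover have "(C * i powr (1 / q)) powr q = C powr q * i"
    using q i by (simp add: powr_mult powr_powr)
  ultimately show ?thesis
    using Lp_norm_le_iff[OF p, of "C * i powr (1 / q)" M f] C le i by (simp add: q_def ennreal_mult)
qed

lemma Lp_norm_infty: "Lp_norm \<infinity> M f = esssup M (\<lambda>x. ennreal (cmod (f x)))"
  by (simp add: Lp_norm_def)

lemma lp_norm_infty_le_iff: "lp_norm \<infinity> A a \<le> B \<longleftrightarrow> (\<forall>x\<in>A. ennreal (cmod (a x)) \<le> B)"
proof
  assume "lp_norm \<infinity> A a \<le> B"
  moreover have "AE x in count_space A. ennreal (cmod (a x)) \<le> lp_norm \<infinity> A a"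
    unfolding lp_norm_def Lp_norm_infty by (rule esssup_AE)
  ultimately show "\<forall>x\<in>A. ennreal (cmod (a x)) \<le> B" by (auto simp: AE_count_space)
next
  assume "\<forall>x\<in>A. ennreal (cmod (a x)) \<le> B"
  then show "lp_norm \<infinity> A a \<le> B"
    unfolding lp_norm_def Lp_norm_infty by (intro esssup_I) (auto simp: AE_count_space)
qed

lemma norm_le_lp_norm:
  assumes p: "0 < p" and x: "x \<in> A"
  shows "ennreal (cmod (a x)) \<le> lp_norm p A a"
proof (cases "p = \<infinity>")
  case True
  then show ?thesis using lp_norm_infty_le_iff[of A a "lp_norm \<infinity> A a"] x by auto
next
  case False
  show ?thesis
  proof (cases "lp_norm p A a = \<infinity>")
    case False
    then obtain B where B: "lp_norm p A a = ennreal B" "B \<ge> 0" by (cases "lp_norm p A a") auto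
    define q where "q = enn2real p"
    have q: "q > 0" using enn2real_pos[OF p \<open>p \<noteq> \<infinity>\<close>] by (simp add: q_def)
    have "ennreal (cmod (a x) powr q) \<le> (\<integral>\<^sup>+x. ennreal (cmod (a x) powr q) \<partial>count_space A)"
      by (rule nn_integral_ge_point[OF x, of "\<lambda>x. ennreal (cmod (a x) powr q)"])
    also have "\<dots> \<le> ennreal (B powr q)"
      using Lp_norm_le_iff[OF p \<open>p \<noteq> \<infinity>\<close> B(2), of "count_space A" a] B unfolding lp_norm_def q_def by simp
    finally have "cmod (a x) powr q \<le> B powr q" by simp
    then have "cmod (a x) \<le> B" using q B by (metis powr_less_mono2 norm_ge_zero not_le)
    then show ?thesis using B by (simp add: ennreal_leI)
  qed simp
qed

section \<open>Weights in the logarithmic coordinate\<close>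

text \<open>Everything is measured in the coordinate \<open>lx z = 2 * \<alpha> * ln |z| - c\<close>, in which the weight
  is a Gaussian and the monomial of degree \<open>n\<close> peaks at \<open>n\<close>.\<close>

locale log_weight =
  fixes \<alpha> c :: real
  assumes alpha: "\<alpha> > 0"
begin

definition lx :: "complex \<Rightarrow> real" where "lx z = 2 * \<alpha> * ln (cmod z) - c"

text \<open>With \<open>c = 2/p\<close> the factor \<open>cmod z powr c\<close> absorbs the scale:
  planar measure becomes \<open>dA / |z|^2\<close>, which is invariant under dilations.\<close>

definition wt :: "complex \<Rightarrow> real" where "wt z = cmod z powr c * exp (- \<alpha> * (ln (cmod z))\<^sup>2)"

definition V :: "(complex \<Rightarrow> complex) \<Rightarrow> complex \<Rightarrow> real" where "V f z = cmod (f z) * wt z"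

lemma norm_eq_lx: "z \<noteq> 0 \<Longrightarrow> cmod z = exp ((lx z + c) / (2 * \<alpha>))"
  using alpha by (simp add: lx_def)

lemma wt_eq_lx:
  assumes "z \<noteq> 0"
  shows "wt z = exp ((c\<^sup>2 - (lx z)\<^sup>2) / (4 * \<alpha>))"
proof -
  have "wt z = exp (c * ln (cmod z) - \<alpha> * (ln (cmod z))\<^sup>2)"
    using assms by (simp add: wt_def powr_def exp_add[symmetric])
  also have "c * ln (cmod z) - \<alpha> * (ln (cmod z))\<^sup>2 = (c\<^sup>2 - (lx z)\<^sup>2) / (4 * \<alpha>)"
    using alpha by (simp add: lx_def field_simps power2_eq_square)
  finally show ?thesis .
qed

lemma wt_pos: "z \<noteq> 0 \<Longrightarrow> wt z > 0" by (simp add: wt_eq_lx)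

lemma V_nonneg: "V f z \<ge> 0"
  by (simp add: V_def wt_def)

lemma norm_le_iff_lx: "z \<noteq> 0 \<Longrightarrow> w \<noteq> 0 \<Longrightarrow> cmod z \<le> cmod w \<longleftrightarrow> lx z \<le> lx w"
  using alpha by (simp add: lx_def)

lemma norm_quotient_lx: "z \<noteq> 0 \<Longrightarrow> w \<noteq> 0 \<Longrightarrow> cmod (z / w) = exp ((lx z - lx w) / (2 * \<alpha>))"
  by (simp add: norm_divide norm_eq_lx exp_diff[symmetric] diff_divide_distrib[symmetric])

definition rad :: "real \<Rightarrow> real" where "rad x = exp ((x + c) / (2 * \<alpha>))"

lemma rad_pos [simp]: "rad x > 0" by (simp add: rad_def)

lemma lx_eqI: "cmod z = rad x \<Longrightarrow> lx z = x"
  using alpha by (simp add: lx_def rad_def)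

lemma norm_eq_rad: "z \<noteq> 0 \<Longrightarrow> cmod z = rad (lx z)"
  by (simp add: norm_eq_lx rad_def)

text \<open>Completing the square: the width of the Gaussian does not depend on \<open>n\<close>, so
  all degrees look alike after a shift of \<open>lx\<close>.\<close>

lemma norm_powi_wt:
  fixes n :: int
  assumes "z \<noteq> 0"
  shows "cmod z powi n * wt z = exp ((of_int n + c)\<^sup>2 / (4 * \<alpha>)) * exp (- ((lx z - of_int n)\<^sup>2 / (4 * \<alpha>)))"
proof -
  have "cmod z powi n = exp (of_int n * ((lx z + c) / (2 * \<alpha>)))"
    using assms by (simp add: norm_eq_lx exp_power_int mult.commute)
  moreover have "of_int n * ((lx z + c) / (2 * \<alpha>)) + (c\<^sup>2 - (lx z)\<^sup>2) / (4 * \<alpha>)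
      = (of_int n + c)\<^sup>2 / (4 * \<alpha>) + - ((lx z - of_int n)\<^sup>2 / (4 * \<alpha>))"
    using alpha by (simp add: divide_simps) (simp add: algebra_simps power2_eq_square)
  ultimately show ?thesis
    unfolding wt_eq_lx[OF assms] by (simp only: exp_add[symmetric])
qed

lemma V_shift:
  fixes n :: int
  assumes "z \<noteq> 0"
  shows "V f z = cmod (f z * z powi (- n)) * exp ((of_int n + c)\<^sup>2 / (4 * \<alpha>)) * exp (- ((lx z - of_int n)\<^sup>2 / (4 * \<alpha>)))"
proof -
  have "cmod (f z * z powi (- n)) * (cmod z powi n * wt z) = cmod (f z) * wt z"
    using assms by (simp add: norm_mult norm_power_int power_int_minus norm_inverse)
  then show ?thesis
    unfolding norm_powi_wt[OF assms] V_def by (simp add: mult.assoc)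
qed

text \<open>Multiplying by \<open>z powi (- n)\<close> with \<open>n\<close> close to \<open>x\<close> makes the weight comparable to a constant
  on the annulus around \<open>lx = x\<close>, so that local estimates for holomorphic functions survive.\<close>

definition ann_const :: "real \<Rightarrow> real" where "ann_const b = exp ((b + 1)\<^sup>2 / (4 * \<alpha>))"

lemma ann_const_pos [simp]: "ann_const b > 0" by (simp add: ann_const_def)

lemma V_local:
  fixes x b :: real and f :: "complex \<Rightarrow> complex"
  obtains h :: "complex \<Rightarrow> complex" and n :: int where
    "h = (\<lambda>z. of_real (exp ((of_int n + c)\<^sup>2 / (4 * \<alpha>))) * (f z * z powi (- n)))"
    "\<And>z. z \<noteq> 0 \<Longrightarrow> V f z \<le> cmod (h z)"
    "\<And>z. z \<noteq> 0 \<Longrightarrow> \<bar>lx z - x\<bar> \<le> b \<Longrightarrow> cmod (h z) \<le> ann_const b * V f z"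
proof -
  \<comment> \<open>Any integer within distance 1 of \<open>x\<close> would do; this distance is the
    \<open>+ 1\<close> in \<open>ann_const\<close>.\<close>
  define n where "n = \<lfloor>x\<rfloor>"
  define h where "h = (\<lambda>z. of_real (exp ((of_int n + c)\<^sup>2 / (4 * \<alpha>))) * (f z * z powi (- n)))"
  have eq: "V f z = cmod (h z) * exp (- ((lx z - of_int n)\<^sup>2 / (4 * \<alpha>)))" if "z \<noteq> 0" for z
    using V_shift[OF that, of f n] by (simp add: h_def norm_mult)
  show ?thesis
  proof (rule that[OF h_def])
    fix z :: complex assume z: "z \<noteq> 0"
    have "exp (- ((lx z - of_int n)\<^sup>2 / (4 * \<alpha>))) \<le> 1" using alpha by simp
    then show "V f z \<le> cmod (h z)" unfolding eq[OF z] by (simp add: mult_left_le)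
    assume b: "\<bar>lx z - x\<bar> \<le> b"
    have "\<bar>lx z - of_int n\<bar> \<le> b + 1" using b unfolding n_def by linarith
    then have "(lx z - of_int n)\<^sup>2 \<le> (b + 1)\<^sup>2" by (metis abs_ge_zero abs_le_square_iff abs_of_nonneg order_trans)
    then have "(lx z - of_int n)\<^sup>2 / (4 * \<alpha>) \<le> (b + 1)\<^sup>2 / (4 * \<alpha>)" using alpha by (intro divide_right_mono) auto
    then have "1 \<le> ann_const b * exp (- ((lx z - of_int n)\<^sup>2 / (4 * \<alpha>)))"
      unfolding ann_const_def exp_add[symmetric] by simp
    then have "cmod (h z) * 1 \<le> cmod (h z) * (ann_const b * exp (- ((lx z - of_int n)\<^sup>2 / (4 * \<alpha>))))"
      by (intro mult_left_mono) auto
    then show "cmod (h z) \<le> ann_const b * V f z" unfolding eq[OF z] by (simp add: mult_ac)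
  qed
qed

lemma V_local_holomorphic:
  assumes "f holomorphic_on -{0}" "h = (\<lambda>z. a * (f z * z powi (n::int)))"
  shows "h holomorphic_on -{0}"
  unfolding assms(2) by (intro holomorphic_intros assms(1)) auto

text \<open>On the disc of radius \<open>|w| / 2\<close> about \<open>w\<close> the modulus changes
  by a factor of at most 2; this is the resulting width in the coordinate \<open>lx\<close>.\<close>

definition half_width :: real where "half_width = 2 * \<alpha> * ln 2"

lemma near_ball:
  assumes w: "w \<noteq> 0" and z: "z \<in> cball w (cmod w / 2)"
  shows "z \<noteq> 0" "\<bar>lx z - lx w\<bar> \<le> half_width" "cmod w / 2 \<le> cmod z" "cmod z \<le> 3 / 2 * cmod w"
proof -
  have "cmod (w - z) \<le> cmod w / 2" using z by (simp add: dist_norm)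
  moreover have "cmod w - cmod z \<le> cmod (w - z)" "cmod z - cmod w \<le> cmod (w - z)"
    using norm_triangle_ineq2 norm_minus_commute by metis+
  ultimately show b: "cmod w / 2 \<le> cmod z" "cmod z \<le> 3 / 2 * cmod w" by auto
  then show z0: "z \<noteq> 0" using w by auto
  have "ln (cmod w / 2) \<le> ln (cmod z)" "ln (cmod z) \<le> ln (2 * cmod w)"
    using b w z0 by (auto intro!: ln_mono)
  then have "\<bar>ln (cmod z) - ln (cmod w)\<bar> \<le> ln 2"
    using w by (auto simp: ln_div ln_mult)
  then have "2 * \<alpha> * \<bar>ln (cmod z) - ln (cmod w)\<bar> \<le> half_width"
    unfolding half_width_def using alpha by (intro mult_left_mono) auto
  moreover have "\<bar>lx z - lx w\<bar> = 2 * \<alpha> * \<bar>ln (cmod z) - ln (cmod w)\<bar>"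
    using alpha by (simp add: lx_def abs_mult right_diff_distrib[symmetric])
  ultimately show "\<bar>lx z - lx w\<bar> \<le> half_width" by simp
qed

end

section \<open>Weighted point values against the Fock norm\<close>

locale fock = log_weight \<alpha> "two_over p" for \<alpha> p +
  assumes p: "0 < p"
begin

abbreviation c where "c \<equiv> two_over p"

definition v :: "(complex \<Rightarrow> complex) \<Rightarrow> complex \<Rightarrow> complex" where
  "v f z = f z * of_real (exp (- \<alpha> * (ln (cmod z))\<^sup>2))"

lemma fock_norm_eq: "fock_norm \<alpha> p f = Lp_norm p lborel (v f)"
proof -
  have "v f = (\<lambda>z. f z * of_real (exp (- \<alpha> * (ln (cmod z))\<^sup>2)))" by (simp add: v_def fun_eq_iff)
  then show ?thesis by (simp only: fock_norm_def)
qed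

lemma V_eq_v: "V f z = cmod (v f z) * cmod z powr c"
  by (simp add: V_def v_def wt_def norm_mult)

lemma q_pos: "p \<noteq> \<infinity> \<Longrightarrow> enn2real p > 0" using enn2real_pos p by auto

lemma c_eq: "p \<noteq> \<infinity> \<Longrightarrow> c = 2 / enn2real p" by (simp add: two_over_def)

lemma c_infty: "p = \<infinity> \<Longrightarrow> c = 0" by (simp add: two_over_def)

lemma V_powr:
  assumes "p \<noteq> \<infinity>" "z \<noteq> 0"
  shows "V f z powr enn2real p = cmod (v f z) powr enn2real p * (cmod z)\<^sup>2"
proof -
  have "c * enn2real p = 2" using q_pos[OF assms(1)] by (simp add: c_eq[OF assms(1)])
  then show ?thesis using assms(2) by (simp add: V_eq_v powr_mult powr_powr)
qed

lemma measurable_v: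
  assumes "f holomorphic_on -{0}"
  shows "v f \<in> borel_measurable borel"
proof -
  have "(\<lambda>z. if z \<in> -{0} then v f z else v f 0) \<in> borel_measurable borel"
    unfolding v_def
    by (intro borel_measurable_continuous_on_if continuous_intros holomorphic_on_imp_continuous_on assms) auto
  then show ?thesis by (rule measurable_cong[THEN iffD1, rotated]) auto
qed

text \<open>Mean value inequality on the disc of radius \<open>|w| / 2\<close> for the companion of
  \<open>f\<close> from \<open>V_local\<close>. The factor \<open>|z|^2\<close> hidden in the p-th
  power of \<open>V\<close> matches the area of the disc, so one constant serves all
  \<open>w\<close>.\<close>

lemma V_powr_le_integral:
  assumes fin: "p \<noteq> \<infinity>"
  obtains C where "C > 0" "\<And>f w. f holomorphic_on -{0} \<Longrightarrow> w \<noteq> 0 \<Longrightarrow>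
     ennreal (V f w powr enn2real p) \<le> ennreal C *
       (\<integral>\<^sup>+z\<in>ball w (cmod w / 2). ennreal (cmod (v f z) powr enn2real p) \<partial>lborel)"
proof -
  define q where "q = enn2real p"
  have q: "q > 0" using q_pos[OF fin] by (simp add: q_def)
  obtain C where C: "C > 0" "\<And>S f z0 R. open S \<Longrightarrow> cball z0 R \<subseteq> S \<Longrightarrow> f holomorphic_on S \<Longrightarrow> R > 0 \<Longrightarrow>
      ennreal (R\<^sup>2 * cmod (f z0) powr q) \<le> ennreal C * (\<integral>\<^sup>+z\<in>ball z0 R. ennreal (cmod (f z) powr q) \<partial>lborel)"
    by (rule holomorphic_submean_powr[OF q]) blast
  define A where "A = ann_const half_width"
  \<comment> \<open>The 9 stems from \<open>|z| \<le> 3 * R\<close> on the ball of radius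
    \<open>R = |w| / 2\<close>.\<close>
  define D where "D = 9 * C * A powr q"
  have "ennreal (V f w powr q) \<le> ennreal D *
       (\<integral>\<^sup>+z\<in>ball w (cmod w / 2). ennreal (cmod (v f z) powr q) \<partial>lborel)"
    if f: "f holomorphic_on -{0}" and w: "w \<noteq> 0" for f w
  proof -
    obtain h n where h: "h = (\<lambda>z. of_real (exp ((of_int n + c)\<^sup>2 / (4 * \<alpha>))) * (f z * z powi (- n)))"
      "\<And>z. z \<noteq> 0 \<Longrightarrow> V f z \<le> cmod (h z)"
      "\<And>z. z \<noteq> 0 \<Longrightarrow> \<bar>lx z - lx w\<bar> \<le> half_width \<Longrightarrow> cmod (h z) \<le> A * V f z"
      unfolding A_def by (rule V_local[of f "lx w" half_width]) blast
    have hol: "h holomorphic_on -{0}" by (rule V_local_holomorphic[OF f h(1)])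
    define R where "R = cmod w / 2"
    have R: "R > 0" using w by (simp add: R_def)
    have sub: "cball w R \<subseteq> -{0}" using near_ball(1)[OF w] by (auto simp: R_def)
    have [measurable]: "v f \<in> borel_measurable borel" by (rule measurable_v[OF f])
    have "(\<lambda>z. ennreal (cmod (v f z) powr q)) \<in> borel_measurable lborel" by measurable
    then have Vv: "(\<lambda>z. ennreal (cmod (v f z) powr q) * indicator (ball w R) z) \<in> borel_measurable lborel"
      by (intro borel_measurable_times_ennreal borel_measurable_indicator) auto
    define B where "B = A powr q * (9 * R\<^sup>2)"
    have B: "B \<ge> 0" by (simp add: B_def)
    have "ennreal (R\<^sup>2 * V f w powr q) \<le> ennreal (R\<^sup>2 * cmod (h w) powr q)"
      using h(2)[OF w] q V_nonneg by (intro ennreal_leI mult_left_mono powr_mono2) auto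
    also have "\<dots> \<le> ennreal C * (\<integral>\<^sup>+z\<in>ball w R. ennreal (cmod (h z) powr q) \<partial>lborel)"
      by (rule C(2)[OF _ sub hol R]) auto
    also have "(\<integral>\<^sup>+z\<in>ball w R. ennreal (cmod (h z) powr q) \<partial>lborel)
        \<le> (\<integral>\<^sup>+z. ennreal B * (ennreal (cmod (v f z) powr q) * indicator (ball w R) z) \<partial>lborel)"
    proof (intro nn_integral_mono)
      fix z
      show "ennreal (cmod (h z) powr q) * indicator (ball w R) z
        \<le> ennreal B * (ennreal (cmod (v f z) powr q) * indicator (ball w R) z)"
      proof (cases "z \<in> ball w R")
        case True
        then have z: "z \<in> cball w (cmod w / 2)" by (simp add: R_def)
        note nb = near_ball[OF w z]
        have "cmod (h z) powr q \<le> (A * V f z) powr q"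
          using h(3)[OF nb(1,2)] q by (intro powr_mono2) auto
        also have "\<dots> = A powr q * (cmod (v f z) powr q * (cmod z)\<^sup>2)"
          using V_powr[OF fin nb(1), of f] V_nonneg by (simp add: powr_mult A_def q_def)
        also have "\<dots> \<le> A powr q * (cmod (v f z) powr q * (9 * R\<^sup>2))"
        proof -
          have "(cmod z)\<^sup>2 \<le> (3 * R)\<^sup>2" using nb(4) by (intro power_mono) (auto simp: R_def)
          then show ?thesis by (intro mult_left_mono) (auto simp: power_mult_distrib)
        qed
        also have "\<dots> = B * cmod (v f z) powr q" by (simp add: B_def)
        finally show ?thesis using True B by (simp add: ennreal_mult[symmetric] ennreal_leI)
      qed auto
    qed
    also have "\<dots> = ennreal B * (\<integral>\<^sup>+z\<in>ball w R. ennreal (cmod (v f z) powr q) \<partial>lborel)"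
      by (rule nn_integral_cmult[OF Vv])
    finally have "ennreal (R\<^sup>2 * V f w powr q) \<le> ennreal (R\<^sup>2 * D) * (\<integral>\<^sup>+z\<in>ball w R. ennreal (cmod (v f z) powr q) \<partial>lborel)"
    proof (rule order_trans[OF _ eq_refl], goal_cases)
      case 1 then show ?case by (simp add: mult_left_mono)
    next
      case 2
      have "C * B = R\<^sup>2 * D" by (simp add: B_def D_def)
      then show ?case using C(1) B by (simp add: mult.assoc[symmetric] ennreal_mult[symmetric])
    qed
    then have "ennreal (1 / R\<^sup>2) * ennreal (R\<^sup>2 * V f w powr q) \<le> ennreal (1 / R\<^sup>2) * (ennreal (R\<^sup>2 * D) * (\<integral>\<^sup>+z\<in>ball w R. ennreal (cmod (v f z) powr q) \<partial>lborel))"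
      by (intro mult_left_mono) auto
    moreover have "ennreal (1 / R\<^sup>2) * ennreal (R\<^sup>2 * V f w powr q) = ennreal (V f w powr q)"
      using R by (simp add: ennreal_mult[symmetric])
    moreover have "ennreal (1 / R\<^sup>2) * (ennreal (R\<^sup>2 * D) * X) = ennreal D * X" for X
      using R C(1) by (simp add: mult.assoc[symmetric] ennreal_mult[symmetric] D_def)
    ultimately show ?thesis by (simp add: R_def)
  qed
  moreover have "D > 0" using C(1) by (simp add: D_def A_def ann_const_def)
  ultimately show ?thesis using that[of D] by (simp add: q_def)
qed

text \<open>The essential supremum bounds only almost every value; a larger value at
  \<open>w\<close> would by continuity persist on a nonempty open set, which is not
  negligible.\<close>

lemma V_le_fock_norm_infty:
  assumes f: "f holomorphic_on -{0}" and w: "w \<noteq> 0" and inf: "p = \<infinity>"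
  shows "ennreal (V f w) \<le> fock_norm \<alpha> p f"
proof (rule ccontr)
  assume "\<not> ?thesis"
  then have less: "fock_norm \<alpha> p f < ennreal (V f w)" by simp
  then obtain B where B: "fock_norm \<alpha> p f = ennreal B" "B \<ge> 0"
    by (cases "fock_norm \<alpha> p f") auto
  have V: "V f z = cmod (v f z)" if "z \<noteq> 0" for z 
    unfolding V_eq_v using that by (simp add: c_infty[OF inf])
  have "B < cmod (v f w)" using less B V[OF w] by (simp add: ennreal_less_iff)
  define U where "U = (-{0}) \<inter> (\<lambda>z. cmod (v f z)) -` {B<..}"
  have "continuous_on (-{0}) (\<lambda>z. cmod (v f z))"
    unfolding v_def by (intro continuous_intros holomorphic_on_imp_continuous_on f) auto
  then have U: "open U" unfolding U_def by (intro continuous_open_preimage) auto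
  have "w \<in> U" using w \<open>B < cmod (v f w)\<close> by (auto simp: U_def)
  have "AE z in lborel. ennreal (cmod (v f z)) \<le> ennreal B"
  proof -
    have "esssup lborel (\<lambda>z. ennreal (cmod (v f z))) = ennreal B"
      using B(1) unfolding fock_norm_eq Lp_norm_def by (simp add: inf)
    then show ?thesis using esssup_AE[of "\<lambda>z. ennreal (cmod (v f z))" lborel] by simp
  qed
  then have "AE z in lborel. z \<notin> U"
    using B(2) by (auto simp: U_def ennreal_le_iff elim!: eventually_mono)
  then have "U \<in> null_sets lborel"
    using U by (subst AE_iff_null_sets) auto
  then have "negligible U" using null_sets_completionI negligible_iff_null_sets by blast
  then show False using open_not_negligible[OF U] \<open>w \<in> U\<close> by auto
qed

end

context log_weight
begin

lemma rad_nonzero [simp]: "rad x \<noteq> 0" by (simp add: rad_def)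

text \<open>The weighted modulus \<open>V F\<close> itself obeys no maximum principle; its companion
  \<open>h\<close> does, and within distance \<open>b\<close> in \<open>lx\<close> the two differ by
  a factor of at most \<open>ann_const b\<close>.\<close>

lemma V_max_principle:
  assumes F: "F holomorphic_on -{0}" and z: "z \<noteq> 0" "y1 \<le> lx z" "lx z \<le> y2"
    and b: "lx z - y1 \<le> b" "y2 - lx z \<le> b"
    and M: "\<And>u. u \<noteq> 0 \<Longrightarrow> lx u = y1 \<or> lx u = y2 \<Longrightarrow> V F u \<le> M"
  shows "V F z \<le> ann_const b * M"
proof -
  obtain h n where h: "h = (\<lambda>z. of_real (exp ((of_int n + c)\<^sup>2 / (4 * \<alpha>))) * (F z * z powi (- n)))"
      "\<And>z. z \<noteq> 0 \<Longrightarrow> V F z \<le> cmod (h z)"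
      "\<And>u. u \<noteq> 0 \<Longrightarrow> \<bar>lx u - lx z\<bar> \<le> b \<Longrightarrow> cmod (h u) \<le> ann_const b * V F u"
    by (rule V_local[of F "lx z" b]) blast
  have hol: "h holomorphic_on -{0}" by (rule V_local_holomorphic[OF F h(1)])
  define S where "S = {u. rad y1 \<le> cmod u \<and> cmod u \<le> rad y2}"
  have "closed S" unfolding S_def by (intro closed_Collect_conj closed_Collect_le continuous_intros)
  have S0: "S \<subseteq> -{0}" using rad_pos[of y1] by (auto simp: S_def not_le[symmetric] simp del: rad_pos)
  have "cmod (h z) \<le> ann_const b * M"
  proof (rule maximum_modulus_frontier[of h S])
    show "h holomorphic_on interior S" using hol S0 interior_subset holomorphic_on_subset by blast
    show "continuous_on (closure S) h"
      using \<open>closed S\<close> holomorphic_on_imp_continuous_on[OF holomorphic_on_subset[OF hol S0]] by simp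
    show "bounded S" unfolding S_def by (rule boundedI[of _ "rad y2"]) auto
    show "z \<in> S" using z alpha by (simp add: S_def norm_eq_rad rad_def divide_right_mono)
    fix u assume u: "u \<in> frontier S"
    have uS: "u \<in> S" using u \<open>closed S\<close> frontier_subset_closed by blast
    have u0: "u \<noteq> 0" using uS S0 by auto
    have "open {u. rad y1 < cmod u \<and> cmod u < rad y2}"
      by (intro open_Collect_conj open_Collect_less continuous_intros)
    then have "{u. rad y1 < cmod u \<and> cmod u < rad y2} \<subseteq> interior S"
      by (intro interior_maximal) (auto simp: S_def)
    moreover have "u \<notin> interior S" using u by (simp add: frontier_def)
    ultimately have "\<not> (rad y1 < cmod u \<and> cmod u < rad y2)" by blast
    then have "cmod u = rad y1 \<or> cmod u = rad y2" using uS by (auto simp: S_def)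
    then have l: "lx u = y1 \<or> lx u = y2" using lx_eqI by blast
    then have "cmod (h u) \<le> ann_const b * V F u" using z b by (intro h(3)[OF u0]) auto
    also have "\<dots> \<le> ann_const b * M" using M[OF u0 l] by (intro mult_left_mono) (auto simp: less_imp_le)
    finally show "cmod (h u) \<le> ann_const b * M" .
  qed
  then show ?thesis using h(2)[OF z(1)] by linarith
qed

end

section \<open>Exchange of discrete samples and integral norms\<close>

context fock
begin

lemma powr_cancel_const:
  assumes "p \<noteq> \<infinity>" "D \<ge> 0"
  obtains C where "C > 0" "D \<le> C powr enn2real p"
proof -
  have "((D + 1) powr (1 / enn2real p)) powr enn2real p = D + 1"
    using q_pos[OF assms(1)] assms by (simp add: powr_powr)
  then show ?thesis using assms that[of "(D + 1) powr (1 / enn2real p)"] by auto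
qed

text \<open>A sampling inequality: each sample is bounded by an integral over a disc of comparable
  size, and bounded density means that every \<open>z\<close> lies in a bounded number of these
  discs. The constant depends on the points only through \<open>K\<close>.\<close>

lemma lp_norm_V_le_fock_norm:
  fixes K :: nat
  obtains C where "C > 0"
    "\<And>(I::'i set) w f. window_bounded I (\<lambda>i. lx (w i)) K \<Longrightarrow> (\<And>i. i \<in> I \<Longrightarrow> w i \<noteq> 0) \<Longrightarrow>
      f holomorphic_on -{0} \<Longrightarrow> lp_norm p I (\<lambda>i. of_real (V f (w i))) \<le> ennreal C * fock_norm \<alpha> p f"
proof (cases "p = \<infinity>")
  case True
  have "lp_norm p I (\<lambda>i. of_real (V f (w i))) \<le> ennreal 1 * fock_norm \<alpha> p f"
    if "\<And>i. i \<in> I \<Longrightarrow> w i \<noteq> 0" "f holomorphic_on -{0}" for I :: "'i set" and w f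
  proof -
    have "\<forall>i\<in>I. ennreal (cmod (of_real (V f (w i)))) \<le> fock_norm \<alpha> p f"
      using V_le_fock_norm_infty[OF that(2) that(1) True] by (simp add: V_nonneg)
    then have "lp_norm \<infinity> I (\<lambda>i. of_real (V f (w i))) \<le> fock_norm \<alpha> p f"
      unfolding lp_norm_infty_le_iff .
    then show ?thesis using True by simp
  qed
  then show ?thesis using that[of 1] by simp
next
  case fin: False
  define q where "q = enn2real p"
  obtain C0 where C0: "C0 > 0" "\<And>f w. f holomorphic_on -{0} \<Longrightarrow> w \<noteq> 0 \<Longrightarrow>
     ennreal (V f w powr q) \<le> ennreal C0 *
       (\<integral>\<^sup>+z\<in>ball w (cmod w / 2). ennreal (cmod (v f z) powr q) \<partial>lborel)"
    unfolding q_def by (rule V_powr_le_integral[OF fin]) blast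
  define N where "N = K * (nat \<lceil>2 * half_width\<rceil> + 1)"
  obtain C where C: "C > 0" "C0 * real N \<le> C powr q"
    unfolding q_def using powr_cancel_const[OF fin, of "C0 * real N"] C0(1) by auto
  have "lp_norm p I (\<lambda>i. of_real (V f (w i))) \<le> ennreal C * fock_norm \<alpha> p f"
    if w: "window_bounded I (\<lambda>i. lx (w i)) K" and w0: "\<And>i. i \<in> I \<Longrightarrow> w i \<noteq> 0" and f: "f holomorphic_on -{0}"
    for I :: "'i set" and w f
    unfolding lp_norm_def fock_norm_eq
  proof (rule Lp_norm_le_multI[OF p fin C(1)], fold q_def)
    define G where "G = (\<lambda>z. ennreal (cmod (v f z) powr q))"
    have [measurable]: "v f \<in> borel_measurable borel" by (rule measurable_v[OF f])
    have G: "G \<in> borel_measurable lborel" unfolding G_def by measurable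
    have Gi: "(\<lambda>z. G z * indicator (ball (w i) (cmod (w i) / 2)) z) \<in> borel_measurable lborel" for i
      using G by (intro borel_measurable_times_ennreal borel_measurable_indicator) auto
    have "(\<integral>\<^sup>+i. ennreal (cmod (of_real (V f (w i))) powr q) \<partial>count_space I)
      \<le> (\<integral>\<^sup>+i. ennreal C0 * (\<integral>\<^sup>+z\<in>ball (w i) (cmod (w i) / 2). G z \<partial>lborel) \<partial>count_space I)"
      using C0(2)[OF f w0] by (intro nn_integral_mono) (auto simp: V_nonneg G_def)
    also have "\<dots> = ennreal C0 * (\<integral>\<^sup>+i. (\<integral>\<^sup>+z\<in>ball (w i) (cmod (w i) / 2). G z \<partial>lborel) \<partial>count_space I)"
      by (intro nn_integral_cmult) auto
    also have "(\<integral>\<^sup>+i. (\<integral>\<^sup>+z\<in>ball (w i) (cmod (w i) / 2). G z \<partial>lborel) \<partial>count_space I)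
        = (\<integral>\<^sup>+z. \<integral>\<^sup>+i. G z * indicator (ball (w i) (cmod (w i) / 2)) z \<partial>count_space I \<partial>lborel)"
      by (rule nn_integral_count_space_nn_integral[symmetric, OF window_bounded_countable[OF w] Gi])
    also have "\<dots> \<le> (\<integral>\<^sup>+z. ennreal (real N) * G z \<partial>lborel)"
    proof (intro nn_integral_mono)
      fix z
      define A where "A = {i\<in>I. z \<in> ball (w i) (cmod (w i) / 2)}"
      have s: "A \<subseteq> {i\<in>I. \<bar>lx (w i) - lx z\<bar> \<le> half_width}"
        unfolding A_def using near_ball(2)[OF w0] by (fastforce simp: abs_minus_commute)
      have A: "finite A" "card A \<le> N"
        using window_bounded_near[OF w, of "lx z" half_width] finite_subset[OF s] card_mono[OF _ s]
        unfolding N_def by (auto intro: le_trans)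
      have "(\<integral>\<^sup>+i. G z * indicator (ball (w i) (cmod (w i) / 2)) z \<partial>count_space I)
        = (\<integral>\<^sup>+i. G z * indicator A i \<partial>count_space I)"
        by (intro nn_integral_cong) (auto simp: A_def indicator_def)
      also have "\<dots> = G z * emeasure (count_space I) A"
        by (rule nn_integral_cmult_indicator) (auto simp: A_def)
      also have "emeasure (count_space I) A = ennreal (real (card A))"
        using A by (subst emeasure_count_space_finite) (auto simp: A_def ennreal_of_nat_eq_real_of_nat)
      also have "G z * \<dots> \<le> G z * ennreal (real N)"
        using A by (intro mult_left_mono ennreal_leI) auto
      finally show "(\<integral>\<^sup>+i. G z * indicator (ball (w i) (cmod (w i) / 2)) z \<partial>count_space I) \<le> ennreal (real N) * G z"
        by (simp add: mult.commute)
    qed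
    also have "\<dots> = ennreal (real N) * (\<integral>\<^sup>+z. G z \<partial>lborel)" by (rule nn_integral_cmult[OF G])
    finally have "(\<integral>\<^sup>+i. ennreal (cmod (of_real (V f (w i))) powr q) \<partial>count_space I)
        \<le> ennreal C0 * (ennreal (real N) * (\<integral>\<^sup>+z. G z \<partial>lborel))" by (simp add: mult_left_mono)
    also have "\<dots> = ennreal (C0 * real N) * (\<integral>\<^sup>+z. G z \<partial>lborel)"
      using C0(1) by (simp add: ennreal_mult mult.assoc)
    also have "\<dots> \<le> ennreal (C powr q) * (\<integral>\<^sup>+z. G z \<partial>lborel)"
      using C by (intro mult_right_mono ennreal_leI) auto
    finally show "(\<integral>\<^sup>+i. ennreal (cmod (of_real (V f (w i))) powr q) \<partial>count_space I)
        \<le> ennreal (C powr q) * (\<integral>\<^sup>+z. ennreal (cmod (v f z) powr q) \<partial>lborel)" by (simp add: G_def)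
  qed
  then show ?thesis using that[OF C(1)] by blast
qed

lemma V_le_fock_norm:
  obtains C where "C > 0" "\<And>f w. f holomorphic_on -{0} \<Longrightarrow> w \<noteq> 0 \<Longrightarrow> ennreal (V f w) \<le> ennreal C * fock_norm \<alpha> p f"
proof -
  obtain C where C: "C > 0" "\<And>(I::unit set) w f. window_bounded I (\<lambda>i. lx (w i)) 1 \<Longrightarrow> (\<And>i. i \<in> I \<Longrightarrow> w i \<noteq> 0) \<Longrightarrow>
      f holomorphic_on -{0} \<Longrightarrow> lp_norm p I (\<lambda>i. of_real (V f (w i))) \<le> ennreal C * fock_norm \<alpha> p f"
    by (rule lp_norm_V_le_fock_norm[of 1]) blast
  have "ennreal (V f w) \<le> ennreal C * fock_norm \<alpha> p f" if f: "f holomorphic_on -{0}" and w: "w \<noteq> 0" for f w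
  proof -
    have "window_bounded (UNIV::unit set) (\<lambda>i. lx w) 1"
      unfolding window_bounded_def by (auto intro: card_mono[of "UNIV :: unit set", simplified])
    then have "lp_norm p (UNIV::unit set) (\<lambda>i. of_real (V f w)) \<le> ennreal C * fock_norm \<alpha> p f"
      using C(2)[of UNIV "\<lambda>_. w" f] f w by simp
    then show ?thesis
      using norm_le_lp_norm[OF p, of "()" UNIV "\<lambda>i. of_real (V f w)"] V_nonneg by (auto intro: order_trans)
  qed
  then show ?thesis using that C(1) by blast
qed

lemma rad_add_1: "rad (x + 1) = rad x * exp (1 / (2 * \<alpha>))"
  by (simp add: rad_def exp_add[symmetric] add_divide_distrib[symmetric] add_ac)

text \<open>The converse direction, for a majorant constant on unit annuli in \<open>lx\<close>.
  Each annulus may be replaced by the full disc that contains it, because outer and inner radius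
  have a fixed ratio.\<close>

lemma fock_norm_le_lp_norm:
  obtains C where "C > 0"
    "\<And>F d. F holomorphic_on -{0} \<Longrightarrow> F 0 = 0 \<Longrightarrow> (\<And>m. d m \<ge> 0) \<Longrightarrow> (\<And>z. z \<noteq> 0 \<Longrightarrow> V F z \<le> d \<lfloor>lx z\<rfloor>) \<Longrightarrow>
      fock_norm \<alpha> p F \<le> ennreal C * lp_norm p (UNIV :: int set) (\<lambda>m. of_real (d m))"
proof (cases "p = \<infinity>")
  case inf: True
  have "fock_norm \<alpha> p F \<le> ennreal 1 * lp_norm p (UNIV :: int set) (\<lambda>m. of_real (d m))"
    if F: "F holomorphic_on -{0}" "F 0 = 0" and d: "\<And>m. d m \<ge> 0" "\<And>z. z \<noteq> 0 \<Longrightarrow> V F z \<le> d \<lfloor>lx z\<rfloor>" for F d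
  proof -
    have m: "ennreal (d m) \<le> lp_norm p (UNIV :: int set) (\<lambda>m. of_real (d m))" for m
      using norm_le_lp_norm[OF p, of m UNIV "\<lambda>m. of_real (d m)"] d(1)[of m] by simp
    have "ennreal (cmod (v F z)) \<le> lp_norm p (UNIV :: int set) (\<lambda>m. of_real (d m))" for z
    proof (cases "z = 0")
      case True then show ?thesis using F by (simp add: v_def)
    next
      case False
      then have "cmod (v F z) = V F z" unfolding V_eq_v by (simp add: c_infty[OF inf])
      then have "ennreal (cmod (v F z)) \<le> ennreal (d \<lfloor>lx z\<rfloor>)" using d(2)[OF False] by (simp add: ennreal_leI)
      then show ?thesis using m by (rule order_trans)
    qed
    moreover have "(\<lambda>z. ennreal (cmod (v F z))) \<in> borel_measurable lborel"
      using measurable_v[OF F(1)] by measurable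
    ultimately have "esssup lborel (\<lambda>z. ennreal (cmod (v F z))) \<le> lp_norm p (UNIV :: int set) (\<lambda>m. of_real (d m))"
      by (intro esssup_I) auto
    moreover have "fock_norm \<alpha> p F = esssup lborel (\<lambda>z. ennreal (cmod (v F z)))"
      unfolding fock_norm_eq Lp_norm_def by (simp add: inf)
    ultimately show ?thesis by simp
  qed
  then show ?thesis using that[of 1] by simp
next
  case fin: False
  define q where "q = enn2real p"
  have q: "q > 0" using q_pos[OF fin] by (simp add: q_def)
  define D where "D = pi * (exp (1 / (2 * \<alpha>)))\<^sup>2"
  obtain C where C: "C > 0" "D \<le> C powr q"
    unfolding q_def using powr_cancel_const[OF fin, of D] by (auto simp: D_def)
  have "fock_norm \<alpha> p F \<le> ennreal C * lp_norm p (UNIV :: int set) (\<lambda>m. of_real (d m))"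
    if F: "F holomorphic_on -{0}" "F 0 = 0" and d: "\<And>m. d m \<ge> 0" "\<And>z. z \<noteq> 0 \<Longrightarrow> V F z \<le> d \<lfloor>lx z\<rfloor>" for F d
    unfolding lp_norm_def fock_norm_eq
  proof (rule Lp_norm_le_multI[OF p fin C(1)], fold q_def)
    define a where "a = (\<lambda>m::int. d m powr q / (rad (of_int m))\<^sup>2)"
    have "(\<integral>\<^sup>+z. ennreal (cmod (v F z) powr q) \<partial>lborel)
      \<le> (\<integral>\<^sup>+z. \<integral>\<^sup>+m. ennreal (a m) * indicator (ball (0::complex) (rad (of_int m + 1))) z \<partial>count_space UNIV \<partial>lborel)"
    proof (intro nn_integral_mono)
      fix z
      show "ennreal (cmod (v F z) powr q) \<le> (\<integral>\<^sup>+m. ennreal (a m) * indicator (ball (0::complex) (rad (of_int m + 1))) z \<partial>count_space UNIV)"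
      proof (cases "z = 0")
        case True then show ?thesis using F q by (simp add: v_def)
      next
        case False
        define m where "m = \<lfloor>lx z\<rfloor>"
        have z: "cmod z = rad (lx z)" by (rule norm_eq_rad[OF False])
        have "rad (of_int m) \<le> cmod z" unfolding z using alpha by (simp add: rad_def m_def divide_right_mono)
        then have "(rad (of_int m))\<^sup>2 \<le> (cmod z)\<^sup>2" by (intro power_mono) (auto simp: less_imp_le)
        have "cmod z < rad (of_int m + 1)" unfolding z using alpha by (auto simp: rad_def m_def intro!: divide_strict_right_mono)
        have "cmod (v F z) powr q * (rad (of_int m))\<^sup>2 \<le> cmod (v F z) powr q * (cmod z)\<^sup>2"
          using \<open>(rad (of_int m))\<^sup>2 \<le> (cmod z)\<^sup>2\<close> by (intro mult_left_mono) auto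
        also have "\<dots> = V F z powr q" using V_powr[OF fin False] by (simp add: q_def)
        also have "\<dots> \<le> d m powr q" using d(2)[OF False] V_nonneg q by (intro powr_mono2) (auto simp: m_def)
        finally have "cmod (v F z) powr q \<le> a m"
          unfolding a_def using rad_pos[of "of_int m"] by (subst pos_le_divide_eq) auto
        then have "ennreal (cmod (v F z) powr q) \<le> ennreal (a m) * indicator (ball (0::complex) (rad (of_int m + 1))) z"
          using \<open>cmod z < rad (of_int m + 1)\<close> by (simp add: ennreal_leI)
        also have "\<dots> \<le> (\<integral>\<^sup>+m. ennreal (a m) * indicator (ball (0::complex) (rad (of_int m + 1))) z \<partial>count_space UNIV)"
          by (rule nn_integral_ge_point[of m UNIV "\<lambda>m. ennreal (a m) * indicator (ball (0::complex) (rad (of_int m + 1))) z"]) simp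
        finally show ?thesis .
      qed
    qed
    also have "\<dots> = (\<integral>\<^sup>+m. \<integral>\<^sup>+z. ennreal (a m) * indicator (ball (0::complex) (rad (of_int m + 1))) z \<partial>lborel \<partial>count_space UNIV)"
      by (intro nn_integral_count_space_nn_integral borel_measurable_times_ennreal borel_measurable_indicator) auto
    also have "\<dots> = (\<integral>\<^sup>+m. ennreal D * ennreal (cmod (of_real (d m)) powr q) \<partial>count_space UNIV)"
    proof (intro nn_integral_cong)
      fix m :: int
      have "(\<integral>\<^sup>+z. ennreal (a m) * indicator (ball (0::complex) (rad (of_int m + 1))) z \<partial>lborel) = ennreal (a m) * ennreal (pi * (rad (of_int m + 1))\<^sup>2)"
        by (subst nn_integral_cmult_indicator) (simp_all add: emeasure_ball unit_ball_vol_2 less_imp_le)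
      also have "\<dots> = ennreal (a m * (pi * (rad (of_int m + 1))\<^sup>2))"
        by (rule ennreal_mult[symmetric]) (auto simp: a_def)
      also have "a m * (pi * (rad (of_int m + 1))\<^sup>2) = D * d m powr q"
        by (simp add: a_def rad_add_1 D_def power_mult_distrib)
      finally show "(\<integral>\<^sup>+z. ennreal (a m) * indicator (ball (0::complex) (rad (of_int m + 1))) z \<partial>lborel) = ennreal D * ennreal (cmod (of_real (d m)) powr q)"
        using d(1)[of m] by (simp add: ennreal_mult D_def)
    qed
    also have "\<dots> = ennreal D * (\<integral>\<^sup>+m. ennreal (cmod (of_real (d m)) powr q) \<partial>count_space UNIV)"
      by (intro nn_integral_cmult) auto
    also have "\<dots> \<le> ennreal (C powr q) * (\<integral>\<^sup>+m. ennreal (cmod (of_real (d m)) powr q) \<partial>count_space UNIV)"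
      using C by (intro mult_right_mono ennreal_leI) auto
    finally show "(\<integral>\<^sup>+z. ennreal (cmod (v F z) powr q) \<partial>lborel)
        \<le> ennreal (C powr q) * (\<integral>\<^sup>+m. ennreal (cmod (of_real (d m)) powr q) \<partial>count_space UNIV)" .
  qed
  then show ?thesis using that[OF C(1)] by blast
qed

text \<open>A discrete convolution estimate in which each \<open>d m\<close> is dominated by a
  single term. The p-th power of one term is at most the sum of the p-th powers, so no distinction
  between \<open>p < 1\<close> and \<open>p \<ge> 1\<close> arises.\<close>

lemma lp_norm_exp_decay_point:
  assumes \<eta>: "\<eta> > 0"
  obtains C where "C > 0"
    "\<And>(d::int \<Rightarrow> real) (a::int \<Rightarrow> complex) B. B > 0 \<Longrightarrow> (\<And>m. d m \<ge> 0) \<Longrightarrow>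
       (\<And>m. \<exists>k. d m \<le> B * (cmod (a k) * exp (- \<eta> * \<bar>of_int k - of_int m\<bar>))) \<Longrightarrow>
      lp_norm p UNIV (\<lambda>m. of_real (d m)) \<le> ennreal (C * B) * lp_norm p UNIV a"
proof (cases "p = \<infinity>")
  case inf: True
  have "lp_norm p UNIV (\<lambda>m. of_real (d m)) \<le> ennreal (1 * B) * lp_norm p UNIV a"
    if B: "B > 0" and d: "\<And>m. d m \<ge> 0" "\<And>m. \<exists>k. d m \<le> B * (cmod (a k) * exp (- \<eta> * \<bar>of_int k - of_int m\<bar>))"
    for d :: "int \<Rightarrow> real" and a :: "int \<Rightarrow> complex" and B
    unfolding inf lp_norm_infty_le_iff
  proof
    fix m :: int
    obtain k where k: "d m \<le> B * (cmod (a k) * exp (- \<eta> * \<bar>of_int k - of_int m\<bar>))" using d(2) by blast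
    also have "\<dots> \<le> B * (cmod (a k) * 1)" using \<eta> B by (intro mult_left_mono) auto
    finally have "ennreal (d m) \<le> ennreal B * ennreal (cmod (a k))"
      using B by (simp add: ennreal_mult[symmetric] ennreal_leI)
    also have "\<dots> \<le> ennreal B * lp_norm \<infinity> UNIV a"
      using norm_le_lp_norm[of \<infinity> k UNIV a] by (intro mult_left_mono) auto
    finally show "ennreal (cmod (of_real (d m))) \<le> ennreal (1 * B) * lp_norm \<infinity> UNIV a" using d(1)[of m] by simp
  qed
  then show ?thesis using that[of 1] by simp
next
  case fin: False
  define q where "q = enn2real p"
  have q: "q > 0" using q_pos[OF fin] by (simp add: q_def)
  define D where "D = exp_sum_bound (q * \<eta>) 2"
  have D: "D \<ge> 0" unfolding D_def using q \<eta> by (intro exp_sum_bound_nonneg) auto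
  obtain C where C: "C > 0" "D \<le> C powr q"
    unfolding q_def using powr_cancel_const[OF fin D] by auto
  have "lp_norm p UNIV (\<lambda>m. of_real (d m)) \<le> ennreal (C * B) * lp_norm p UNIV a"
    if B: "B > 0" and d: "\<And>m. d m \<ge> 0" "\<And>m. \<exists>k. d m \<le> B * (cmod (a k) * exp (- \<eta> * \<bar>of_int k - of_int m\<bar>))"
    for d :: "int \<Rightarrow> real" and a :: "int \<Rightarrow> complex" and B
    unfolding lp_norm_def
  proof (rule Lp_norm_le_multI[OF p fin], fold q_def)
    show "0 < C * B" using C B by simp
    define g where "g = (\<lambda>k m. ennreal (B powr q) * (ennreal (cmod (a k) powr q) * ennreal (exp (- (q * \<eta>) * \<bar>of_int m - of_int k\<bar>))))"
    have "(\<integral>\<^sup>+m. ennreal (cmod (of_real (d m)) powr q) \<partial>count_space UNIV)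
        \<le> (\<integral>\<^sup>+m. \<integral>\<^sup>+k. g k m \<partial>count_space UNIV \<partial>count_space UNIV)"
    proof (intro nn_integral_mono)
      fix m
      obtain k where k: "d m \<le> B * (cmod (a k) * exp (- \<eta> * \<bar>of_int k - of_int m\<bar>))" using d(2) by blast
      have "cmod (of_real (d m)) powr q \<le> (B * (cmod (a k) * exp (- \<eta> * \<bar>of_int k - of_int m\<bar>))) powr q"
        using k d(1)[of m] q by (intro powr_mono2) auto
      also have "\<dots> = B powr q * (cmod (a k) powr q * exp (- (q * \<eta>) * \<bar>of_int m - of_int k\<bar>))"
        by (simp add: powr_mult exp_powr_real abs_minus_commute mult_ac)
      finally have "ennreal (cmod (of_real (d m)) powr q) \<le> g k m"
        unfolding g_def by (simp add: ennreal_mult[symmetric] ennreal_leI)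
      also have "\<dots> \<le> (\<integral>\<^sup>+k. g k m \<partial>count_space UNIV)"
        by (rule nn_integral_ge_point[of k UNIV "\<lambda>k. g k m"]) simp
      finally show "ennreal (cmod (of_real (d m)) powr q) \<le> (\<integral>\<^sup>+k. g k m \<partial>count_space UNIV)" .
    qed
    also have "\<dots> = (\<integral>\<^sup>+k. \<integral>\<^sup>+m. g k m \<partial>count_space UNIV \<partial>count_space UNIV)"
      by (intro nn_integral_count_space_nn_integral) auto
    also have "\<dots> \<le> (\<integral>\<^sup>+k. ennreal (B powr q * D) * ennreal (cmod (a k) powr q) \<partial>count_space UNIV)"
    proof (intro nn_integral_mono)
      fix k :: int
      have "(\<integral>\<^sup>+m. g k m \<partial>count_space UNIV) = ennreal (B powr q) * (ennreal (cmod (a k) powr q) *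
          (\<integral>\<^sup>+m. ennreal (exp (- (q * \<eta>) * \<bar>of_int m - of_int k\<bar>)) \<partial>count_space UNIV))"
        unfolding g_def by (simp add: nn_integral_cmult)
      also have "\<dots> \<le> ennreal (B powr q) * (ennreal (cmod (a k) powr q) * ennreal D)"
        unfolding D_def using q \<eta> by (intro mult_left_mono exp_nn_integral_le[OF window_bounded_of_int]) auto
      finally show "(\<integral>\<^sup>+m. g k m \<partial>count_space UNIV) \<le> ennreal (B powr q * D) * ennreal (cmod (a k) powr q)"
        using D by (simp add: ennreal_mult mult_ac)
    qed
    also have "\<dots> = ennreal (B powr q * D) * (\<integral>\<^sup>+k. ennreal (cmod (a k) powr q) \<partial>count_space UNIV)"
      by (intro nn_integral_cmult) auto
    also have "\<dots> \<le> ennreal ((C * B) powr q) * (\<integral>\<^sup>+k. ennreal (cmod (a k) powr q) \<partial>count_space UNIV)"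
      using C B by (intro mult_right_mono ennreal_leI) (auto simp: powr_mult mult.commute intro!: mult_right_mono)
    finally show "(\<integral>\<^sup>+m. ennreal (cmod (of_real (d m)) powr q) \<partial>count_space UNIV)
        \<le> ennreal ((C * B) powr q) * (\<integral>\<^sup>+k. ennreal (cmod (a k) powr q) \<partial>count_space UNIV)" .
  qed
  then show ?thesis using that[OF C(1)] by blast
qed

text \<open>Reduces a series to one of its terms: half of the decay is kept in \<open>b\<close>, the
  other half makes the remaining series converge, and some \<open>b k\<close> comes within a factor
  2 of the supremum.\<close>

lemma exp_infsum_attained:
  fixes a :: "int \<Rightarrow> complex"
  assumes \<eta>: "\<eta> > 0" and A: "\<And>k. cmod (a k) \<le> A"
  shows "(\<lambda>k. cmod (a k) * exp (- \<eta> * \<bar>of_int k - x\<bar>)) summable_on UNIV"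
    and "\<exists>k. (\<Sum>\<^sub>\<infinity>k. cmod (a k) * exp (- \<eta> * \<bar>of_int k - x\<bar>))
      \<le> (2 * exp_sum_bound (\<eta> / 2) 2 + 1) * (cmod (a k) * exp (- (\<eta> / 2) * \<bar>of_int k - x\<bar>))"
proof -
  define E where "E = exp_sum_bound (\<eta> / 2) 2"
  have E: "E \<ge> 0" unfolding E_def using \<eta> by (intro exp_sum_bound_nonneg) auto
  have A0: "A \<ge> 0" using A[of 0] norm_ge_zero order_trans by blast
  define b where "b = (\<lambda>k::int. cmod (a k) * exp (- (\<eta> / 2) * \<bar>of_int k - x\<bar>))"
  have b: "b k \<le> A" "b k \<ge> 0" for k
  proof -
    have "b k \<le> A * 1" unfolding b_def using A A0 \<eta> by (intro mult_mono) auto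
    then show "b k \<le> A" "b k \<ge> 0" by (auto simp: b_def)
  qed
  have bdd: "bdd_above (range b)" using b(1) by (intro bdd_aboveI2) auto
  define s where "s = (SUP k. b k)"
  have bs: "b k \<le> s" for k unfolding s_def using bdd by (intro cSUP_upper) auto
  have s0: "s \<ge> 0" using b(2)[of 0] bs[of 0] by linarith
  have eq: "cmod (a k) * exp (- \<eta> * \<bar>of_int k - x\<bar>) = b k * exp (- (\<eta> / 2) * \<bar>of_int k - x\<bar>)" for k
    by (simp add: b_def exp_add[symmetric] mult.assoc)
  note es = exp_summable_on[OF window_bounded_of_int, of "\<eta> / 2" x]
  have sums: "(\<lambda>k. s * exp (- (\<eta> / 2) * \<bar>of_int k - x\<bar>)) summable_on UNIV"
    using \<eta> es(1) by (intro summable_on_cmult_right) auto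
  show sm: "(\<lambda>k. cmod (a k) * exp (- \<eta> * \<bar>of_int k - x\<bar>)) summable_on UNIV"
    unfolding eq by (rule summable_on_comparison_test[OF sums]) (use bs b in \<open>auto intro: mult_right_mono\<close>)
  have "(\<Sum>\<^sub>\<infinity>k. cmod (a k) * exp (- \<eta> * \<bar>of_int k - x\<bar>)) \<le> (\<Sum>\<^sub>\<infinity>k. s * exp (- (\<eta> / 2) * \<bar>of_int k - x\<bar>))"
    using sm unfolding eq by (rule infsum_mono[OF _ sums]) (use bs in \<open>auto intro: mult_right_mono\<close>)
  also have "\<dots> = s * (\<Sum>\<^sub>\<infinity>k::int. exp (- (\<eta> / 2) * \<bar>of_int k - x\<bar>))"
    by (rule infsum_cmult_right') 
  also have "\<dots> \<le> s * E" unfolding E_def using \<eta> s0 es(2) by (intro mult_left_mono) auto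
  finally have le: "(\<Sum>\<^sub>\<infinity>k. cmod (a k) * exp (- \<eta> * \<bar>of_int k - x\<bar>)) \<le> s * E" .
  show "\<exists>k. (\<Sum>\<^sub>\<infinity>k. cmod (a k) * exp (- \<eta> * \<bar>of_int k - x\<bar>))
      \<le> (2 * exp_sum_bound (\<eta> / 2) 2 + 1) * (cmod (a k) * exp (- (\<eta> / 2) * \<bar>of_int k - x\<bar>))"
  proof (cases "s = 0")
    case True
    then show ?thesis using le E by (intro exI[of _ 0]) (auto simp: E_def intro: order_trans)
  next
    case False
    obtain k where k: "s / 2 < b k"
    proof (rule ccontr)
      assume "\<not> thesis"
      then have "b k \<le> s / 2" for k using that[of k] by force
      then have "s \<le> s / 2" unfolding s_def by (intro cSUP_least) auto
      then show False using False s0 by simp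
    qed
    have "s * E \<le> (2 * b k) * E" using k E by (intro mult_right_mono) auto
    also have "\<dots> \<le> (2 * E + 1) * b k" using b(2)[of k] by (simp add: algebra_simps)
    finally show ?thesis using le by (intro exI[of _ k]) (auto simp: b_def E_def)
  qed
qed

text \<open>It is enough to compare \<open>F\<close> on one circle per unit annulus with a single
  value of \<open>f\<close> there. The maximum principle fills the space between the circles, and
  the values of \<open>f\<close> form a sample of bounded density.\<close>

lemma fock_norm_le_of_circles:
  obtains C where "C > 0"
    "\<And>F f K. F holomorphic_on -{0} \<Longrightarrow> f holomorphic_on -{0} \<Longrightarrow> F 0 = 0 \<Longrightarrow> K > 0 \<Longrightarrow>
      (\<And>m::int. \<exists>w. w \<noteq> 0 \<and> of_int m \<le> lx w \<and> lx w \<le> of_int m + 1 \<and>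
         (\<forall>z. z \<noteq> 0 \<longrightarrow> lx z = lx w \<longrightarrow> V F z \<le> K * V f w)) \<Longrightarrow>
      fock_norm \<alpha> p F \<le> ennreal (C * K) * fock_norm \<alpha> p f"
proof -
  obtain C1 where C1: "C1 > 0" "\<And>F d. F holomorphic_on -{0} \<Longrightarrow> F 0 = 0 \<Longrightarrow> (\<And>m. d m \<ge> 0) \<Longrightarrow> (\<And>z. z \<noteq> 0 \<Longrightarrow> V F z \<le> d \<lfloor>lx z\<rfloor>) \<Longrightarrow>
      fock_norm \<alpha> p F \<le> ennreal C1 * lp_norm p (UNIV :: int set) (\<lambda>m. of_real (d m))"
    by (rule fock_norm_le_lp_norm) blast
  obtain C2 where C2: "C2 > 0" "\<And>(d::int \<Rightarrow> real) (a::int \<Rightarrow> complex) B. B > 0 \<Longrightarrow> (\<And>m. d m \<ge> 0) \<Longrightarrow>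
       (\<And>m. \<exists>k. d m \<le> B * (cmod (a k) * exp (- 1 * \<bar>of_int k - of_int m\<bar>))) \<Longrightarrow>
      lp_norm p UNIV (\<lambda>m. of_real (d m)) \<le> ennreal (C2 * B) * lp_norm p UNIV a"
    by (rule lp_norm_exp_decay_point[OF zero_less_one]) blast
  define K0 where "K0 = 2 * (nat \<lceil>2 * (1 + 1 :: real)\<rceil> + 1)"
  obtain C3 where C3: "C3 > 0" "\<And>(I::int set) w f. window_bounded I (\<lambda>i. lx (w i)) K0 \<Longrightarrow> (\<And>i. i \<in> I \<Longrightarrow> w i \<noteq> 0) \<Longrightarrow>
      f holomorphic_on -{0} \<Longrightarrow> lp_norm p I (\<lambda>i. of_real (V f (w i))) \<le> ennreal C3 * fock_norm \<alpha> p f"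
    by (rule lp_norm_V_le_fock_norm[of K0]) blast
  define A where "A = ann_const 2"
  have A: "A > 0" by (simp add: A_def)
  define C where "C = C1 * (C2 * (A * exp 1) * C3)"
  have main: "fock_norm \<alpha> p F \<le> ennreal (C * K) * fock_norm \<alpha> p f"
    if F: "F holomorphic_on -{0}" "F 0 = 0" and f: "f holomorphic_on -{0}" and K: "K > 0"
      and ex: "\<And>m::int. \<exists>w. w \<noteq> 0 \<and> of_int m \<le> lx w \<and> lx w \<le> of_int m + 1 \<and>
         (\<forall>z. z \<noteq> 0 \<longrightarrow> lx z = lx w \<longrightarrow> V F z \<le> K * V f w)" for F f K
  proof -
    obtain w where w: "\<And>m::int. w m \<noteq> 0" "\<And>m. of_int m \<le> lx (w m)" "\<And>m. lx (w m) \<le> of_int m + 1"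
      "\<And>m z. z \<noteq> 0 \<Longrightarrow> lx z = lx (w m) \<Longrightarrow> V F z \<le> K * V f (w m)"
      using ex by metis
    define u where "u = (\<lambda>m. V f (w m))"
    have u: "u m \<ge> 0" for m by (simp add: u_def V_nonneg)
    \<comment> \<open>The circles chosen for \<open>m - 1\<close> and \<open>m + 1\<close> enclose
      the annulus \<open>m \<le> lx z \<le> m + 1\<close>, at distance at most 2 from its points;
      the circle for \<open>m\<close> itself may lie inside it.\<close>
    define d where "d = (\<lambda>m::int. A * (K * max (u (m - 1)) (u (m + 1))))"
    have d0: "d m \<ge> 0" for m using A K u[of "m - 1"] by (simp add: d_def le_max_iff_disj)
    have "V F z \<le> d \<lfloor>lx z\<rfloor>" if z: "z \<noteq> 0" for z
    proof -
      define m where "m = \<lfloor>lx z\<rfloor>"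
      have m: "of_int m \<le> lx z" "lx z \<le> of_int m + 1" unfolding m_def by linarith+
      show ?thesis unfolding d_def A_def m_def[symmetric]
      proof (rule V_max_principle[OF F(1) z, where ?y1.0 = "lx (w (m - 1))" and ?y2.0 = "lx (w (m + 1))"])
        fix x assume x: "x \<noteq> 0" "lx x = lx (w (m - 1)) \<or> lx x = lx (w (m + 1))"
        then have "V F x \<le> K * u (m - 1) \<or> V F x \<le> K * u (m + 1)" using w(4) by (auto simp: u_def)
        moreover have "K * u (m - 1) \<le> K * max (u (m - 1)) (u (m + 1))" "K * u (m + 1) \<le> K * max (u (m - 1)) (u (m + 1))"
          using K by (auto intro!: mult_left_mono)
        ultimately show "V F x \<le> K * max (u (m - 1)) (u (m + 1))" by linarith
      qed (use m w(2,3)[of "m - 1"] w(2,3)[of "m + 1"] in auto)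
    qed
    then have "fock_norm \<alpha> p F \<le> ennreal C1 * lp_norm p UNIV (\<lambda>m. of_real (d m))"
      by (intro C1(2) F d0)
    also have "\<dots> \<le> ennreal C1 * (ennreal (C2 * (A * exp 1 * K)) * lp_norm p UNIV (\<lambda>m. of_real (u m)))"
    proof (intro mult_left_mono C2(2) d0)
      show "0 < A * exp 1 * K" using A K by simp
      fix m :: int
      \<comment> \<open>Neighbouring indices differ by one, so \<open>exp 1\<close> undoes the decay
        factor.\<close>
      have "d m = A * exp 1 * K * (u (m - 1) * exp (- 1 * \<bar>of_int (m - 1) - of_int m\<bar>)) \<or>
         d m = A * exp 1 * K * (u (m + 1) * exp (- 1 * \<bar>of_int (m + 1) - of_int m\<bar>))"
        by (auto simp: d_def max_def exp_minus)
      then show "\<exists>k. d m \<le> A * exp 1 * K * (cmod (of_real (u k)) * exp (- 1 * \<bar>of_int k - of_int m\<bar>))"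
        using u by (auto intro: exI[of _ "m - 1"] exI[of _ "m + 1"])
    qed auto
    also have "\<dots> \<le> ennreal C1 * (ennreal (C2 * (A * exp 1 * K)) * (ennreal C3 * fock_norm \<alpha> p f))"
    proof (intro mult_left_mono)
      have "window_bounded UNIV (\<lambda>i. lx (w i)) K0" unfolding K0_def
      proof (rule window_bounded_close)
        fix i show "\<bar>lx (w i) - of_int i\<bar> \<le> 1" using w(2)[of i] w(3)[of i] by linarith
      qed
      then show "lp_norm p UNIV (\<lambda>m. of_real (u m)) \<le> ennreal C3 * fock_norm \<alpha> p f"
        unfolding u_def by (intro C3(2) w(1) f)
    qed auto
    also have "\<dots> = ennreal (C * K) * fock_norm \<alpha> p f"
      unfolding mult.assoc[symmetric] using A C1(1) C2(1) C3(1) K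
      by (simp add: ennreal_mult[symmetric] C_def mult_ac)
    finally show ?thesis .
  qed
  have Cpos: "C > 0" using A C1(1) C2(1) C3(1) by (simp add: C_def)
  show ?thesis by (rule that[OF Cpos main])
qed

lemma fock_norm_mono:
  assumes F: "F holomorphic_on -{0}" "F 0 = 0" and f: "f holomorphic_on -{0}" and K: "K > 0"
    and le: "\<And>z. z \<noteq> 0 \<Longrightarrow> cmod (F z) \<le> K * cmod (f z)"
  shows "fock_norm \<alpha> p F \<le> ennreal K * fock_norm \<alpha> p f"
proof -
  have v: "cmod (v F z) \<le> K * cmod (v f z)" for z
  proof (cases "z = 0")
    case True
    then show ?thesis using F(2) K by (simp add: v_def)
  next
    case False
    have "cmod (F z) * exp (- \<alpha> * (ln (cmod z))\<^sup>2) \<le> K * cmod (f z) * exp (- \<alpha> * (ln (cmod z))\<^sup>2)"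
      by (intro mult_right_mono le[OF False]) auto
    then show ?thesis by (simp add: v_def norm_mult)
  qed
  show ?thesis
  proof (cases "p = \<infinity>")
    case inf: True
    have "ennreal (cmod (v F z)) \<le> ennreal K * ennreal (cmod (v f z))" for z
      using v[of z] K by (simp add: ennreal_mult[symmetric] ennreal_leI)
    moreover have "AE z in lborel. ennreal (cmod (v f z)) \<le> fock_norm \<alpha> p f"
      using esssup_AE[of "\<lambda>z. ennreal (cmod (v f z))" lborel] unfolding fock_norm_eq Lp_norm_def by (simp add: inf)
    ultimately have "AE z in lborel. ennreal (cmod (v F z)) \<le> ennreal K * fock_norm \<alpha> p f"
      by (elim eventually_mono) (meson mult_left_mono order_trans zero_le)
    moreover have "(\<lambda>z. ennreal (cmod (v F z))) \<in> borel_measurable lborel"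
      using measurable_v[OF F(1)] by measurable
    ultimately have "esssup lborel (\<lambda>z. ennreal (cmod (v F z))) \<le> ennreal K * fock_norm \<alpha> p f"
      by (intro esssup_I)
    then show ?thesis unfolding fock_norm_eq[of F] Lp_norm_def by (simp add: inf)
  next
    case fin: False
    define q where "q = enn2real p"
    have q: "q > 0" using q_pos[OF fin] by (simp add: q_def)
    have m: "(\<lambda>z. ennreal (cmod (v f z) powr q)) \<in> borel_measurable lborel"
      using measurable_v[OF f] by measurable
    show ?thesis unfolding fock_norm_eq
    proof (rule Lp_norm_le_multI[OF p fin K], fold q_def)
      have "(\<integral>\<^sup>+z. ennreal (cmod (v F z) powr q) \<partial>lborel) \<le> (\<integral>\<^sup>+z. ennreal (K powr q) * ennreal (cmod (v f z) powr q) \<partial>lborel)"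
      proof (intro nn_integral_mono)
        fix z
        have "cmod (v F z) powr q \<le> (K * cmod (v f z)) powr q" using v q by (intro powr_mono2) auto
        then show "ennreal (cmod (v F z) powr q) \<le> ennreal (K powr q) * ennreal (cmod (v f z) powr q)"
          by (simp add: powr_mult ennreal_mult[symmetric] ennreal_leI)
      qed
      also have "\<dots> = ennreal (K powr q) * (\<integral>\<^sup>+z. ennreal (cmod (v f z) powr q) \<partial>lborel)"
        by (rule nn_integral_cmult[OF m])
      finally show "(\<integral>\<^sup>+z. ennreal (cmod (v F z) powr q) \<partial>lborel) \<le> \<dots>" .
    qed
  qed
qed

lemma fock_spaceI:
  "f holomorphic_on -{0} \<Longrightarrow> f 0 = 0 \<Longrightarrow> fock_norm \<alpha> p f < \<infinity> \<Longrightarrow> f \<in> fock_space \<alpha> p"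
  by (simp add: fock_space_def)

lemma fock_spaceD:
  assumes "f \<in> fock_space \<alpha> p"
  shows "f holomorphic_on -{0}" "f 0 = 0" "fock_norm \<alpha> p f < \<infinity>"
  using assms by (auto simp: fock_space_def)

lemma fock_space_cmult:
  assumes f: "f \<in> fock_space \<alpha> p"
  shows "(\<lambda>z. a * f z) \<in> fock_space \<alpha> p"
proof (rule fock_spaceI)
  have "fock_norm \<alpha> p (\<lambda>z. a * f z) \<le> ennreal (cmod a + 1) * fock_norm \<alpha> p f"
    using fock_spaceD[OF f] by (intro fock_norm_mono holomorphic_intros) (auto simp: norm_mult add_nonneg_pos intro!: mult_right_mono)
  also have "\<dots> < \<infinity>" using fock_spaceD(3)[OF f] by (simp add: ennreal_mult_less_top)
  finally show "fock_norm \<alpha> p (\<lambda>z. a * f z) < \<infinity>" .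
qed (use fock_spaceD[OF f] in \<open>auto intro!: holomorphic_intros\<close>)

lemma restriction_op_eq_V:
  assumes "z \<in> \<Lambda>"
  shows "restriction_op \<Lambda> \<alpha> p f z = f z * of_real (wt z)"
  using assms by (simp add: restriction_op_def wt_def)

lemma restriction_op_outside: "z \<notin> \<Lambda> \<Longrightarrow> restriction_op \<Lambda> \<alpha> p f z = 0"
  by (simp add: restriction_op_def)

lemma norm_restriction_op: "z \<in> \<Lambda> \<Longrightarrow> cmod (restriction_op \<Lambda> \<alpha> p f z) = V f z"
  by (simp add: restriction_op_eq_V V_def norm_mult wt_def)

lemma lp_norm_cong_norm:
  assumes eq: "\<And>i. i \<in> I \<Longrightarrow> cmod (a i) = cmod (b i)"
  shows "lp_norm p I a = lp_norm p I b"
proof (cases "p = \<infinity>")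
  case True
  have "lp_norm \<infinity> I a \<le> B \<longleftrightarrow> lp_norm \<infinity> I b \<le> B" for B
    unfolding lp_norm_infty_le_iff using eq by simp
  then show ?thesis unfolding True by (intro antisym) auto
next
  case False
  have "(\<integral>\<^sup>+i. ennreal (cmod (a i) powr enn2real p) \<partial>count_space I) = (\<integral>\<^sup>+i. ennreal (cmod (b i) powr enn2real p) \<partial>count_space I)"
    by (intro nn_integral_cong) (simp add: eq)
  then show ?thesis using False by (simp add: lp_norm_def Lp_norm_def)
qed

lemma lp_norm_bij:
  assumes "bij_betw g I J"
  shows "lp_norm p J a = lp_norm p I (a \<circ> g)"
proof (cases "p = \<infinity>")
  case True
  have "lp_norm \<infinity> J a \<le> lp_norm \<infinity> I (a \<circ> g)"
    unfolding lp_norm_infty_le_iff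
  proof
    fix x assume "x \<in> J"
    then obtain i where "i \<in> I" "x = g i" using assms by (auto simp: bij_betw_def)
    then show "ennreal (cmod (a x)) \<le> lp_norm \<infinity> I (a \<circ> g)" using norm_le_lp_norm[of \<infinity> i I "a \<circ> g"] by simp
  qed
  moreover have "lp_norm \<infinity> I (a \<circ> g) \<le> lp_norm \<infinity> J a"
    unfolding lp_norm_infty_le_iff
    using assms norm_le_lp_norm[of \<infinity> _ J a] by (auto simp: bij_betw_def)
  ultimately show ?thesis using True by simp
next
  case False
  then show ?thesis
    using nn_integral_bij_count_space[OF assms, of "\<lambda>x. ennreal (cmod (a x) powr enn2real p)"]
    by (simp add: lp_norm_def Lp_norm_def)
qed

end

section \<open>Products with prescribed zeros\<close>

text \<open>Factors are compared with \<open>max 1 |\<zeta>|\<close>, with error at most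
  \<open>1 + exp (- a * |y|)\<close> whether \<open>|\<zeta>|\<close> is large or small; the product
  of the errors is at most \<open>exp E\<close>, uniformly in the number of factors.\<close>

lemma prod_one_minus_le:
  fixes \<zeta> :: "nat \<Rightarrow> complex" and y :: "nat \<Rightarrow> real"
  assumes y: "\<And>n. cmod (\<zeta> n) = exp (a * y n)" and a: "a > 0"
    and E: "(\<Sum>n<N. exp (- a * \<bar>y n\<bar>)) \<le> E"
  shows "cmod (\<Prod>n<N. 1 - \<zeta> n) \<le> exp E * (\<Prod>n<N. max 1 (cmod (\<zeta> n)))"
proof -
  have "cmod (1 - \<zeta> n) \<le> max 1 (cmod (\<zeta> n)) * exp (exp (- a * \<bar>y n\<bar>))" for n
  proof -
    have "cmod (1 - \<zeta> n) \<le> 1 + cmod (\<zeta> n)" using norm_triangle_ineq4[of 1 "\<zeta> n"] by simp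
    also have "\<dots> = max 1 (cmod (\<zeta> n)) * (1 + exp (- a * \<bar>y n\<bar>))"
    proof (cases "y n \<ge> 0")
      case True
      then have "max 1 (cmod (\<zeta> n)) = exp (a * y n)" using a by (simp add: y max_def)
      then show ?thesis using True by (simp add: y distrib_left exp_add[symmetric])
    next
      case False
      then have "a * y n \<le> 0" using a by (simp add: mult_le_0_iff)
      then have "max 1 (cmod (\<zeta> n)) = 1" by (simp add: y)
      then show ?thesis using False by (simp add: y)
    qed
    also have "\<dots> \<le> max 1 (cmod (\<zeta> n)) * exp (exp (- a * \<bar>y n\<bar>))"
      by (intro mult_left_mono exp_ge_add_one_self) auto
    finally show ?thesis .
  qed
  then have "(\<Prod>n<N. cmod (1 - \<zeta> n)) \<le> (\<Prod>n<N. max 1 (cmod (\<zeta> n)) * exp (exp (- a * \<bar>y n\<bar>)))"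
    by (intro prod_mono) auto
  also have "\<dots> = (\<Prod>n<N. max 1 (cmod (\<zeta> n))) * exp (\<Sum>n<N. exp (- a * \<bar>y n\<bar>))"
    by (simp add: prod.distrib exp_sum)
  also have "\<dots> \<le> (\<Prod>n<N. max 1 (cmod (\<zeta> n))) * exp E"
    using E by (intro mult_left_mono prod_nonneg) (auto simp: le_max_iff_disj)
  finally show ?thesis by (simp add: prod_norm[symmetric] mult.commute)
qed

text \<open>The 2 serves factors with \<open>b = exp (- a * |y|) \<le> 1 / 2\<close>, through
  \<open>exp (- 2 * b) \<le> 1 - b\<close>; the other entry serves the remaining factors, where
  \<open>exp (- L * b) \<le> \<kappa>\<close>.\<close>

definition low_const :: "real \<Rightarrow> real" where "low_const \<kappa> = max 2 (- 2 * ln \<kappa>)"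

text \<open>Away from \<open>|\<zeta>| = 1\<close> a factor is at least
  \<open>(1 - b) * max 1 |\<zeta>|\<close> by the triangle inequality alone; the separation
  \<open>\<kappa>\<close> is called for only near modulus 1.\<close>

lemma prod_one_minus_ge:
  fixes \<zeta> :: "nat \<Rightarrow> complex" and y :: "nat \<Rightarrow> real"
  assumes y: "\<And>n. cmod (\<zeta> n) = exp (a * y n)" and a: "a > 0"
    and E: "(\<Sum>n<N. exp (- a * \<bar>y n\<bar>)) \<le> E"
    and \<kappa>: "\<kappa> > 0" "\<And>n. \<kappa> * max 1 (cmod (\<zeta> n)) \<le> cmod (1 - \<zeta> n)"
  shows "exp (- low_const \<kappa> * E) * (\<Prod>n<N. max 1 (cmod (\<zeta> n))) \<le> cmod (\<Prod>n<N. 1 - \<zeta> n)"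
proof -
  define L where "L = low_const \<kappa>"
  have L: "L \<ge> 2" "L \<ge> - 2 * ln \<kappa>" by (auto simp: L_def low_const_def)
  have "max 1 (cmod (\<zeta> n)) * exp (- L * exp (- a * \<bar>y n\<bar>)) \<le> cmod (1 - \<zeta> n)" for n
  proof -
    define b where "b = exp (- a * \<bar>y n\<bar>)"
    have b0: "b > 0" by (simp add: b_def)
    have m0: "max 1 (cmod (\<zeta> n)) \<ge> 0" by simp
    show ?thesis
    proof (cases "b \<le> 1 / 2")
      case True
      have "exp (- L * b) \<le> exp (- 2 * b)" using L b0 by simp
      also have "\<dots> \<le> 1 - b"
      proof -
        have "1 \<le> (1 - b) * (1 + 2 * b)"
          using mult_nonneg_nonneg[of b "1 - 2 * b"] True b0 by (simp add: algebra_simps)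
        also have "\<dots> \<le> (1 - b) * exp (2 * b)"
          using True by (intro mult_left_mono exp_ge_add_one_self) auto
        finally have "1 * exp (- 2 * b) \<le> (1 - b) * exp (2 * b) * exp (- 2 * b)"
          by (intro mult_right_mono) auto
        then show ?thesis by (simp add: mult.assoc exp_add[symmetric])
      qed
      finally have "max 1 (cmod (\<zeta> n)) * exp (- L * b) \<le> max 1 (cmod (\<zeta> n)) * (1 - b)"
        by (intro mult_left_mono) auto
      also have "\<dots> = \<bar>1 - cmod (\<zeta> n)\<bar>"
      proof (cases "y n \<ge> 0")
        case True
        then have m: "max 1 (cmod (\<zeta> n)) = exp (a * y n)" and "1 \<le> exp (a * y n)" using a by (simp_all add: y max_def)
        then show ?thesis using True by (simp add: y b_def right_diff_distrib exp_add[symmetric])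
      next
        case False
        then have le: "a * y n \<le> 0" using a by (simp add: mult_le_0_iff)
        then have "max 1 (cmod (\<zeta> n)) = 1" by (simp add: y)
        then show ?thesis using False le by (simp add: y b_def)
      qed
      also have "\<dots> \<le> cmod (1 - \<zeta> n)" using norm_triangle_ineq3[of 1 "\<zeta> n"] by simp
      finally show ?thesis by (simp add: b_def)
    next
      case False
      have "- L * b \<le> ln \<kappa>"
      proof (cases "ln \<kappa> \<ge> 0")
        case True
        then show ?thesis using L b0 by (smt (verit) mult_nonneg_nonneg mult_minus_left)
      next
        case neg: False
        have "L * b \<ge> (- 2 * ln \<kappa>) * (1 / 2)" using False L neg by (intro mult_mono) auto
        then show ?thesis by simp
      qed
      then have "exp (- L * b) \<le> \<kappa>" using \<kappa>(1) by (metis exp_le_cancel_iff exp_ln)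
      then have "max 1 (cmod (\<zeta> n)) * exp (- L * b) \<le> max 1 (cmod (\<zeta> n)) * \<kappa>"
        by (intro mult_left_mono) auto
      also have "\<dots> \<le> cmod (1 - \<zeta> n)" using \<kappa>(2)[of n] by (simp add: mult.commute)
      finally show ?thesis by (simp add: b_def)
    qed
  qed
  then have "(\<Prod>n<N. max 1 (cmod (\<zeta> n)) * exp (- L * exp (- a * \<bar>y n\<bar>))) \<le> (\<Prod>n<N. cmod (1 - \<zeta> n))"
    by (intro prod_mono) (auto simp: le_max_iff_disj)
  moreover have "(\<Prod>n<N. max 1 (cmod (\<zeta> n)) * exp (- L * exp (- a * \<bar>y n\<bar>)))
      = (\<Prod>n<N. max 1 (cmod (\<zeta> n))) * exp (- L * (\<Sum>n<N. exp (- a * \<bar>y n\<bar>)))"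
    by (simp only: prod.distrib sum_distrib_left exp_sum finite_lessThan)
  moreover have "(\<Prod>n<N. max 1 (cmod (\<zeta> n))) * exp (- L * (\<Sum>n<N. exp (- a * \<bar>y n\<bar>))) \<ge> (\<Prod>n<N. max 1 (cmod (\<zeta> n))) * exp (- L * E)"
    using E L by (intro mult_left_mono prod_nonneg) (auto simp: le_max_iff_disj intro!: mult_left_mono)
  ultimately show ?thesis by (simp add: prod_norm[symmetric] mult.commute L_def)
qed

section \<open>Canonical products over a separated sequence\<close>

locale zero_seq = log_weight \<alpha> c for \<alpha> c +
  fixes l :: "int \<Rightarrow> complex" and K :: nat and \<kappa> :: real
  assumes l0: "l k \<noteq> 0" and mono_step: "cmod (l k) \<le> cmod (l (k + 1))"
    and win: "window_bounded UNIV (\<lambda>k. lx (l k)) K"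
    and \<kappa>: "\<kappa> > 0"
    and sep: "j \<noteq> k \<Longrightarrow> \<kappa> * max (cmod (l j)) (cmod (l k)) \<le> cmod (l j - l k)"
begin

definition x :: "int \<Rightarrow> real" where "x k = lx (l k)"

definition a :: real where "a = 1 / (2 * \<alpha>)"

lemma a_pos: "a > 0" using alpha by (simp add: a_def)

lemma x_mono: "j \<le> k \<Longrightarrow> x j \<le> x k"
proof (induction k rule: int_ge_induct)
  case base then show ?case by simp
next
  case (step i)
  then show ?case using mono_step[of i] norm_le_iff_lx[OF l0 l0] unfolding x_def by (metis order_trans)
qed

lemma norm_quot: "z \<noteq> 0 \<Longrightarrow> cmod (z / l j) = exp (a * (lx z - x j))"
  using norm_quotient_lx[OF _ l0, of z j] by (simp add: x_def a_def)

lemma norm_quot': "z \<noteq> 0 \<Longrightarrow> cmod (l j / z) = exp (a * (x j - lx z))"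
  using norm_quotient_lx[OF l0, of z j] by (simp add: x_def a_def)

lemma norm_l: "cmod (l j) = exp (a * x j) * rad 0"
  unfolding norm_eq_lx[OF l0] rad_def exp_add[symmetric] a_def x_def by (simp add: add_divide_distrib)

definition E :: real where "E = exp_sum_bound a K"

lemma exp_sum_inj_le:
  fixes i :: "nat \<Rightarrow> int"
  assumes "inj i"
  shows "(\<Sum>n<N. exp (- a * \<bar>x (i n) - t\<bar>)) \<le> E"
proof -
  have "(\<Sum>n<N. exp (- a * \<bar>x (i n) - t\<bar>)) = (\<Sum>j\<in>i ` {..<N}. exp (- a * \<bar>x j - t\<bar>))"
    using assms by (subst sum.reindex) (auto simp: inj_on_def inj_def)
  also have "\<dots> \<le> E" unfolding E_def x_def by (rule exp_sum_le[OF win a_pos finite_imageI[OF finite_lessThan] subset_UNIV])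
  finally show ?thesis .
qed

text \<open>Both enumerations start next to \<open>k\<close>, so that \<open>l k\<close> is left out
  of the products.\<close>

definition fw :: "int \<Rightarrow> nat \<Rightarrow> int" where "fw k n = k + 1 + int n"
definition bw :: "int \<Rightarrow> nat \<Rightarrow> int" where "bw k n = k - 1 - int n"

lemma inj_fw: "inj (fw k)" and inj_bw: "inj (bw k)" by (auto simp: inj_def fw_def bw_def)

text \<open>Zeros beyond \<open>l k\<close> enter through \<open>z / l j\<close>, zeros before it
  through \<open>l j / z\<close>; this way both products converge on the whole punctured plane.
  \<open>MA\<close> and \<open>MB\<close> are models that depend on \<open>|z|\<close>
  alone.\<close>

definition A :: "int \<Rightarrow> nat \<Rightarrow> complex \<Rightarrow> complex" where "A k N z = (\<Prod>n<N. 1 - z / l (fw k n))"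
definition B :: "int \<Rightarrow> nat \<Rightarrow> complex \<Rightarrow> complex" where "B k N z = (\<Prod>n<N. 1 - l (bw k n) / z)"
definition MA :: "int \<Rightarrow> nat \<Rightarrow> complex \<Rightarrow> real" where "MA k N z = (\<Prod>n<N. max 1 (cmod (z / l (fw k n))))"
definition MB :: "int \<Rightarrow> nat \<Rightarrow> complex \<Rightarrow> real" where "MB k N z = (\<Prod>n<N. max 1 (cmod (l (bw k n) / z)))"

definition PA :: "int \<Rightarrow> complex \<Rightarrow> complex" where "PA k z = lim (\<lambda>N. A k N z)"
definition PB :: "int \<Rightarrow> complex \<Rightarrow> complex" where "PB k z = lim (\<lambda>N. B k N z)"
definition P :: "int \<Rightarrow> complex \<Rightarrow> complex" where "P k z = PA k z * PB k z"

lemma A_le: "z \<noteq> 0 \<Longrightarrow> cmod (A k N z) \<le> exp E * MA k N z"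
  unfolding A_def MA_def
  by (rule prod_one_minus_le[OF norm_quot a_pos], simp)
     (use exp_sum_inj_le[OF inj_fw] in \<open>simp add: abs_minus_commute\<close>)

lemma B_le: "z \<noteq> 0 \<Longrightarrow> cmod (B k N z) \<le> exp E * MB k N z"
  unfolding B_def MB_def
  by (rule prod_one_minus_le[OF norm_quot' a_pos], simp)
     (use exp_sum_inj_le[OF inj_bw] in \<open>simp add: abs_minus_commute\<close>)

text \<open>Relative distance at least \<open>\<rho>\<close> from the zeros, the index
  \<open>k\<close> being exempt so that \<open>l k\<close> itself is admissible for
  \<open>P k\<close>.\<close>

definition good :: "int \<Rightarrow> real \<Rightarrow> complex \<Rightarrow> bool" where
  "good k \<rho> z \<longleftrightarrow> z \<noteq> 0 \<and> \<rho> > 0 \<and> (\<forall>j. j \<noteq> k \<longrightarrow> \<rho> * max (cmod z) (cmod (l j)) \<le> cmod (z - l j))"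

lemma good_quot:
  assumes "good k \<rho> z" "j \<noteq> k"
  shows "\<rho> * max 1 (cmod (z / l j)) \<le> cmod (1 - z / l j)"
    and "\<rho> * max 1 (cmod (l j / z)) \<le> cmod (1 - l j / z)"
proof -
  have g: "\<rho> * max (cmod z) (cmod (l j)) \<le> cmod (z - l j)" and z: "z \<noteq> 0"
    using assms by (auto simp: good_def)
  have "\<rho> * max 1 (cmod (z / l j)) = \<rho> * max (cmod z) (cmod (l j)) / cmod (l j)"
    using l0[of j] by (auto simp: norm_divide max_def field_simps)
  also have "\<dots> \<le> cmod (z - l j) / cmod (l j)" using g by (intro divide_right_mono) auto
  also have "\<dots> = cmod (1 - z / l j)"
    using l0[of j] by (simp add: norm_divide[symmetric] diff_divide_distrib norm_minus_commute)
  finally show "\<rho> * max 1 (cmod (z / l j)) \<le> cmod (1 - z / l j)" .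
  have "\<rho> * max 1 (cmod (l j / z)) = \<rho> * max (cmod z) (cmod (l j)) / cmod z"
    using z by (auto simp: norm_divide max_def field_simps)
  also have "\<dots> \<le> cmod (z - l j) / cmod z" using g by (intro divide_right_mono) auto
  also have "\<dots> = cmod (1 - l j / z)"
    using z by (simp add: norm_divide[symmetric] diff_divide_distrib)
  finally show "\<rho> * max 1 (cmod (l j / z)) \<le> cmod (1 - l j / z)" .
qed

lemma A_ge:
  assumes "good k \<rho> z"
  shows "exp (- low_const \<rho> * E) * MA k N z \<le> cmod (A k N z)"
  unfolding A_def MA_def
proof (rule prod_one_minus_ge[OF norm_quot a_pos])
  show "(\<Sum>n<N. exp (- a * \<bar>lx z - x (fw k n)\<bar>)) \<le> E"
    using exp_sum_inj_le[OF inj_fw, where t = "lx z"] by (simp add: abs_minus_commute)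
  show "\<rho> * max 1 (cmod (z / l (fw k n))) \<le> cmod (1 - z / l (fw k n))" for n
    by (rule good_quot[OF assms]) (simp add: fw_def)
qed (use assms in \<open>auto simp: good_def\<close>)

lemma B_ge:
  assumes "good k \<rho> z"
  shows "exp (- low_const \<rho> * E) * MB k N z \<le> cmod (B k N z)"
  unfolding B_def MB_def
proof (rule prod_one_minus_ge[OF norm_quot' a_pos])
  show "(\<Sum>n<N. exp (- a * \<bar>x (bw k n) - lx z\<bar>)) \<le> E"
    by (rule exp_sum_inj_le[OF inj_bw])
  show "\<rho> * max 1 (cmod (l (bw k n) / z)) \<le> cmod (1 - l (bw k n) / z)" for n
    by (rule good_quot[OF assms]) (simp add: bw_def)
qed (use assms in \<open>auto simp: good_def\<close>)

lemma summable_fw: "summable (\<lambda>n. exp (- a * \<bar>x (fw k n) - t\<bar>))"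
  and summable_bw: "summable (\<lambda>n. exp (- a * \<bar>x (bw k n) - t\<bar>))"
  by (rule summableI_nonneg_bounded[where x = E]; use exp_sum_inj_le[OF inj_fw] exp_sum_inj_le[OF inj_bw] in simp)+

lemma uniform_limit_A:
  "uniform_limit (cball 0 R) (A k) (PA k) sequentially"
proof -
  have "uniformly_convergent_on (cball 0 R) (\<lambda>N z. \<Prod>n<N. 1 - z / l (fw k n))"
  proof (rule uniformly_convergent_on_prod')
    show "uniformly_convergent_on (cball 0 R) (\<lambda>N z. \<Sum>n<N. norm (1 - z / l (fw k n) - 1))"
    proof (rule Weierstrass_m_test')
      show "summable (\<lambda>n. \<bar>R\<bar> / rad 0 * exp (- a * \<bar>x (fw k n) - 0\<bar>) * exp (2 * a * \<bar>x k\<bar>))"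
        by (intro summable_mult summable_mult2 summable_fw)
      fix n and z :: complex assume z: "z \<in> cball 0 R"
      \<comment> \<open>Summability is known for \<open>exp (- a * |x j|)\<close>; beyond
        \<open>k\<close> the coordinates are bounded below by \<open>x k\<close>, so the absolute
        value costs only the factor \<open>exp (2 * a * |x k|)\<close>.\<close>
      have "x (fw k n) \<ge> x k" by (rule x_mono) (simp add: fw_def)
      then have "\<bar>x (fw k n)\<bar> \<le> x (fw k n) + 2 * \<bar>x k\<bar>" by linarith
      then have "a * \<bar>x (fw k n)\<bar> \<le> a * (x (fw k n) + 2 * \<bar>x k\<bar>)" using a_pos by (intro mult_left_mono) auto
      then have "exp (- a * x (fw k n)) \<le> exp (- a * \<bar>x (fw k n) - 0\<bar>) * exp (2 * a * \<bar>x k\<bar>)"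
        by (simp add: exp_add[symmetric] algebra_simps)
      moreover have "1 / cmod (l (fw k n)) = exp (- a * x (fw k n)) / rad 0"
        unfolding norm_l by (simp add: exp_minus divide_inverse)
      ultimately have "1 / cmod (l (fw k n)) \<le> exp (- a * \<bar>x (fw k n) - 0\<bar>) * exp (2 * a * \<bar>x k\<bar>) / rad 0"
        by (simp add: divide_right_mono less_imp_le)
      then have "cmod z * (1 / cmod (l (fw k n))) \<le> \<bar>R\<bar> * (exp (- a * \<bar>x (fw k n) - 0\<bar>) * exp (2 * a * \<bar>x k\<bar>) / rad 0)"
        using z by (intro mult_mono) auto
      then show "norm (norm (1 - z / l (fw k n) - 1)) \<le> \<bar>R\<bar> / rad 0 * exp (- a * \<bar>x (fw k n) - 0\<bar>) * exp (2 * a * \<bar>x k\<bar>)"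
        by (simp add: norm_divide)
    qed
  qed (use l0 in \<open>auto intro!: continuous_intros\<close>)
  then show ?thesis
    unfolding uniformly_convergent_uniform_limit_iff PA_def[abs_def] A_def[abs_def] .
qed

lemma uniform_limit_B:
  assumes r: "r > 0"
  shows "uniform_limit (cball w R - ball 0 r) (B k) (PB k) sequentially"
proof -
  have "uniformly_convergent_on (cball w R - ball 0 r) (\<lambda>N z. \<Prod>n<N. 1 - l (bw k n) / z)"
  proof (rule uniformly_convergent_on_prod')
    show "uniformly_convergent_on (cball w R - ball 0 r) (\<lambda>N z. \<Sum>n<N. norm (1 - l (bw k n) / z - 1))"
    proof (rule Weierstrass_m_test')
      show "summable (\<lambda>n. rad 0 / r * exp (- a * \<bar>x (bw k n) - 0\<bar>) * exp (2 * a * \<bar>x k\<bar>))"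
        by (intro summable_mult summable_mult2 summable_bw)
      fix n and z :: complex assume z: "z \<in> cball w R - ball 0 r"
      have "x (bw k n) \<le> x k" by (rule x_mono) (simp add: bw_def)
      then have "\<bar>x (bw k n)\<bar> \<le> 2 * \<bar>x k\<bar> - x (bw k n)" by linarith
      then have "a * \<bar>x (bw k n)\<bar> \<le> a * (2 * \<bar>x k\<bar> - x (bw k n))" using a_pos by (intro mult_left_mono) auto
      then have "exp (a * x (bw k n)) \<le> exp (- a * \<bar>x (bw k n) - 0\<bar>) * exp (2 * a * \<bar>x k\<bar>)"
        by (simp add: exp_add[symmetric] algebra_simps)
      moreover have "cmod (l (bw k n)) = exp (a * x (bw k n)) * rad 0"
        by (rule norm_l)
      ultimately have "cmod (l (bw k n)) \<le> exp (- a * \<bar>x (bw k n) - 0\<bar>) * exp (2 * a * \<bar>x k\<bar>) * rad 0"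
        by (simp add: mult_right_mono less_imp_le)
      then have "cmod (l (bw k n)) / cmod z \<le> exp (- a * \<bar>x (bw k n) - 0\<bar>) * exp (2 * a * \<bar>x k\<bar>) * rad 0 / r"
        using z r by (intro frac_le) (auto simp: less_imp_le)
      then show "norm (norm (1 - l (bw k n) / z - 1)) \<le> rad 0 / r * exp (- a * \<bar>x (bw k n) - 0\<bar>) * exp (2 * a * \<bar>x k\<bar>)"
        by (simp add: norm_divide mult_ac)
    qed
  next
    show "compact (cball w R - ball 0 r)" by (intro compact_diff) auto
  qed (use r in \<open>auto intro!: continuous_intros\<close>)
  then show ?thesis
    unfolding uniformly_convergent_uniform_limit_iff PB_def[abs_def] B_def[abs_def] .
qed

lemma lim_A: "(\<lambda>N. A k N z) \<longlonglongrightarrow> PA k z"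
  by (rule tendsto_uniform_limitI[OF uniform_limit_A[where R = "cmod z"]]) simp

lemma lim_B: "z \<noteq> 0 \<Longrightarrow> (\<lambda>N. B k N z) \<longlonglongrightarrow> PB k z"
  by (rule tendsto_uniform_limitI[OF uniform_limit_B[where r = "cmod z" and w = z and R = 0]]) auto

lemma holomorphic_PA: "PA k holomorphic_on -{0}"
proof (rule holomorphic_uniform_sequence[of _ "A k"])
  show "A k n holomorphic_on -{0}" for n
    unfolding A_def[abs_def] using l0 by (intro holomorphic_intros) auto
  show "\<exists>d>0. cball z d \<subseteq> -{0} \<and> uniform_limit (cball z d) (A k) (PA k) sequentially" if "z \<in> -{0}" for z
  proof (intro exI[of _ "cmod z / 2"] conjI)
    have "cball z (cmod z / 2) \<subseteq> cball 0 (2 * cmod z)"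
      by (auto simp: dist_norm) (smt (verit) norm_triangle_ineq2 norm_minus_commute norm_ge_zero)
    then show "uniform_limit (cball z (cmod z / 2)) (A k) (PA k) sequentially"
      using uniform_limit_on_subset[OF uniform_limit_A] by blast
  qed (use that in auto)
qed auto

lemma holomorphic_PB: "PB k holomorphic_on -{0}"
proof (rule holomorphic_uniform_sequence[of _ "B k"])
  show "B k n holomorphic_on -{0}" for n
    unfolding B_def[abs_def] by (intro holomorphic_intros) auto
  show "\<exists>d>0. cball z d \<subseteq> -{0} \<and> uniform_limit (cball z d) (B k) (PB k) sequentially" if "z \<in> -{0}" for z
  proof (intro exI[of _ "cmod z / 2"] conjI)
    have "cball z (cmod z / 2) \<subseteq> cball z (cmod z / 2) - ball 0 (cmod z / 2)"
      by (auto simp: dist_norm) (smt (verit) norm_triangle_ineq2 norm_minus_commute norm_ge_zero)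
    then show "uniform_limit (cball z (cmod z / 2)) (B k) (PB k) sequentially"
      using that by (intro uniform_limit_on_subset[OF uniform_limit_B[where r = "cmod z / 2" and w = z and R = "cmod z / 2"]]) auto
  qed (use that in auto)
qed auto

lemma holomorphic_P: "P k holomorphic_on -{0}"
  unfolding P_def[abs_def] by (intro holomorphic_intros holomorphic_PA holomorphic_PB)

lemma PA_Suc: "PA k z = (1 - z / l (k + 1)) * PA (k + 1) z"
proof -
  have "A k (Suc N) z = (1 - z / l (k + 1)) * A (k + 1) N z" for N
    unfolding A_def prod.lessThan_Suc_shift by (simp add: fw_def add_ac)
  then have 1: "(\<lambda>N. A k (Suc N) z) \<longlonglongrightarrow> (1 - z / l (k + 1)) * PA (k + 1) z"
    by (simp add: tendsto_mult_left lim_A)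
  have 2: "(\<lambda>N. A k (Suc N) z) \<longlonglongrightarrow> PA k z" using lim_A by (rule LIMSEQ_Suc)
  show ?thesis by (rule LIMSEQ_unique[OF 2 1])
qed

lemma PB_Suc: "z \<noteq> 0 \<Longrightarrow> PB (k + 1) z = (1 - l k / z) * PB k z"
proof -
  assume z: "z \<noteq> 0"
  have "B (k + 1) (Suc N) z = (1 - l k / z) * B k N z" for N
    unfolding B_def prod.lessThan_Suc_shift by (simp add: bw_def algebra_simps)
  then have 1: "(\<lambda>N. B (k + 1) (Suc N) z) \<longlonglongrightarrow> (1 - l k / z) * PB k z"
    by (simp add: tendsto_mult_left lim_B[OF z])
  have 2: "(\<lambda>N. B (k + 1) (Suc N) z) \<longlonglongrightarrow> PB (k + 1) z" using lim_B[OF z] by (rule LIMSEQ_Suc)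
  show ?thesis by (rule LIMSEQ_unique[OF 2 1])
qed

text \<open>Passing from \<open>k\<close> to \<open>k + 1\<close> trades the factor of
  \<open>l (k + 1)\<close> for that of \<open>l k\<close>.\<close>

lemma P_Suc: "z \<noteq> 0 \<Longrightarrow> P k z * (1 - l k / z) = P (k + 1) z * (1 - z / l (k + 1))"
  by (simp add: P_def PA_Suc[of k] PB_Suc)

lemma P_zero:
  assumes "j \<noteq> k"
  shows "P k (l j) = 0"
proof (cases "j > k")
  case True
  define n where "n = nat (j - k - 1)"
  have n: "fw k n = j" using True by (simp add: fw_def n_def)
  have "A k N (l j) = 0" if "N \<ge> Suc n" for N
    unfolding A_def using that n l0[of j] by (intro prod_zero) (auto intro!: bexI[of _ n])
  then have "PA k (l j) = 0"
    by (intro LIMSEQ_unique[OF lim_A tendsto_eventually] eventually_sequentiallyI[of "Suc n"])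
  then show ?thesis by (simp add: P_def)
next
  case False
  define n where "n = nat (k - j - 1)"
  have n: "bw k n = j" using False assms by (simp add: bw_def n_def)
  have "B k N (l j) = 0" if "N \<ge> Suc n" for N
    unfolding B_def using that n l0[of j] by (intro prod_zero) (auto intro!: bexI[of _ n])
  then have "PB k (l j) = 0"
    by (intro LIMSEQ_unique[OF lim_B[OF l0] tendsto_eventually] eventually_sequentiallyI[of "Suc n"])
  then show ?thesis by (simp add: P_def)
qed

lemma sum_fw: "k \<le> m \<Longrightarrow> (\<Sum>n<nat (m - k). f (fw k n)) = (\<Sum>j=k+1..m. f j :: real)"
proof -
  assume km: "k \<le> m"
  have "bij_betw (fw k) {..<nat (m - k)} {k+1..m}"
    by (rule bij_betwI[where g = "\<lambda>j. nat (j - k - 1)"]) (use km in \<open>auto simp: fw_def\<close>)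
  then show ?thesis by (rule sum.reindex_bij_betw)
qed

lemma sum_bw: "m \<le> k \<Longrightarrow> (\<Sum>n<nat (k - m). f (bw k n)) = (\<Sum>j=m..k-1. f j :: real)"
proof -
  assume km: "m \<le> k"
  have "bij_betw (bw k) {..<nat (k - m)} {m..k-1}"
    by (rule bij_betwI[where g = "\<lambda>j. nat (k - 1 - j)"]) (use km in \<open>auto simp: bw_def\<close>)
  then show ?thesis by (rule sum.reindex_bij_betw)
qed

lemma prod_ge_exp_sum:
  fixes f g :: "nat \<Rightarrow> real"
  assumes "M \<le> N" "\<And>n. exp (f n) \<le> g n" "\<And>n. 1 \<le> g n"
  shows "exp (\<Sum>n<M. f n) \<le> (\<Prod>n<N. g n)"
proof -
  have "exp (\<Sum>n<M. f n) = (\<Prod>n<M. exp (f n))" by (simp add: exp_sum)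
  also have "\<dots> \<le> (\<Prod>n<M. g n)" using assms by (intro prod_mono) auto
  also have "\<dots> \<le> (\<Prod>n<N. g n)"
    using assms by (intro prod_mono2) (auto intro: order_trans[OF zero_le_one])
  finally show ?thesis .
qed

lemma prod_le_exp_sum:
  fixes f g :: "nat \<Rightarrow> real"
  assumes "M \<le> N" "\<And>n. n < M \<Longrightarrow> g n \<le> exp (f n)" "\<And>n. n \<ge> M \<Longrightarrow> g n \<le> 1" "\<And>n. 1 \<le> g n"
  shows "(\<Prod>n<N. g n) \<le> exp (\<Sum>n<M. f n)"
proof -
  have g: "g n = 1" if "n \<ge> M" for n using assms(3)[OF that] assms(4)[of n] by linarith
  have g0: "0 \<le> g n" for n using assms(4)[of n] by linarith
  have "(\<Prod>n<N. g n) = (\<Prod>n<M. g n)"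
    by (rule prod.mono_neutral_right) (use assms(1) g in auto)
  also have "\<dots> \<le> (\<Prod>n<M. exp (f n))" using assms(2) g0 by (intro prod_mono) auto
  also have "\<dots> = exp (\<Sum>n<M. f n)" by (simp add: exp_sum)
  finally show ?thesis .
qed

text \<open>Every factor of \<open>MA\<close> is at least 1 and at least the quotient itself, so any
  cut \<open>m\<close> gives a lower bound, wherever \<open>z\<close> lies.\<close>

lemma MA_ge:
  assumes z: "z \<noteq> 0" and m: "k \<le> m" and N: "nat (m - k) \<le> N"
  shows "exp (a * (\<Sum>j=k+1..m. lx z - x j)) \<le> MA k N z"
proof -
  have "exp (\<Sum>n<nat (m - k). a * (lx z - x (fw k n))) \<le> MA k N z"
    unfolding MA_def by (rule prod_ge_exp_sum[OF N]) (use norm_quot[OF z] in \<open>auto simp: le_max_iff_disj\<close>)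
  then show ?thesis using sum_fw[OF m, of "\<lambda>j. a * (lx z - x j)"] by (simp add: sum_distrib_left)
qed

lemma MB_ge:
  assumes z: "z \<noteq> 0" and m: "m \<le> k" and N: "nat (k - m) \<le> N"
  shows "exp (a * (\<Sum>j=m..k-1. x j - lx z)) \<le> MB k N z"
proof -
  have "exp (\<Sum>n<nat (k - m). a * (x (bw k n) - lx z)) \<le> MB k N z"
    unfolding MB_def by (rule prod_ge_exp_sum[OF N]) (use norm_quot'[OF z] in \<open>auto simp: le_max_iff_disj\<close>)
  then show ?thesis using sum_bw[OF m, of "\<lambda>j. a * (x j - lx z)"] by (simp add: sum_distrib_left)
qed

text \<open>Here the cut must be the true one, with \<open>z\<close> between the zeros
  \<open>m\<close> and \<open>m + 1\<close>: factors before it are the quotients, those after it are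
  1. For \<open>m = k\<close> nothing lies before the cut.\<close>

lemma MA_le:
  assumes z: "z \<noteq> 0" and m: "k \<le> m" and N: "nat (m - k) \<le> N"
    and low: "m = k \<or> x m \<le> lx z" and up: "lx z \<le> x (m + 1)"
  shows "MA k N z \<le> exp (a * (\<Sum>j=k+1..m. lx z - x j))"
proof -
  have "MA k N z \<le> exp (\<Sum>n<nat (m - k). a * (lx z - x (fw k n)))"
    unfolding MA_def
  proof (rule prod_le_exp_sum[OF N])
    fix n assume n: "n < nat (m - k)"
    then have "m \<noteq> k" "fw k n \<le> m" by (auto simp: fw_def)
    then have "x (fw k n) \<le> lx z" using low x_mono[of "fw k n" m] by auto
    then show "max 1 (cmod (z / l (fw k n))) \<le> exp (a * (lx z - x (fw k n)))"
      using a_pos by (simp add: norm_quot[OF z])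
  next
    fix n assume n: "n \<ge> nat (m - k)"
    then have "m + 1 \<le> fw k n" using m by (auto simp: fw_def)
    then have "lx z \<le> x (fw k n)" using up x_mono[of "m + 1" "fw k n"] by auto
    then show "max 1 (cmod (z / l (fw k n))) \<le> 1"
      using a_pos by (simp add: norm_quot[OF z] mult_le_0_iff)
  qed auto
  then show ?thesis using sum_fw[OF m, of "\<lambda>j. a * (lx z - x j)"] by (simp add: sum_distrib_left)
qed

lemma MB_le:
  assumes z: "z \<noteq> 0" and m: "m \<le> k" and N: "nat (k - m) \<le> N"
    and up: "m = k \<or> lx z \<le> x m" and low: "x (m - 1) \<le> lx z"
  shows "MB k N z \<le> exp (a * (\<Sum>j=m..k-1. x j - lx z))"
proof -
  have "MB k N z \<le> exp (\<Sum>n<nat (k - m). a * (x (bw k n) - lx z))"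
    unfolding MB_def
  proof (rule prod_le_exp_sum[OF N])
    fix n assume n: "n < nat (k - m)"
    then have "m \<noteq> k" "m \<le> bw k n" by (auto simp: bw_def)
    then have "lx z \<le> x (bw k n)" using up x_mono[of m "bw k n"] by auto
    then show "max 1 (cmod (l (bw k n) / z)) \<le> exp (a * (x (bw k n) - lx z))"
      using a_pos by (simp add: norm_quot'[OF z])
  next
    fix n assume n: "n \<ge> nat (k - m)"
    then have "bw k n \<le> m - 1" using m by (auto simp: bw_def)
    then have "x (bw k n) \<le> lx z" using low x_mono[of "bw k n" "m - 1"] by auto
    then show "max 1 (cmod (l (bw k n) / z)) \<le> 1"
      using a_pos by (simp add: norm_quot'[OF z] mult_le_0_iff)
  qed auto
  then show ?thesis using sum_bw[OF m, of "\<lambda>j. a * (x j - lx z)"] by (simp add: sum_distrib_left)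
qed

lemma PA_upper:
  assumes "z \<noteq> 0" "k \<le> m" "m = k \<or> x m \<le> lx z" "lx z \<le> x (m + 1)"
  shows "cmod (PA k z) \<le> exp E * exp (a * (\<Sum>j=k+1..m. lx z - x j))"
proof (rule LIMSEQ_le_const2[OF tendsto_norm[OF lim_A]])
  have "cmod (A k N z) \<le> exp E * exp (a * (\<Sum>j=k+1..m. lx z - x j))" if "N \<ge> nat (m - k)" for N
    using A_le[OF assms(1), of k N] MA_le[OF assms(1,2) that assms(3,4)]
    by (meson exp_ge_zero mult_left_mono order_trans)
  then show "\<exists>N. \<forall>n\<ge>N. cmod (A k n z) \<le> exp E * exp (a * (\<Sum>j=k+1..m. lx z - x j))" by blast
qed

lemma PB_upper:
  assumes "z \<noteq> 0" "m \<le> k" "m = k \<or> lx z \<le> x m" "x (m - 1) \<le> lx z"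
  shows "cmod (PB k z) \<le> exp E * exp (a * (\<Sum>j=m..k-1. x j - lx z))"
proof (rule LIMSEQ_le_const2[OF tendsto_norm[OF lim_B[OF assms(1)]]])
  have "cmod (B k N z) \<le> exp E * exp (a * (\<Sum>j=m..k-1. x j - lx z))" if "N \<ge> nat (k - m)" for N
    using B_le[OF assms(1), of k N] MB_le[OF assms(1,2) that assms(3,4)]
    by (meson exp_ge_zero mult_left_mono order_trans)
  then show "\<exists>N. \<forall>n\<ge>N. cmod (B k n z) \<le> exp E * exp (a * (\<Sum>j=m..k-1. x j - lx z))" by blast
qed

lemma PA_lower:
  assumes g: "good k \<rho> z" and m: "k \<le> m"
  shows "exp (- low_const \<rho> * E) * exp (a * (\<Sum>j=k+1..m. lx z - x j)) \<le> cmod (PA k z)"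
proof (rule LIMSEQ_le_const[OF tendsto_norm[OF lim_A]])
  have z: "z \<noteq> 0" using g by (simp add: good_def)
  have "exp (- low_const \<rho> * E) * exp (a * (\<Sum>j=k+1..m. lx z - x j)) \<le> cmod (A k N z)" if "N \<ge> nat (m - k)" for N
    using A_ge[OF g, of N] MA_ge[OF z m that]
    by (meson exp_ge_zero mult_left_mono order_trans)
  then show "\<exists>N. \<forall>n\<ge>N. exp (- low_const \<rho> * E) * exp (a * (\<Sum>j=k+1..m. lx z - x j)) \<le> cmod (A k n z)" by blast
qed

lemma PB_lower:
  assumes g: "good k \<rho> z" and m: "m \<le> k"
  shows "exp (- low_const \<rho> * E) * exp (a * (\<Sum>j=m..k-1. x j - lx z)) \<le> cmod (PB k z)"
proof -
  have z: "z \<noteq> 0" using g by (simp add: good_def)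
  show ?thesis
  proof (rule LIMSEQ_le_const[OF tendsto_norm[OF lim_B[OF z]]])
    have "exp (- low_const \<rho> * E) * exp (a * (\<Sum>j=m..k-1. x j - lx z)) \<le> cmod (B k N z)" if "N \<ge> nat (k - m)" for N
      using B_ge[OF g, of N] MB_ge[OF z m that]
      by (meson exp_ge_zero mult_left_mono order_trans)
    then show "\<exists>N. \<forall>n\<ge>N. exp (- low_const \<rho> * E) * exp (a * (\<Sum>j=m..k-1. x j - lx z)) \<le> cmod (B k n z)" by blast
  qed
qed

lemma P_upper_right:
  assumes "z \<noteq> 0" "k \<le> m" "m = k \<or> x m \<le> lx z" "lx z \<le> x (m + 1)" "x (k - 1) \<le> lx z"
  shows "cmod (P k z) \<le> exp (2 * E) * exp (a * (\<Sum>j=k+1..m. lx z - x j))"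
proof -
  have "cmod (P k z) \<le> (exp E * exp (a * (\<Sum>j=k+1..m. lx z - x j))) * (exp E * exp (a * (\<Sum>j=k..k-1. x j - lx z)))"
    unfolding P_def norm_mult using assms by (intro mult_mono PA_upper PB_upper) auto
  then show ?thesis by (simp add: exp_add[symmetric] add_ac)
qed

lemma P_upper_left:
  assumes "z \<noteq> 0" "m \<le> k" "m = k \<or> lx z \<le> x m" "x (m - 1) \<le> lx z" "lx z \<le> x (k + 1)"
  shows "cmod (P k z) \<le> exp (2 * E) * exp (a * (\<Sum>j=m..k-1. x j - lx z))"
proof -
  have "cmod (P k z) \<le> (exp E * exp (a * (\<Sum>j=k+1..k. lx z - x j))) * (exp E * exp (a * (\<Sum>j=m..k-1. x j - lx z)))"
    unfolding P_def norm_mult using assms by (intro mult_mono PA_upper PB_upper) auto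
  then show ?thesis by (simp add: exp_add[symmetric] add_ac)
qed

lemma P_lower_right:
  assumes g: "good k \<rho> z" and m: "k \<le> m"
  shows "exp (- 2 * low_const \<rho> * E) * exp (a * (\<Sum>j=k+1..m. lx z - x j)) \<le> cmod (P k z)"
proof -
  have "(exp (- low_const \<rho> * E) * exp (a * (\<Sum>j=k+1..m. lx z - x j)))
      * (exp (- low_const \<rho> * E) * exp (a * (\<Sum>j=k..k-1. x j - lx z))) \<le> cmod (P k z)"
    unfolding P_def norm_mult by (intro mult_mono PA_lower[OF g m] PB_lower[OF g]) auto
  then show ?thesis by (simp add: exp_add[symmetric] algebra_simps)
qed

lemma P_lower_left:
  assumes g: "good k \<rho> z" and m: "m \<le> k"
  shows "exp (- 2 * low_const \<rho> * E) * exp (a * (\<Sum>j=m..k-1. x j - lx z)) \<le> cmod (P k z)"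
proof -
  have "(exp (- low_const \<rho> * E) * exp (a * (\<Sum>j=k+1..k. lx z - x j)))
      * (exp (- low_const \<rho> * E) * exp (a * (\<Sum>j=m..k-1. x j - lx z))) \<le> cmod (P k z)"
    unfolding P_def norm_mult by (intro mult_mono PA_lower[OF g] PB_lower[OF g m]) auto
  then show ?thesis by (simp add: exp_add[symmetric] algebra_simps)
qed

lemma P_nonzero_good: "good k \<rho> z \<Longrightarrow> P k z \<noteq> 0"
  using P_lower_right[of k \<rho> z k] by auto

text \<open>On a circle avoiding the zeros, \<open>P k\<close> has constant modulus up to a constant factor.\<close>

lemma P_circle_compare:
  assumes g: "good k \<rho> w" and z: "z \<noteq> 0" "lx z = lx w"
  shows "cmod (P k z) \<le> exp (2 * E + 2 * low_const \<rho> * E) * cmod (P k w)"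
proof -
  have w: "w \<noteq> 0" using g by (simp add: good_def)
  \<comment> \<open>The models \<open>MA\<close> and \<open>MB\<close> take the same value at
    \<open>z\<close> and \<open>w\<close>, and there they bound the products from above and from
    below.\<close>
  have nz: "cmod z = cmod w" using norm_eq_lx z w by metis
  define L where "L = low_const \<rho> * E"
  have 1: "cmod (A k N z) \<le> exp (E + L) * cmod (A k N w)" for N
  proof -
    have "cmod (A k N z) \<le> exp E * MA k N w" using A_le[OF z(1), of k N] by (simp add: MA_def norm_divide nz)
    also have "MA k N w = exp L * (exp (- L) * MA k N w)" by (simp add: mult.assoc[symmetric] exp_add[symmetric])
    also have "exp (- L) * MA k N w \<le> cmod (A k N w)" using A_ge[OF g, of N] by (simp add: L_def)
    finally show ?thesis by (simp add: exp_add mult.assoc)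
  qed
  have 2: "cmod (B k N z) \<le> exp (E + L) * cmod (B k N w)" for N
  proof -
    have "cmod (B k N z) \<le> exp E * MB k N w" using B_le[OF z(1), of k N] by (simp add: MB_def norm_divide nz)
    also have "MB k N w = exp L * (exp (- L) * MB k N w)" by (simp add: mult.assoc[symmetric] exp_add[symmetric])
    also have "exp (- L) * MB k N w \<le> cmod (B k N w)" using B_ge[OF g, of N] by (simp add: L_def)
    finally show ?thesis by (simp add: exp_add mult.assoc)
  qed
  have 3: "cmod (PA k z) \<le> exp (E + L) * cmod (PA k w)"
    by (rule LIMSEQ_le[OF tendsto_norm[OF lim_A] tendsto_mult_left[OF tendsto_norm[OF lim_A]]]) (use 1 in blast)
  have 4: "cmod (PB k z) \<le> exp (E + L) * cmod (PB k w)"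
    by (rule LIMSEQ_le[OF tendsto_norm[OF lim_B[OF z(1)]] tendsto_mult_left[OF tendsto_norm[OF lim_B[OF w]]]]) (use 2 in blast)
  have "cmod (P k z) \<le> (exp (E + L) * cmod (PA k w)) * (exp (E + L) * cmod (PB k w))"
    unfolding P_def norm_mult using 3 4 by (intro mult_mono) auto
  also have "\<dots> = (exp (E + L) * exp (E + L)) * cmod (P k w)"
    unfolding P_def norm_mult by (simp only: mult_ac)
  also have "exp (E + L) * exp (E + L) = exp (2 * E + 2 * low_const \<rho> * E)"
    unfolding exp_add[symmetric] L_def by (simp add: algebra_simps)
  finally show ?thesis .
qed

lemma good_self: "good k \<kappa> (l k)"
  unfolding good_def using l0 \<kappa> sep[of k] by auto

text \<open>The unit interval splits into \<open>K + 1\<close> intervals of length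
  \<open>2 * \<eta>\<close>, more than there are zeros in a unit window. \<open>\<rho>\<close> is
  the relative distance that a gap of \<open>\<eta>\<close> in \<open>lx\<close> guarantees.\<close>

definition \<eta> :: real where "\<eta> = 1 / (2 * (real K + 1))"

definition \<rho> :: real where "\<rho> = 1 - exp (- a * \<eta>)"

lemma eta_pos: "\<eta> > 0" by (simp add: \<eta>_def)

lemma rho_pos: "\<rho> > 0" using a_pos eta_pos by (simp add: \<rho>_def)

lemma norm_diff_ge_of_lx:
  assumes z: "z \<noteq> 0" and e: "e \<le> \<bar>lx z - x j\<bar>" "e > 0"
  shows "(1 - exp (- a * e)) * max (cmod z) (cmod (l j)) \<le> cmod (z - l j)"
proof (cases "x j \<le> lx z")
  case True
  have "cmod (l j) = cmod (l j / z) * cmod z" using z by (simp add: norm_divide)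
  also have "cmod (l j / z) \<le> exp (- a * e)"
    unfolding norm_quot'[OF z] using mult_left_mono[of "x j - lx z" "- e" a] True e a_pos by simp
  finally have "cmod (l j) \<le> exp (- a * e) * cmod z" by (simp add: mult_right_mono)
  moreover have "cmod (l j) \<le> cmod z" using True z l0[of j] by (simp add: norm_le_iff_lx x_def)
  ultimately show ?thesis using norm_triangle_ineq2[of z "l j"] by (simp add: algebra_simps)
next
  case False
  have "cmod z = cmod (z / l j) * cmod (l j)" using l0[of j] by (simp add: norm_divide)
  also have "cmod (z / l j) \<le> exp (- a * e)"
    unfolding norm_quot[OF z] using mult_left_mono[of "lx z - x j" "- e" a] False e a_pos by simp
  finally have "cmod z \<le> exp (- a * e) * cmod (l j)" by (simp add: mult_right_mono)
  moreover have "cmod z \<le> cmod (l j)" using False z l0[of j] by (simp add: norm_le_iff_lx x_def)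
  ultimately show ?thesis using norm_triangle_ineq2[of "l j" z] by (simp add: algebra_simps norm_minus_commute)
qed

lemma good_gap:
  assumes "z \<noteq> 0" "\<And>j. \<eta> \<le> \<bar>lx z - x j\<bar>"
  shows "good k \<rho> z" and "\<rho> * max (cmod z) (cmod (l j)) \<le> cmod (z - l j)"
  using assms rho_pos norm_diff_ge_of_lx[OF assms(1) assms(2) eta_pos] by (auto simp: good_def \<rho>_def)

lemma exists_gap: "\<exists>y. t \<le> y \<and> y \<le> t + 1 \<and> (\<forall>j. \<eta> \<le> \<bar>y - x j\<bar>)"
proof (rule ccontr)
  assume "\<not> ?thesis"
  then have no: "\<exists>j. \<bar>y - x j\<bar> < \<eta>" if "t \<le> y" "y \<le> t + 1" for y
    using that by (meson not_le)
  \<comment> \<open>Midpoints of \<open>K + 1\<close> adjacent intervals; were each of them blocked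
    by a zero, these zeros would be distinct.\<close>
  define y where "y = (\<lambda>i::nat. t + (2 * real i + 1) * \<eta>)"
  have \<eta>1: "2 * (real K + 1) * \<eta> = 1" by (simp add: \<eta>_def)
  have y: "t + \<eta> \<le> y i" "y i \<le> t + 1 - \<eta>" if "i \<le> K" for i
  proof -
    show "t + \<eta> \<le> y i" using eta_pos by (simp add: y_def)
    have "(2 * real i + 1) * \<eta> \<le> (2 * real K + 1) * \<eta>" using that eta_pos by (intro mult_right_mono) auto
    also have "\<dots> = 1 - \<eta>" using \<eta>1 by (simp add: algebra_simps)
    finally show "y i \<le> t + 1 - \<eta>" by (simp add: y_def)
  qed
  have "\<exists>j. \<bar>y i - x j\<bar> < \<eta>" if "i \<le> K" for i using y[OF that] eta_pos by (intro no) auto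
  then obtain f where f: "\<And>i. i \<le> K \<Longrightarrow> \<bar>y i - x (f i)\<bar> < \<eta>" by metis
  have "inj_on f {..K}"
  proof (rule inj_onI)
    fix i i' assume i: "i \<in> {..K}" "i' \<in> {..K}" "f i = f i'"
    then have "\<bar>y i - y i'\<bar> < 2 * \<eta>" using f[of i] f[of i'] by auto
    moreover have "\<bar>y i - y i'\<bar> = 2 * \<eta> * \<bar>real i - real i'\<bar>"
    proof -
      have "y i - y i' = 2 * \<eta> * (real i - real i')" unfolding y_def by (simp add: algebra_simps)
      then show ?thesis using eta_pos by (simp add: abs_mult)
    qed
    ultimately have "2 * \<eta> * \<bar>real i - real i'\<bar> < 2 * \<eta> * 1" by simp
    then have "\<bar>real i - real i'\<bar> < 1" using eta_pos by (subst (asm) mult_less_cancel_left_pos) auto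
    then show "i = i'" by linarith
  qed
  moreover have "f ` {..K} \<subseteq> {j\<in>UNIV. t \<le> x j \<and> x j \<le> t + 1}"
  proof
    fix j assume "j \<in> f ` {..K}"
    then obtain i where i: "i \<le> K" "j = f i" by auto
    show "j \<in> {j\<in>UNIV. t \<le> x j \<and> x j \<le> t + 1}"
      using f[OF i(1)] y[OF i(1)] i(2) by auto
  qed
  ultimately have "card {..K} \<le> card {j\<in>UNIV. t \<le> x j \<and> x j \<le> t + 1}"
    using window_boundedD(1)[OF win, of t] unfolding x_def by (intro card_inj_on_le) auto
  then show False using window_boundedD(2)[OF win, of t] unfolding x_def by simp
qed

text \<open>Zeros at distance more than 1 in \<open>lx\<close> are harmless, and only finitely many
  are closer. So every point off the zeros is good for some \<open>r\<close>, which rules out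
  further zeros of \<open>G 0\<close>.\<close>

lemma exists_good_outside:
  assumes z: "z \<noteq> 0" "z \<notin> range l"
  shows "\<exists>r. good k r z"
proof -
  define F where "F = {j. \<bar>x j - lx z\<bar> \<le> 1}"
  have F: "finite F" using window_bounded_near(1)[OF win, of "lx z" 1] by (simp add: F_def x_def)
  define h where "h = (\<lambda>j. cmod (z - l j) / max (cmod z) (cmod (l j)))"
  define r where "r = Min (insert (1 - exp (- a * 1)) (h ` F))"
  have mx: "max (cmod z) (cmod (l j)) > 0" for j using z by (simp add: less_max_iff_disj)
  have hp: "h j > 0" for j unfolding h_def using z mx[of j] by (intro divide_pos_pos) auto
  have r: "r > 0" unfolding r_def using F hp a_pos by (subst Min_gr_iff) auto
  have "r * max (cmod z) (cmod (l j)) \<le> cmod (z - l j)" for j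
  proof (cases "j \<in> F")
    case True
    then have "r \<le> h j" unfolding r_def using F by (intro Min_le) auto
    then show ?thesis using mx[of j] by (simp add: h_def pos_le_divide_eq)
  next
    case False
    then have 1: "(1 - exp (- a * 1)) * max (cmod z) (cmod (l j)) \<le> cmod (z - l j)"
      by (intro norm_diff_ge_of_lx z) (auto simp: F_def abs_minus_commute)
    have "r \<le> 1 - exp (- a * 1)" unfolding r_def using F by (intro Min_le) auto
    then have "r * max (cmod z) (cmod (l j)) \<le> (1 - exp (- a * 1)) * max (cmod z) (cmod (l j))"
      using mx[of j] by (intro mult_right_mono) auto
    with 1 show ?thesis by linarith
  qed
  then show ?thesis using z r by (auto simp: good_def)
qed

text \<open>Up to a constant factor \<open>G n\<close> does not depend on \<open>n\<close> (\<open>G_eq_mult\<close>).\<close>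

definition G :: "int \<Rightarrow> complex \<Rightarrow> complex" where "G n z = z powi n * ((1 - l n / z) * P n z)"

lemma holomorphic_G: "G n holomorphic_on -{0}"
  unfolding G_def[abs_def] by (intro holomorphic_intros holomorphic_P) auto

lemma G_Suc:
  assumes z: "z \<noteq> 0"
  shows "G (n + 1) z = - l (n + 1) * G n z"
proof -
  have "G (n + 1) z = z powi n * (z * (1 - l (n + 1) / z) * P (n + 1) z)"
    using z by (simp add: G_def power_int_add mult_ac)
  also have "z * (1 - l (n + 1) / z) = - l (n + 1) * (1 - z / l (n + 1))"
    using z l0[of "n + 1"] by (simp add: field_simps)
  also have "z powi n * (- l (n + 1) * (1 - z / l (n + 1)) * P (n + 1) z)
      = z powi n * (- l (n + 1) * (P n z * (1 - l n / z)))"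
    using P_Suc[OF z, of n] by (simp add: mult_ac)
  finally show ?thesis by (simp add: G_def mult_ac)
qed

lemma G_eq_mult: "\<exists>d. d \<noteq> 0 \<and> (\<forall>z. z \<noteq> 0 \<longrightarrow> G 0 z = d * G n z)"
proof (induction n rule: int_induct[where k = 0])
  case base then show ?case by (intro exI[of _ 1]) auto
next
  case (step1 i)
  then obtain d where d: "d \<noteq> 0" "\<And>z. z \<noteq> 0 \<Longrightarrow> G 0 z = d * G i z" by blast
  then show ?case using l0[of "i + 1"] by (intro exI[of _ "- d / l (i + 1)"]) (auto simp: G_Suc)
next
  case (step2 i)
  then obtain d where d: "d \<noteq> 0" "\<And>z. z \<noteq> 0 \<Longrightarrow> G 0 z = d * G i z" by blast
  then show ?case using l0[of i] G_Suc[of _ "i - 1"] by (intro exI[of _ "- d * l i"]) auto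
qed

lemma G_zero_iff: "z \<noteq> 0 \<Longrightarrow> G 0 z = 0 \<longleftrightarrow> z \<in> range l"
proof
  assume z: "z \<noteq> 0" "G 0 z = 0"
  show "z \<in> range l"
  proof (rule ccontr)
    assume n: "z \<notin> range l"
    then obtain r where "good 0 r z" using exists_good_outside z by blast
    then have "P 0 z \<noteq> 0" by (rule P_nonzero_good)
    then show False using z n by (auto simp: G_def)
  qed
next
  assume z: "z \<noteq> 0" "z \<in> range l"
  then obtain j where j: "z = l j" by blast
  show "G 0 z = 0" using P_zero[of j 0] z j by (cases "j = 0") (auto simp: G_def)
qed

text \<open>Renumbering \<open>G\<close> to start at \<open>m\<close> displays
  \<open>z - l m\<close> as a factor; the cofactor at \<open>l m\<close> is a nonzero multiple of
  \<open>P m (l m)\<close>, which does not vanish.\<close>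

lemma deriv_G_nonzero: "deriv (G 0) (l m) \<noteq> 0"
proof -
  obtain d where d: "d \<noteq> 0" "\<And>z. z \<noteq> 0 \<Longrightarrow> G 0 z = d * G m z" using G_eq_mult by blast
  define H where "H = (\<lambda>z. d * z powi (m - 1) * P m z)"
  have "H holomorphic_on -{0}" unfolding H_def by (intro holomorphic_intros holomorphic_P) auto
  then have "H field_differentiable at (l m)"
    using l0[of m] by (intro holomorphic_on_imp_differentiable_at[of H "-{0}"]) auto
  then have H: "(H has_field_derivative deriv H (l m)) (at (l m))"
    by (rule DERIV_deriv_iff_field_differentiable[THEN iffD2])
  have d1: "((\<lambda>z. H z * (z - l m)) has_field_derivative H (l m)) (at (l m))"
    by (rule derivative_eq_intros H refl | simp)+
  have ev: "eventually (\<lambda>z. H z * (z - l m) = G 0 z) (nhds (l m))"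
  proof (rule eventually_nhds_in_open[of "-{0}", THEN eventually_mono])
    fix z :: complex assume "z \<in> -{0}"
    then have z: "z \<noteq> 0" by simp
    have "z powi m = z powi (m - 1) * z" using z power_int_add[of z "m - 1" 1] by simp
    then show "H z * (z - l m) = G 0 z" using z d(2)[OF z] by (simp add: H_def G_def field_simps)
  qed (use l0 in auto)
  have "(G 0 has_field_derivative H (l m)) (at (l m))"
    using DERIV_cong_ev[OF refl ev refl, of "H (l m)"] d1 by simp
  then have "deriv (G 0) (l m) = H (l m)" by (rule DERIV_imp_deriv)
  moreover have "H (l m) \<noteq> 0" using d l0[of m] P_nonzero_good[OF good_self[of m]] by (simp add: H_def)
  ultimately show ?thesis by simp
qed

lemma divide_by_G:
  assumes f: "f holomorphic_on -{0}" and zero: "\<And>m. f (l m) = 0"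
  obtains h where "h holomorphic_on -{0}" "\<And>z. z \<noteq> 0 \<Longrightarrow> f z = G 0 z * h z"
proof (rule holomorphic_divide_simple_zeros[OF f holomorphic_G[of 0]])
  show "f z = 0 \<and> deriv (G 0) z \<noteq> 0" if "z \<in> -{0}" "G 0 z = 0" for z
    using that G_zero_iff[of z] zero deriv_G_nonzero by auto
qed (use that in auto)

end

section \<open>Functions vanishing at all nodes but one\<close>

locale interp = fock \<alpha> p + zero_seq \<alpha> "two_over p" l K \<kappa> for \<alpha> p l K \<kappa>
begin

text \<open>In the coordinate \<open>lx\<close> the polar form of the statement reads
  \<open>lx (l k) = k + \<delta> k\<close>.\<close>

definition \<delta> :: "int \<Rightarrow> real" where "\<delta> k = x k - of_int k"

text \<open>With \<open>t = lx z\<close>, the terms on the left are the logarithms, in units of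
  \<open>a\<close>, of the monomial relative to \<open>l k\<close>, of the model product, and of the
  weight relative to \<open>l k\<close>. The quadratic parts cancel for every \<open>t\<close>; the
  remainder \<open>(t - m)^2 / 2\<close> is harmless once \<open>m\<close> is close to
  \<open>t\<close>.\<close>

lemma exponent_right:
  assumes "k \<le> m"
  shows "of_int k * (t - x k) + (\<Sum>j=k+1..m. t - x j) - (t\<^sup>2 - (x k)\<^sup>2) / 2
    = - (of_int (m - k) / 2) - (\<Sum>j=k+1..m. \<delta> j) - (t - of_int m)\<^sup>2 / 2 + (\<delta> k)\<^sup>2 / 2"
  using assms
proof (induction m rule: int_ge_induct)
  case base
  then show ?case by (simp add: \<delta>_def power2_eq_square field_simps)
next
  case (step i)
  have s: "{k+1..i+1} = insert (i + 1) {k+1..i}" using step.hyps by auto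
  have 1: "(\<Sum>j=k+1..i+1. t - x j) = (t - x (i + 1)) + (\<Sum>j=k+1..i. t - x j)"
    and 2: "(\<Sum>j=k+1..i+1. \<delta> j) = \<delta> (i + 1) + (\<Sum>j=k+1..i. \<delta> j)"
    unfolding s by (subst sum.insert; simp)+
  have 3: "(t - of_int (i + 1))\<^sup>2 = (t - of_int i)\<^sup>2 - 2 * (t - of_int i) + 1"
    by (simp add: power2_eq_square algebra_simps)
  have 4: "\<delta> (i + 1) = x (i + 1) - of_int i - 1" by (simp add: \<delta>_def)
  show ?case unfolding 1 2 3 using step.IH unfolding 4 by (simp add: field_simps)
qed

lemma exponent_left:
  assumes "m \<le> k"
  shows "of_int k * (t - x k) + (\<Sum>j=m..k-1. x j - t) - (t\<^sup>2 - (x k)\<^sup>2) / 2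
    = - (of_int (k - m) / 2) + (\<Sum>j=m..k-1. \<delta> j) - (t - of_int m)\<^sup>2 / 2 + (\<delta> k)\<^sup>2 / 2"
  using assms
proof (induction m rule: int_le_induct)
  case base
  then show ?case by (simp add: \<delta>_def power2_eq_square field_simps)
next
  case (step i)
  have s: "{i-1..k-1} = insert (i - 1) {i..k-1}" using step.hyps by auto
  have 1: "(\<Sum>j=i-1..k-1. x j - t) = (x (i - 1) - t) + (\<Sum>j=i..k-1. x j - t)"
    and 2: "(\<Sum>j=i-1..k-1. \<delta> j) = \<delta> (i - 1) + (\<Sum>j=i..k-1. \<delta> j)"
    unfolding s by (subst sum.insert; simp)+
  have 3: "(t - of_int (i - 1))\<^sup>2 = (t - of_int i)\<^sup>2 + 2 * (t - of_int i) + 1"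
    by (simp add: power2_eq_square algebra_simps)
  have 4: "\<delta> (i - 1) = x (i - 1) - of_int i + 1" by (simp add: \<delta>_def)
  show ?case unfolding 1 2 3 using step.IH unfolding 4 by (simp add: field_simps)
qed

definition g :: "int \<Rightarrow> complex \<Rightarrow> complex" where
  "g k z = (if z = 0 then 0 else (z / l k) powi k * P k z / P k (l k))"

lemma holomorphic_g: "g k holomorphic_on -{0}"
proof (rule holomorphic_transform)
  show "(\<lambda>z. (z / l k) powi k * P k z / P k (l k)) holomorphic_on -{0}"
    using l0[of k] P_nonzero_good[OF good_self[of k]]
    by (intro holomorphic_intros holomorphic_P) auto
qed (auto simp: g_def)

lemma g_zero [simp]: "g k 0 = 0" by (simp add: g_def)

lemma g_self: "g k (l k) = 1"
  using l0[of k] P_nonzero_good[OF good_self[of k]] by (simp add: g_def)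

lemma g_other: "j \<noteq> k \<Longrightarrow> g k (l j) = 0"
  using P_zero by (simp add: g_def)

lemma wt_quot: "z \<noteq> 0 \<Longrightarrow> wt z = wt (l k) * exp (a * (- ((lx z)\<^sup>2 - (x k)\<^sup>2) / 2))"
  using alpha by (simp add: wt_eq_lx l0 a_def x_def exp_add[symmetric] field_simps)

lemma V_g_eq:
  assumes z: "z \<noteq> 0"
  shows "V (g k) z = wt (l k) / cmod (P k (l k)) *
     (exp (a * (of_int k * (lx z - x k) - ((lx z)\<^sup>2 - (x k)\<^sup>2) / 2)) * cmod (P k z))"
proof -
  have "cmod ((z / l k) powi k) = exp (a * (of_int k * (lx z - x k)))"
    by (simp add: norm_power_int norm_quot[OF z] exp_power_int mult_ac)
  then have "V (g k) z = exp (a * (of_int k * (lx z - x k))) * cmod (P k z) / cmod (P k (l k))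
      * (wt (l k) * exp (a * (- ((lx z)\<^sup>2 - (x k)\<^sup>2) / 2)))"
    using z by (simp add: V_def g_def norm_mult norm_divide wt_quot[OF z, of k])
  also have "\<dots> = wt (l k) / cmod (P k (l k)) *
     ((exp (a * (of_int k * (lx z - x k))) * exp (a * (- ((lx z)\<^sup>2 - (x k)\<^sup>2) / 2))) * cmod (P k z))"
    by simp
  also have "exp (a * (of_int k * (lx z - x k))) * exp (a * (- ((lx z)\<^sup>2 - (x k)\<^sup>2) / 2))
     = exp (a * (of_int k * (lx z - x k) - ((lx z)\<^sup>2 - (x k)\<^sup>2) / 2))"
    unfolding exp_add[symmetric] distrib_left[symmetric] by (simp add: minus_divide_left)
  finally show ?thesis .
qed

lemma P_self_bounds: "exp (- 2 * low_const \<kappa> * E) \<le> cmod (P k (l k))" "cmod (P k (l k)) \<le> exp (2 * E)"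
  using P_lower_right[OF good_self[of k] order_refl]
    P_upper_right[OF l0[of k] order_refl, where k = k] x_mono[of "k - 1" k] x_mono[of k "k + 1"]
  by (auto simp: x_def)

definition upper_const :: real where "upper_const = exp (2 * E + 2 * low_const \<kappa> * E)"

lemma V_g_upper:
  assumes z: "z \<noteq> 0" and P: "cmod (P k z) \<le> exp (2 * E) * exp (a * s)"
    and e: "of_int k * (lx z - x k) + s - ((lx z)\<^sup>2 - (x k)\<^sup>2) / 2 \<le> e"
  shows "V (g k) z \<le> wt (l k) * (upper_const * exp (a * e))"
proof -
  define u where "u = of_int k * (lx z - x k) - ((lx z)\<^sup>2 - (x k)\<^sup>2) / 2"
  have w: "wt (l k) > 0" by (rule wt_pos[OF l0])
  have p: "cmod (P k (l k)) > 0" using P_nonzero_good[OF good_self[of k]] by simp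
  have "inverse (cmod (P k (l k))) \<le> inverse (exp (- 2 * low_const \<kappa> * E))"
    by (rule le_imp_inverse_le[OF P_self_bounds(1)]) simp
  then have inv: "1 / cmod (P k (l k)) \<le> exp (2 * low_const \<kappa> * E)"
    by (simp add: exp_minus divide_inverse)
  have "V (g k) z = wt (l k) * (1 / cmod (P k (l k)) * (exp (a * u) * cmod (P k z)))"
    unfolding V_g_eq[OF z] u_def by simp
  also have "\<dots> \<le> wt (l k) * (exp (2 * low_const \<kappa> * E) * (exp (a * u) * (exp (2 * E) * exp (a * s))))"
    using w P inv by (intro mult_left_mono mult_mono) auto
  also have "exp (2 * low_const \<kappa> * E) * (exp (a * u) * (exp (2 * E) * exp (a * s))) = upper_const * exp (a * (u + s))"
    by (simp add: upper_const_def exp_add[symmetric] algebra_simps)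
  also have "wt (l k) * (upper_const * exp (a * (u + s))) \<le> wt (l k) * (upper_const * exp (a * e))"
    using w e a_pos by (intro mult_left_mono) (auto simp: upper_const_def u_def)
  finally show ?thesis .
qed

lemma V_g_lower:
  assumes z: "z \<noteq> 0" and P: "exp (- 2 * low_const r * E) * exp (a * s) \<le> cmod (P k z)"
    and e: "e \<le> of_int k * (lx z - x k) + s - ((lx z)\<^sup>2 - (x k)\<^sup>2) / 2"
  shows "wt (l k) * (exp (- 2 * low_const r * E - 2 * E) * exp (a * e)) \<le> V (g k) z"
proof -
  define u where "u = of_int k * (lx z - x k) - ((lx z)\<^sup>2 - (x k)\<^sup>2) / 2"
  have w: "wt (l k) > 0" by (rule wt_pos[OF l0])
  have p: "cmod (P k (l k)) > 0" using P_nonzero_good[OF good_self[of k]] by simp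
  have "inverse (exp (2 * E)) \<le> inverse (cmod (P k (l k)))"
    by (rule le_imp_inverse_le[OF P_self_bounds(2) p])
  then have inv: "exp (- 2 * E) \<le> 1 / cmod (P k (l k))" by (simp add: exp_minus divide_inverse)
  have "wt (l k) * (exp (- 2 * low_const r * E - 2 * E) * exp (a * e))
     \<le> wt (l k) * (exp (- 2 * low_const r * E - 2 * E) * exp (a * (u + s)))"
    using w e a_pos by (intro mult_left_mono) (auto simp: u_def)
  also have "exp (- 2 * low_const r * E - 2 * E) * exp (a * (u + s))
     = exp (- 2 * E) * (exp (a * u) * (exp (- 2 * low_const r * E) * exp (a * s)))"
    by (simp add: exp_add[symmetric] algebra_simps)
  also have "wt (l k) * \<dots> \<le> wt (l k) * (1 / cmod (P k (l k)) * (exp (a * u) * cmod (P k z)))"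
    using w P inv by (intro mult_left_mono mult_mono) auto
  also have "\<dots> = V (g k) z" unfolding V_g_eq[OF z] u_def by simp
  finally show ?thesis .
qed

lemma V_g_lower_right:
  assumes g: "good k r z" and m: "k \<le> m"
  shows "wt (l k) * (exp (- 2 * low_const r * E - 2 * E) *
     exp (a * (- (of_int (m - k) / 2) - (\<Sum>j=k+1..m. \<delta> j) - (lx z - of_int m)\<^sup>2 / 2))) \<le> V (g k) z"
proof (rule V_g_lower[OF _ P_lower_right[OF g m]])
  show "z \<noteq> 0" using g by (simp add: good_def)
  show "- (of_int (m - k) / 2) - (\<Sum>j=k+1..m. \<delta> j) - (lx z - of_int m)\<^sup>2 / 2
    \<le> of_int k * (lx z - x k) + (\<Sum>j=k+1..m. lx z - x j) - ((lx z)\<^sup>2 - (x k)\<^sup>2) / 2"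
    unfolding exponent_right[OF m] by simp
qed

lemma V_g_lower_left:
  assumes g: "good k r z" and m: "m \<le> k"
  shows "wt (l k) * (exp (- 2 * low_const r * E - 2 * E) *
     exp (a * (- (of_int (k - m) / 2) + (\<Sum>j=m..k-1. \<delta> j) - (lx z - of_int m)\<^sup>2 / 2))) \<le> V (g k) z"
proof (rule V_g_lower[OF _ P_lower_left[OF g m]])
  show "z \<noteq> 0" using g by (simp add: good_def)
  show "- (of_int (k - m) / 2) + (\<Sum>j=m..k-1. \<delta> j) - (lx z - of_int m)\<^sup>2 / 2
    \<le> of_int k * (lx z - x k) + (\<Sum>j=m..k-1. x j - lx z) - ((lx z)\<^sup>2 - (x k)\<^sup>2) / 2"
    unfolding exponent_left[OF m] by simp
qed

lemma inj_l: "inj l"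
proof (rule injI, rule ccontr)
  fix j k assume "l j = l k" "j \<noteq> k"
  then have "\<kappa> * cmod (l k) \<le> 0" using sep[of j k] by simp
  then show False using \<kappa> l0[of k] by (simp add: mult_le_0_iff)
qed

end

text \<open>\<open>avg\<close> is the condition on averages in additive form; \<open>C0\<close>
  absorbs incomplete blocks.\<close>

locale interp_suff = interp +
  fixes D C0 \<epsilon> :: real
  assumes delta_bd: "\<bar>\<delta> k\<bar> \<le> D"
    and eps: "\<epsilon> > 0"
    and avg: "n \<le> m \<Longrightarrow> \<bar>\<Sum>j=n+1..m. \<delta> j\<bar> \<le> (1/2 - \<epsilon>) * of_int (m - n) + C0"
begin

lemma exists_between:
  obtains m where "x m \<le> t" "t < x (m + 1)"
proof -
  define j0 where "j0 = \<lfloor>t - D\<rfloor>"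
  have d: "x j \<le> of_int j + D" "of_int j - D \<le> x j" for j
    using delta_bd[of j] by (auto simp: \<delta>_def abs_le_iff)
  have j0: "x j0 \<le> t" using d(1)[of j0] unfolding j0_def by linarith
  define Q where "Q = (\<lambda>n::nat. t < x (j0 + 1 + int n))"
  have "Q (nat (\<lceil>t + D\<rceil> + 1 - j0))"
    using d(2)[of "j0 + 1 + int (nat (\<lceil>t + D\<rceil> + 1 - j0))"] unfolding Q_def by linarith
  then have "Q (LEAST n. Q n)" by (rule LeastI)
  moreover define n where "n = (LEAST n. Q n)"
  ultimately have L: "Q n" by simp
  have "x (j0 + int n) \<le> t"
  proof (cases n)
    case 0 then show ?thesis using j0 by simp
  next
    case (Suc n')
    then have "\<not> Q n'" using not_less_Least[of n' Q] by (simp add: n_def)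
    then show ?thesis using Suc by (simp add: Q_def add_ac)
  qed
  moreover have "t < x (j0 + int n + 1)" using L by (simp add: Q_def add_ac)
  ultimately show ?thesis by (rule that)
qed

text \<open>\<open>D^2 / 2\<close> bounds the term \<open>(\<delta> k)^2 / 2\<close> of the
  exponent, and \<open>\<epsilon> * (D + 1)\<close> pays for replacing the cut by
  \<open>lx z\<close>.\<close>

definition decay_const :: real where "decay_const = upper_const * exp (a * (C0 + D\<^sup>2 / 2 + \<bar>1/2 - \<epsilon>\<bar> + \<epsilon> * (D + 1)))"

lemma D_nonneg: "D \<ge> 0" using delta_bd[of 0] by linarith

text \<open>The rate is \<open>1/2 - (1/2 - \<epsilon>)\<close>: the linear decay left by the
  cancellation, minus the most that the sums of \<open>\<delta>\<close> can take back. The cut is a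
  zero next to \<open>z\<close>; as \<open>\<delta>\<close> is bounded, its index lies within
  \<open>D + 1\<close> of \<open>lx z\<close>.\<close>

lemma V_g_decay:
  assumes z: "z \<noteq> 0"
  shows "V (g k) z \<le> wt (l k) * (decay_const * exp (- (a * \<epsilon>) * \<bar>of_int k - lx z\<bar>))"
proof -
  obtain m where m: "x m \<le> lx z" "lx z < x (m + 1)" by (rule exists_between)
  have dk: "(\<delta> k)\<^sup>2 \<le> D\<^sup>2" using delta_bd[of k] abs_le_square_iff[of "\<delta> k" D] D_nonneg by simp
  have fin: "wt (l k) * (upper_const * exp (a * (- \<epsilon> * \<bar>of_int (k - i)\<bar> + C0 + D\<^sup>2 / 2)))
      \<le> wt (l k) * (decay_const * exp (- (a * \<epsilon>) * \<bar>of_int k - lx z\<bar>))"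
    if i: "\<bar>lx z - of_int i\<bar> \<le> D + 1" for i
  proof -
    have "\<epsilon> * \<bar>of_int k - lx z\<bar> \<le> \<epsilon> * (\<bar>of_int (k - i)\<bar> + (D + 1))"
      using i eps by (intro mult_left_mono) auto
    then have "- \<epsilon> * \<bar>of_int (k - i)\<bar> + C0 + D\<^sup>2 / 2 \<le> C0 + D\<^sup>2 / 2 + \<bar>1/2 - \<epsilon>\<bar> + \<epsilon> * (D + 1) - \<epsilon> * \<bar>of_int k - lx z\<bar>"
      by (simp add: distrib_left)
    then have "a * (- \<epsilon> * \<bar>of_int (k - i)\<bar> + C0 + D\<^sup>2 / 2) \<le> a * (C0 + D\<^sup>2 / 2 + \<bar>1/2 - \<epsilon>\<bar> + \<epsilon> * (D + 1) - \<epsilon> * \<bar>of_int k - lx z\<bar>)"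
      using a_pos by (intro mult_left_mono) auto
    also have "\<dots> = a * (C0 + D\<^sup>2 / 2 + \<bar>1/2 - \<epsilon>\<bar> + \<epsilon> * (D + 1)) + (- (a * \<epsilon>) * \<bar>of_int k - lx z\<bar>)"
      by (simp add: right_diff_distrib mult.assoc)
    finally have "exp (a * (- \<epsilon> * \<bar>of_int (k - i)\<bar> + C0 + D\<^sup>2 / 2))
        \<le> exp (a * (C0 + D\<^sup>2 / 2 + \<bar>1/2 - \<epsilon>\<bar> + \<epsilon> * (D + 1))) * exp (- (a * \<epsilon>) * \<bar>of_int k - lx z\<bar>)"
      unfolding exp_add[symmetric] by simp
    then show ?thesis unfolding decay_const_def using wt_pos[OF l0[of k]]
      by (simp add: mult.assoc upper_const_def)
  qed
  have dm: "\<bar>x j - of_int j\<bar> \<le> D" for j using delta_bd[of j] by (simp add: \<delta>_def)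
  show ?thesis
  proof (cases "k \<le> m")
    case True
    have near: "\<bar>lx z - of_int m\<bar> \<le> D + 1" using m dm[of m] dm[of "m + 1"] by auto
    have "V (g k) z \<le> wt (l k) * (upper_const * exp (a * (- \<epsilon> * \<bar>of_int (k - m)\<bar> + C0 + D\<^sup>2 / 2)))"
    proof (rule V_g_upper[OF z P_upper_right[OF z True]])
      show "x (k - 1) \<le> lx z" using x_mono[of "k - 1" m] True m by simp
      define N :: real where "N = of_int (m - k)"
      have ab: "\<bar>of_int (k - m)\<bar> = N" using True by (simp add: N_def)
      have h: "- (\<Sum>j=k+1..m. \<delta> j) \<le> N / 2 - \<epsilon> * N + C0"
        using avg[OF True, folded N_def] unfolding left_diff_distrib by linarith
      show "of_int k * (lx z - x k) + (\<Sum>j=k+1..m. lx z - x j) - ((lx z)\<^sup>2 - (x k)\<^sup>2) / 2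
         \<le> - \<epsilon> * \<bar>of_int (k - m)\<bar> + C0 + D\<^sup>2 / 2"
        unfolding exponent_right[OF True] ab N_def[symmetric]
        using h dk zero_le_power2[of "lx z - of_int m"] by linarith
    qed (use m in auto)
    then show ?thesis using fin[OF near] by linarith
  next
    case False
    \<comment> \<open>To the left of \<open>l k\<close> the cut has to be the first zero beyond
      \<open>z\<close>, hence \<open>m + 1\<close>.\<close>
    then have mk: "m + 1 \<le> k" by simp
    have near: "\<bar>lx z - of_int (m + 1)\<bar> \<le> D + 1" using m dm[of m] dm[of "m + 1"] by auto
    have "V (g k) z \<le> wt (l k) * (upper_const * exp (a * (- \<epsilon> * \<bar>of_int (k - (m + 1))\<bar> + C0 + D\<^sup>2 / 2)))"
    proof (rule V_g_upper[OF z P_upper_left[OF z mk]])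
      show "lx z \<le> x (k + 1)" using x_mono[of "m + 1" "k + 1"] mk m by simp
      define N :: real where "N = of_int (k - (m + 1))"
      have ab: "\<bar>N\<bar> = N" using mk by (simp add: N_def)
      have "of_int (k - 1 - m) = N" by (simp add: N_def)
      then have h: "(\<Sum>j=m+1..k-1. \<delta> j) \<le> N / 2 - \<epsilon> * N + C0"
        using avg[of m "k - 1"] mk unfolding left_diff_distrib by simp
      show "of_int k * (lx z - x k) + (\<Sum>j=m+1..k-1. x j - lx z) - ((lx z)\<^sup>2 - (x k)\<^sup>2) / 2
         \<le> - \<epsilon> * \<bar>of_int (k - (m + 1))\<bar> + C0 + D\<^sup>2 / 2"
        unfolding exponent_left[OF mk] N_def[symmetric] ab
        using h dk zero_le_power2[of "lx z - of_int (m + 1)"] by linarith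
    qed (use m in auto)
    then show ?thesis using fin[OF near] by linarith
  qed
qed

end

section \<open>Sufficiency\<close>

lemma (in log_weight) V_diff_le: "V (\<lambda>z. f z - h z) z \<le> V f z + V h z"
  unfolding V_def distrib_right[symmetric]
  by (intro mult_right_mono norm_triangle_ineq4) (simp add: wt_def)

lemma (in fock) fock_space_V_bounded:
  assumes f: "f \<in> fock_space \<alpha> p"
  obtains M where "M \<ge> 0" "\<And>z. z \<noteq> 0 \<Longrightarrow> V f z \<le> M"
proof -
  obtain C where C: "C > 0" "\<And>f w. f holomorphic_on -{0} \<Longrightarrow> w \<noteq> 0 \<Longrightarrow> ennreal (V f w) \<le> ennreal C * fock_norm \<alpha> p f"
    by (rule V_le_fock_norm) blast
  obtain B where B: "fock_norm \<alpha> p f = ennreal B" "B \<ge> 0"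
    using fock_spaceD(3)[OF f] by (cases "fock_norm \<alpha> p f") auto
  have "V f z \<le> C * B" if "z \<noteq> 0" for z
    using C(2)[OF fock_spaceD(1)[OF f] that] C(1) B by (simp add: ennreal_mult[symmetric])
  then show ?thesis using that[of "C * B"] C(1) B by simp
qed

context interp_suff
begin

lemma log_growth_contradiction:
  fixes B r :: real
  assumes "r > 0" "\<And>N::nat. N \<ge> N0 \<Longrightarrow> exp (r * real N) \<le> B"
  shows False
proof -
  obtain n :: nat where n: "B / r < real n" using reals_Archimedean2 by blast
  define N where "N = max n N0"
  have "B < r * real n" using n assms(1) by (simp add: field_simps)
  also have "\<dots> \<le> r * real N" using assms(1) by (simp add: N_def)
  also have "\<dots> < exp (r * real N)" using exp_ge_add_one_self[of "r * real N"] by linarith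
  also have "\<dots> \<le> B" by (rule assms(2)) (simp add: N_def)
  finally show False by simp
qed

text \<open>\<open>G 0\<close> is a constant multiple of \<open>(1 - l 0 / z) * g 0 z\<close>, so a
  lower bound for \<open>V (g 0)\<close> on a circle limits the quotient \<open>h\<close>.\<close>

lemma quotient_circle_bound:
  assumes F: "\<And>z. z \<noteq> 0 \<Longrightarrow> V F z \<le> M" and h: "\<And>z. z \<noteq> 0 \<Longrightarrow> F z = G 0 z * h z"
    and z: "z \<noteq> 0" and gap: "\<And>j. \<eta> \<le> \<bar>lx z - x j\<bar>" and e: "e > 0" "e \<le> V (g 0) z"
  shows "cmod (h z) * cmod (1 - l 0 / z) \<le> M / (e * cmod (P 0 (l 0)))"
proof -
  have p: "cmod (P 0 (l 0)) > 0" using P_nonzero_good[OF good_self[of 0]] by simp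
  have eq: "V F z = cmod (h z) * cmod (1 - l 0 / z) * (V (g 0) z * cmod (P 0 (l 0)))"
    using z p by (simp add: V_def h G_def g_def norm_mult norm_divide)
  have "cmod (h z) * cmod (1 - l 0 / z) * (e * cmod (P 0 (l 0))) \<le> V F z"
    unfolding eq using e p by (intro mult_left_mono mult_right_mono) auto
  also have "\<dots> \<le> M" by (rule F[OF z])
  finally show ?thesis using e p by (subst pos_le_divide_eq) auto
qed

text \<open>Rate \<open>1 - \<epsilon>\<close>: one half from the basic decay and up to
  \<open>1/2 - \<epsilon>\<close> from the sums of \<open>\<delta>\<close>. As \<open>|z|\<close> is
  proportional to \<open>exp (a * lx z)\<close>, this loses less than one power of
  \<open>|z|\<close>, which decides uniqueness.\<close>

lemma V_g0_lower:
  fixes N :: nat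
  assumes z: "z \<noteq> 0" and gap: "\<And>j. \<eta> \<le> \<bar>lx z - x j\<bar>"
    and n: "n = int N \<or> n = - int N" and near: "\<bar>lx z - of_int n\<bar> \<le> 1"
  shows "wt (l 0) * (exp (- 2 * low_const \<rho> * E - 2 * E) * exp (a * (- C0 - 1 / 2))) * exp (- (a * (1 - \<epsilon>)) * real N) \<le> V (g 0) z"
proof -
  have sq: "(lx z - of_int n)\<^sup>2 \<le> 1" using near by (simp add: abs_square_le_1)
  note gd = good_gap(1)[OF z gap, of 0]
  define A where "A = wt (l 0) * exp (- 2 * low_const \<rho> * E - 2 * E)"
  have A: "A \<ge> 0" using wt_pos[OF l0[of 0]] by (simp add: A_def)
  have main: "A * exp (a * (- C0 - 1/2 - (1 - \<epsilon>) * real N)) \<le> V (g 0) z"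
    using n
  proof
    assume n: "n = int N"
    have le: "0 \<le> n" using n by simp
    have "(\<Sum>j=0+1..n. \<delta> j) \<le> (1/2 - \<epsilon>) * real N + C0" using avg[OF le] n by simp
    then have "- C0 - 1/2 - (1 - \<epsilon>) * real N
        \<le> - (of_int (n - 0) / 2) - (\<Sum>j=0+1..n. \<delta> j) - (lx z - of_int n)\<^sup>2 / 2"
      using sq n unfolding left_diff_distrib by simp
    then have "a * (- C0 - 1/2 - (1 - \<epsilon>) * real N)
        \<le> a * (- (of_int (n - 0) / 2) - (\<Sum>j=0+1..n. \<delta> j) - (lx z - of_int n)\<^sup>2 / 2)"
      using a_pos by (intro mult_left_mono) auto
    then have "A * exp (a * (- C0 - 1/2 - (1 - \<epsilon>) * real N))
        \<le> A * exp (a * (- (of_int (n - 0) / 2) - (\<Sum>j=0+1..n. \<delta> j) - (lx z - of_int n)\<^sup>2 / 2))"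
      using A by (intro mult_left_mono) auto
    also have "\<dots> \<le> V (g 0) z" using V_g_lower_right[OF gd le] by (simp add: A_def mult.assoc)
    finally show ?thesis .
  next
    assume n: "n = - int N"
    have le: "n \<le> 0" using n by simp
    have "- (\<Sum>j=n..0-1. \<delta> j) \<le> (1/2 - \<epsilon>) * real N + C0" using avg[of "n - 1" "- 1"] n by simp
    then have "- C0 - 1/2 - (1 - \<epsilon>) * real N
        \<le> - (of_int (0 - n) / 2) + (\<Sum>j=n..0-1. \<delta> j) - (lx z - of_int n)\<^sup>2 / 2"
      using sq n unfolding left_diff_distrib by simp
    then have "a * (- C0 - 1/2 - (1 - \<epsilon>) * real N)
        \<le> a * (- (of_int (0 - n) / 2) + (\<Sum>j=n..0-1. \<delta> j) - (lx z - of_int n)\<^sup>2 / 2)"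
      using a_pos by (intro mult_left_mono) auto
    then have "A * exp (a * (- C0 - 1/2 - (1 - \<epsilon>) * real N))
        \<le> A * exp (a * (- (of_int (0 - n) / 2) + (\<Sum>j=n..0-1. \<delta> j) - (lx z - of_int n)\<^sup>2 / 2))"
      using A by (intro mult_left_mono) auto
    also have "\<dots> \<le> V (g 0) z" using V_g_lower_left[OF gd le] by (simp add: A_def mult.assoc)
    finally show ?thesis .
  qed
  have "exp (a * (- C0 - 1/2 - (1 - \<epsilon>) * real N)) = exp (a * (- C0 - 1 / 2)) * exp (- (a * (1 - \<epsilon>)) * real N)"
    unfolding exp_add[symmetric] by (simp add: algebra_simps)
  then show ?thesis using main by (simp add: A_def mult_ac)
qed

text \<open>On circles avoiding the zeros, the quotient by \<open>G 0\<close> is at most of order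
  \<open>|z| powr (1 - \<epsilon>)\<close> at infinity and \<open>|z| powr \<epsilon>\<close> at the
  origin. A nonzero quotient would reach a fixed monomial on each circle; degree at least 1 is
  excluded at infinity, degree at most 0 at the origin.\<close>

lemma uniqueness:
  assumes F: "F holomorphic_on -{0}" and zero: "\<And>m. F (l m) = 0"
    and M: "\<And>z. z \<noteq> 0 \<Longrightarrow> V F z \<le> M" and z0: "z0 \<noteq> 0"
  shows "F z0 = 0"
proof (rule ccontr)
  assume nz: "F z0 \<noteq> 0"
  obtain h where h: "h holomorphic_on -{0}" "\<And>z. z \<noteq> 0 \<Longrightarrow> F z = G 0 z * h z"
    using divide_by_G[OF F zero] by blast
  have "h z0 \<noteq> 0" using nz h(2)[OF z0] by auto
  then obtain j d where d: "d > 0" "\<And>r. r > 0 \<Longrightarrow> \<exists>z. cmod z = r \<and> d * r powi j \<le> cmod (h z)"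
    using laurent_lower_bound[OF h(1) z0] by blast
  define A where "A = wt (l 0) * (exp (- 2 * low_const \<rho> * E - 2 * E) * exp (a * (- C0 - 1 / 2)))"
  have A: "A > 0" using wt_pos[OF l0[of 0]] by (simp add: A_def)
  define p0 where "p0 = cmod (P 0 (l 0))"
  have p0: "p0 > 0" using P_nonzero_good[OF good_self[of 0]] by (simp add: p0_def)
  have M0: "M \<ge> 0" using M[OF z0] V_nonneg order_trans by blast
  \<comment> \<open>\<open>t\<close> tends to either end; \<open>z\<close> is a point where
    \<open>h\<close> is large on a gap circle in the annulus from \<open>t\<close> to
    \<open>t + 1\<close>.\<close>
  have key: "\<exists>z. z \<noteq> 0 \<and> t \<le> lx z \<and> lx z \<le> t + 1 \<and> d * cmod z powi j \<le> cmod (h z) \<and>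
     cmod (h z) * (\<rho> * max 1 (cmod (l 0 / z))) \<le> M / (A * p0) * exp (a * (1 - \<epsilon>) * real N)"
    if t: "(t = real N \<and> n = int N) \<or> (t = - real N \<and> n = - int N)" for t N n
  proof -
    obtain y where y: "t \<le> y" "y \<le> t + 1" "\<And>j. \<eta> \<le> \<bar>y - x j\<bar>" using exists_gap by blast
    obtain z where z: "cmod z = rad y" "d * rad y powi j \<le> cmod (h z)" using d(2)[of "rad y"] by auto
    have z00: "z \<noteq> 0" using z(1) rad_nonzero[of y] by auto
    have ly: "lx z = y" using z(1) by (rule lx_eqI)
    have gap: "\<And>j. \<eta> \<le> \<bar>lx z - x j\<bar>" using y ly by simp
    define e where "e = A * exp (- (a * (1 - \<epsilon>)) * real N)"
    have e: "e > 0" using A by (simp add: e_def)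
    have "e \<le> V (g 0) z" unfolding e_def A_def
      by (rule V_g0_lower[OF z00 gap, where n = n]) (use t y ly in auto)
    then have "cmod (h z) * cmod (1 - l 0 / z) \<le> M / (e * p0)"
      unfolding p0_def by (intro quotient_circle_bound[OF M h(2) z00 gap e]) auto
    moreover have "M / (e * p0) = M / (A * p0) * exp (a * (1 - \<epsilon>) * real N)"
      using A by (simp add: e_def exp_minus divide_inverse)
    \<comment> \<open>Index 1 is exempted, so that the bound covers the zero
      \<open>l 0\<close>.\<close>
    moreover have "\<rho> * max 1 (cmod (l 0 / z)) \<le> cmod (1 - l 0 / z)"
      by (rule good_quot(2)[OF good_gap(1)[OF z00 gap, of 1]]) simp
    then have "cmod (h z) * (\<rho> * max 1 (cmod (l 0 / z))) \<le> cmod (h z) * cmod (1 - l 0 / z)"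
      by (intro mult_left_mono) auto
    ultimately show ?thesis using z00 y ly z by (intro exI[of _ z]) auto
  qed
  define M' where "M' = M / (A * p0)"
  have M': "M' \<ge> 0" using M0 A p0 by (simp add: M'_def)
  have norm_z: "cmod z = exp (a * (lx z + c))" if "z \<noteq> 0" for z
    using norm_eq_lx[OF that] by (simp add: a_def)
  show False
  proof (cases "j \<ge> 1")
    case True
    show False
    proof (rule log_growth_contradiction[of "a * \<epsilon>" "nat \<lceil>\<bar>c\<bar>\<rceil>" "M' / (d * \<rho> * exp (a * c))"])
      show "a * \<epsilon> > 0" using a_pos eps by simp
      fix N :: nat assume N: "N \<ge> nat \<lceil>\<bar>c\<bar>\<rceil>"
      obtain z where z: "z \<noteq> 0" "real N \<le> lx z" "d * cmod z powi j \<le> cmod (h z)"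
        "cmod (h z) * (\<rho> * max 1 (cmod (l 0 / z))) \<le> M' * exp (a * (1 - \<epsilon>) * real N)"
        using key[of "real N" N "int N"] unfolding M'_def by blast
      have "lx z + c \<ge> 0" using z(2) N by linarith
      then have c1: "cmod z \<ge> 1" unfolding norm_z[OF z(1)] using a_pos by simp
      have "exp (a * (real N + c)) \<le> cmod z" unfolding norm_z[OF z(1)] using z(2) a_pos by simp
      also have "\<dots> \<le> cmod z powi j" using c1 True power_int_increasing[of 1 j "cmod z"] by simp
      finally have "d * exp (a * (real N + c)) \<le> cmod (h z)" using d(1) z(3) by (meson less_imp_le mult_left_mono order_trans)
      then have "d * exp (a * (real N + c)) * (\<rho> * 1) \<le> cmod (h z) * (\<rho> * max 1 (cmod (l 0 / z)))"
        using rho_pos d(1) by (intro mult_mono) auto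
      then have "d * exp (a * (real N + c)) * \<rho> \<le> M' * exp (a * (1 - \<epsilon>) * real N)" using z(4) by simp
      moreover have "d * exp (a * (real N + c)) * \<rho> = d * \<rho> * exp (a * c) * exp (a * \<epsilon> * real N) * exp (a * (1 - \<epsilon>) * real N)"
        by (simp add: mult.assoc exp_add[symmetric] algebra_simps)
      ultimately have "d * \<rho> * exp (a * c) * exp (a * \<epsilon> * real N) \<le> M'" by simp
      then show "exp (a * \<epsilon> * real N) \<le> M' / (d * \<rho> * exp (a * c))"
        using d(1) rho_pos by (subst pos_le_divide_eq) (auto simp: mult_ac)
    qed
  next
    case False
    show False
    proof (rule log_growth_contradiction[of "a * \<epsilon>" "nat \<lceil>\<bar>c\<bar>\<rceil> + 1" "M' * exp (a * (1 + c)) / (d * \<rho> * cmod (l 0))"])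
      show "a * \<epsilon> > 0" using a_pos eps by simp
      fix N :: nat assume N: "N \<ge> nat \<lceil>\<bar>c\<bar>\<rceil> + 1"
      obtain z where z: "z \<noteq> 0" "lx z \<le> - real N + 1" "d * cmod z powi j \<le> cmod (h z)"
        "cmod (h z) * (\<rho> * max 1 (cmod (l 0 / z))) \<le> M' * exp (a * (1 - \<epsilon>) * real N)"
        using key[of "- real N" N "- int N"] unfolding M'_def by blast
      have "lx z + c \<le> 0" using z(2) N by linarith
      then have c1: "cmod z \<le> 1" unfolding norm_z[OF z(1)] using a_pos by (simp add: mult_le_0_iff)
      have "1 \<le> cmod z powi j" using c1 z(1) False power_int_decreasing[of j 0 "cmod z"] by simp
      then have "d * 1 \<le> d * cmod z powi j" using d(1) by (intro mult_left_mono) auto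
      then have "d \<le> cmod (h z)" using z(3) by simp
      \<comment> \<open>Near the origin the factor \<open>|l 0 / z|\<close> gains the power of
        \<open>|z|\<close> that turns growth at rate \<open>1 - \<epsilon>\<close> into
        decay.\<close>
      then have "d * (\<rho> * cmod (l 0 / z)) \<le> cmod (h z) * (\<rho> * max 1 (cmod (l 0 / z)))"
        using rho_pos d(1) by (intro mult_mono) auto
      then have "d * \<rho> * cmod (l 0) / cmod z \<le> M' * exp (a * (1 - \<epsilon>) * real N)" using z(4) by (simp add: norm_divide)
      then have "d * \<rho> * cmod (l 0) \<le> M' * exp (a * (1 - \<epsilon>) * real N) * cmod z"
        using z(1) by (simp add: pos_divide_le_eq)
      also have "\<dots> \<le> M' * exp (a * (1 - \<epsilon>) * real N) * exp (a * (- real N + 1 + c))"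
        unfolding norm_z[OF z(1)] using M' z(2) a_pos by (intro mult_left_mono) auto
      also have "\<dots> = M' * exp (a * (1 + c)) * exp (- (a * \<epsilon> * real N))"
        by (simp add: mult.assoc exp_add[symmetric] algebra_simps)
      finally have "d * \<rho> * cmod (l 0) * exp (a * \<epsilon> * real N) \<le> M' * exp (a * (1 + c)) * exp (- (a * \<epsilon> * real N)) * exp (a * \<epsilon> * real N)"
        by (intro mult_right_mono) auto
      also have "\<dots> = M' * exp (a * (1 + c))" by (simp add: mult.assoc exp_add[symmetric])
      finally show "exp (a * \<epsilon> * real N) \<le> M' * exp (a * (1 + c)) / (d * \<rho> * cmod (l 0))"
        using d(1) rho_pos l0[of 0] by (subst pos_le_divide_eq) (auto simp: mult_ac)
    qed
  qed
qed

text \<open>The solution is the series of \<open>b k / wt (l k) * g k\<close>. By the decay of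
  \<open>V (g k)\<close> it converges locally uniformly, and in each annulus it is controlled by one
  term of a majorant, to which the discrete convolution estimate applies.\<close>

lemma interpolate:
  obtains C where "C > 0"
    "\<And>w. w \<in> lp_space p (range l) \<Longrightarrow> \<exists>f\<in>fock_space \<alpha> p. restriction_op (range l) \<alpha> p f = w \<and>
        fock_norm \<alpha> p f \<le> ennreal C * lp_norm p (range l) w"
proof -
  define \<epsilon>' where "\<epsilon>' = a * \<epsilon>"
  have e': "\<epsilon>' > 0" using a_pos eps by (simp add: \<epsilon>'_def)
  have decay_const: "decay_const > 0" by (simp add: decay_const_def upper_const_def)
  obtain C1 where C1: "C1 > 0" "\<And>F d. F holomorphic_on -{0} \<Longrightarrow> F 0 = 0 \<Longrightarrow> (\<And>m. d m \<ge> 0) \<Longrightarrow> (\<And>z. z \<noteq> 0 \<Longrightarrow> V F z \<le> d \<lfloor>lx z\<rfloor>) \<Longrightarrow>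
      fock_norm \<alpha> p F \<le> ennreal C1 * lp_norm p (UNIV :: int set) (\<lambda>m. of_real (d m))"
    by (rule fock_norm_le_lp_norm) blast
  have e2: "\<epsilon>' / 2 > 0" using e' by simp
  obtain C2 where C2: "C2 > 0" "\<And>(d::int \<Rightarrow> real) (a::int \<Rightarrow> complex) B. B > 0 \<Longrightarrow> (\<And>m. d m \<ge> 0) \<Longrightarrow>
       (\<And>m. \<exists>k. d m \<le> B * (cmod (a k) * exp (- (\<epsilon>' / 2) * \<bar>of_int k - of_int m\<bar>))) \<Longrightarrow>
      lp_norm p UNIV (\<lambda>m. of_real (d m)) \<le> ennreal (C2 * B) * lp_norm p UNIV a"
    by (rule lp_norm_exp_decay_point[OF e2]) blast
  define E2 where "E2 = 2 * exp_sum_bound (\<epsilon>' / 2) 2 + 1"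
  have E2: "E2 > 0" using exp_sum_bound_nonneg[OF e2, of 2] by (simp add: E2_def)
  \<comment> \<open>\<open>exp \<epsilon>'\<close> pays for replacing \<open>lx z\<close> by its
    integer part, \<open>E2\<close> for reducing the series to one term.\<close>
  define B where "B = decay_const * exp \<epsilon>' * E2"
  have B: "B > 0" using decay_const E2 by (simp add: B_def)
  define C where "C = C1 * (C2 * B)"
  have Cpos: "C > 0" using C1(1) C2(1) B by (simp add: C_def)
  have main: "\<exists>f\<in>fock_space \<alpha> p. restriction_op (range l) \<alpha> p f = w \<and>
        fock_norm \<alpha> p f \<le> ennreal C * lp_norm p (range l) w"
    if w: "w \<in> lp_space p (range l)" for w
  proof -
    define b where "b = (\<lambda>k. w (l k))"
    have lpb: "lp_norm p (range l) w = lp_norm p UNIV b"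
    proof -
      have "bij_betw l UNIV (range l)" using inj_l by (simp add: bij_betw_def)
      then show ?thesis using lp_norm_bij[of l UNIV "range l" w] by (simp add: b_def o_def)
    qed
    have fin: "lp_norm p UNIV b < \<infinity>" using w lpb by (simp add: lp_space_def)
    then obtain A where A: "lp_norm p UNIV b = ennreal A" "A \<ge> 0" by (cases "lp_norm p UNIV b") auto
    have bA: "cmod (b k) \<le> A" for k
      using norm_le_lp_norm[OF p, of k UNIV b] A by simp
    define t where "t = (\<lambda>k z. b k / of_real (wt (l k)) * g k z)"
    define f where "f = (\<lambda>z. \<Sum>\<^sub>\<infinity>k. t k z)"
    have tV: "cmod (t k z) * wt z \<le> decay_const * (cmod (b k) * exp (- \<epsilon>' * \<bar>of_int k - lx z\<bar>))" if z: "z \<noteq> 0" for k z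
    proof -
      have wk: "wt (l k) > 0" by (rule wt_pos[OF l0])
      have "cmod (t k z) * wt z = cmod (b k) / wt (l k) * V (g k) z"
        using wk by (simp add: t_def V_def norm_mult norm_divide)
      also have "\<dots> \<le> cmod (b k) / wt (l k) * (wt (l k) * (decay_const * exp (- \<epsilon>' * \<bar>of_int k - lx z\<bar>)))"
        using V_g_decay[OF z, of k] wk unfolding \<epsilon>'_def by (intro mult_left_mono) auto
      also have "\<dots> = decay_const * (cmod (b k) * exp (- \<epsilon>' * \<bar>of_int k - lx z\<bar>))" using wk by simp
      finally show ?thesis .
    qed
    have ulim: "uniform_limit (cball z0 (cmod z0 / 2)) (\<lambda>X z. \<Sum>k\<in>X. t k z) f (finite_subsets_at_top UNIV)"
      if z0: "z0 \<noteq> 0" for z0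
    proof -
      \<comment> \<open>A positive minimum of the weight on the disc turns weighted bounds into a
        Weierstrass majorant.\<close>
      have "continuous_on (cball z0 (cmod z0 / 2)) wt"
        unfolding wt_def[abs_def] using near_ball(1)[OF z0] by (intro continuous_intros) auto
      then obtain z1 where z1: "z1 \<in> cball z0 (cmod z0 / 2)" "\<And>z. z \<in> cball z0 (cmod z0 / 2) \<Longrightarrow> wt z1 \<le> wt z"
        using continuous_attains_inf[of "cball z0 (cmod z0 / 2)" wt] by (metis centre_in_cball compact_cball empty_iff norm_ge_zero zero_le_divide_iff zero_le_numeral)
      have w1: "wt z1 > 0" using near_ball(1)[OF z0 z1(1)] by (rule wt_pos)
      show ?thesis unfolding f_def
      proof (rule Weierstrass_m_test_general)
      show "norm (t k z) \<le> decay_const * A * exp (\<epsilon>' * half_width) / wt z1 * exp (- \<epsilon>' * \<bar>of_int k - lx z0\<bar>)"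
        if zb: "z \<in> cball z0 (cmod z0 / 2)" for k z
      proof -
        note nb = near_ball[OF z0 zb]
        have "\<epsilon>' * \<bar>of_int k - lx z0\<bar> \<le> \<epsilon>' * (\<bar>of_int k - lx z\<bar> + half_width)"
          using nb(2) e' by (intro mult_left_mono) auto
        then have ex: "exp (- \<epsilon>' * \<bar>of_int k - lx z\<bar>) \<le> exp (\<epsilon>' * half_width) * exp (- \<epsilon>' * \<bar>of_int k - lx z0\<bar>)"
          unfolding exp_add[symmetric] by (simp add: algebra_simps)
        have "cmod (t k z) * wt z1 \<le> cmod (t k z) * wt z" using z1(2)[OF zb] by (intro mult_left_mono) auto
        also have "\<dots> \<le> decay_const * (cmod (b k) * exp (- \<epsilon>' * \<bar>of_int k - lx z\<bar>))" by (rule tV[OF nb(1)])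
        also have "\<dots> \<le> decay_const * (A * (exp (\<epsilon>' * half_width) * exp (- \<epsilon>' * \<bar>of_int k - lx z0\<bar>)))"
          using decay_const bA A(2) ex by (intro mult_left_mono mult_mono) auto
        finally have "cmod (t k z) \<le> decay_const * (A * (exp (\<epsilon>' * half_width) * exp (- \<epsilon>' * \<bar>of_int k - lx z0\<bar>))) / wt z1"
          using w1 by (simp add: pos_le_divide_eq)
        then show ?thesis by (simp add: mult_ac)
      qed
      show "(\<lambda>k. decay_const * A * exp (\<epsilon>' * half_width) / wt z1 * exp (- \<epsilon>' * \<bar>of_int k - lx z0\<bar>)) summable_on UNIV"
        by (intro summable_on_cmult_right exp_summable_on(1)[OF window_bounded_of_int e'])
      qed
    qed
    have hol: "f holomorphic_on -{0}"
    proof -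
      have "f field_differentiable at z0" if z0: "z0 \<noteq> 0" for z0
      proof -
        have t_hol: "(\<lambda>z. \<Sum>k\<in>X. t k z) holomorphic_on -{0}" for X
          unfolding t_def by (intro holomorphic_intros holomorphic_g) auto
        have sub: "cball z0 (cmod z0 / 2) \<subseteq> -{0}" using near_ball(1)[OF z0] by auto
        obtain "f holomorphic_on ball z0 (cmod z0 / 2)"
        proof (rule holomorphic_uniform_limit[OF _ ulim[OF z0]])
          show "\<forall>\<^sub>F X in finite_subsets_at_top UNIV. continuous_on (cball z0 (cmod z0 / 2)) (\<lambda>z. \<Sum>k\<in>X. t k z) \<and>
              (\<lambda>z. \<Sum>k\<in>X. t k z) holomorphic_on ball z0 (cmod z0 / 2)"
            by (intro always_eventually allI conjI holomorphic_on_imp_continuous_on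
                holomorphic_on_subset[OF t_hol sub] holomorphic_on_subset[OF t_hol subset_trans[OF ball_subset_cball sub]])
        qed (auto simp: finite_subsets_at_top_neq_bot)
        then show ?thesis using z0 by (intro holomorphic_on_imp_differentiable_at[of f "ball z0 (cmod z0 / 2)"]) auto
      qed
      then show ?thesis by (simp add: holomorphic_on_def field_differentiable_at_within)
    qed
    have f0: "f 0 = 0" by (simp add: f_def t_def)
    have fl: "f (l m) = b m / of_real (wt (l m))" for m
    proof -
      have "((\<lambda>k. t k (l m)) has_sum t m (l m)) UNIV"
        by (rule has_sum_finite_neutralI[of "{m}"]) (auto simp: t_def g_other)
      then show ?thesis unfolding f_def by (simp add: infsumI t_def g_self)
    qed
    define d where "d = (\<lambda>m::int. decay_const * exp \<epsilon>' * (\<Sum>\<^sub>\<infinity>k. cmod (b k) * exp (- \<epsilon>' * \<bar>of_int k - of_int m\<bar>)))"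
    have d0: "d m \<ge> 0" for m unfolding d_def using decay_const by (intro mult_nonneg_nonneg infsum_nonneg) auto
    note att = exp_infsum_attained[OF e', where a = b and A = A, OF bA]
    have Vf: "V f z \<le> d \<lfloor>lx z\<rfloor>" if z: "z \<noteq> 0" for z
    proof -
      have "V f z = cmod (\<Sum>\<^sub>\<infinity>k. t k z * of_real (wt z))"
        using wt_pos[OF z] by (simp add: V_def f_def infsum_cmult_left' norm_mult)
      also have "\<dots> \<le> (\<Sum>\<^sub>\<infinity>k. decay_const * exp \<epsilon>' * (cmod (b k) * exp (- \<epsilon>' * \<bar>of_int k - of_int \<lfloor>lx z\<rfloor>\<bar>)))"
      proof (rule norm_infsum_le)
        have bd: "norm (t k z * of_real (wt z)) \<le> decay_const * exp \<epsilon>' * (cmod (b k) * exp (- \<epsilon>' * \<bar>of_int k - of_int \<lfloor>lx z\<rfloor>\<bar>))" for k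
        proof -
          have "\<bar>of_int k - of_int \<lfloor>lx z\<rfloor>\<bar> \<le> \<bar>of_int k - lx z\<bar> + 1" by linarith
          then have "\<epsilon>' * \<bar>of_int k - of_int \<lfloor>lx z\<rfloor>\<bar> \<le> \<epsilon>' * (\<bar>of_int k - lx z\<bar> + 1)" using e' by (intro mult_left_mono) auto
          then have ex: "exp (- \<epsilon>' * \<bar>of_int k - lx z\<bar>) \<le> exp \<epsilon>' * exp (- \<epsilon>' * \<bar>of_int k - of_int \<lfloor>lx z\<rfloor>\<bar>)"
            unfolding exp_add[symmetric] by (simp add: algebra_simps)
          have "norm (t k z * of_real (wt z)) \<le> decay_const * (cmod (b k) * exp (- \<epsilon>' * \<bar>of_int k - lx z\<bar>))"
            using tV[OF z, of k] wt_pos[OF z] by (simp add: norm_mult)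
          also have "\<dots> \<le> decay_const * (cmod (b k) * (exp \<epsilon>' * exp (- \<epsilon>' * \<bar>of_int k - of_int \<lfloor>lx z\<rfloor>\<bar>)))"
            using decay_const ex by (intro mult_left_mono) auto
          finally show ?thesis by (simp add: mult_ac)
        qed
        then show "norm (t k z * of_real (wt z)) \<le> decay_const * exp \<epsilon>' * (cmod (b k) * exp (- \<epsilon>' * \<bar>of_int k - of_int \<lfloor>lx z\<rfloor>\<bar>))" for k .
        have sm: "(\<lambda>k. decay_const * exp \<epsilon>' * (cmod (b k) * exp (- \<epsilon>' * \<bar>of_int k - of_int \<lfloor>lx z\<rfloor>\<bar>))) summable_on UNIV"
          by (intro summable_on_cmult_right att(1))
        then show "((\<lambda>k. decay_const * exp \<epsilon>' * (cmod (b k) * exp (- \<epsilon>' * \<bar>of_int k - of_int \<lfloor>lx z\<rfloor>\<bar>))) has_sum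
            (\<Sum>\<^sub>\<infinity>k. decay_const * exp \<epsilon>' * (cmod (b k) * exp (- \<epsilon>' * \<bar>of_int k - of_int \<lfloor>lx z\<rfloor>\<bar>)))) UNIV"
          by (rule has_sum_infsum)
        show "((\<lambda>k. t k z * of_real (wt z)) has_sum (\<Sum>\<^sub>\<infinity>k. t k z * of_real (wt z))) UNIV"
          by (rule has_sum_infsum[OF abs_summable_summable[OF Infinite_Sum.abs_summable_on_comparison_test'[OF sm bd]]])
      qed
      also have "\<dots> = d \<lfloor>lx z\<rfloor>" unfolding d_def by (rule infsum_cmult_right')
      finally show ?thesis .
    qed
    have "fock_norm \<alpha> p f \<le> ennreal C1 * lp_norm p UNIV (\<lambda>m. of_real (d m))"
      by (rule C1(2)[OF hol f0 d0 Vf])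
    also have "\<dots> \<le> ennreal C1 * (ennreal (C2 * B) * lp_norm p UNIV b)"
    proof (intro mult_left_mono C2(2)[OF B d0])
      fix m
      obtain k where k: "(\<Sum>\<^sub>\<infinity>k. cmod (b k) * exp (- \<epsilon>' * \<bar>of_int k - of_int m\<bar>))
          \<le> E2 * (cmod (b k) * exp (- (\<epsilon>' / 2) * \<bar>of_int k - of_int m\<bar>))"
        using att(2)[where x = "of_int m"] unfolding E2_def by blast
      have "d m \<le> decay_const * exp \<epsilon>' * (E2 * (cmod (b k) * exp (- (\<epsilon>' / 2) * \<bar>of_int k - of_int m\<bar>)))"
        unfolding d_def using decay_const k by (intro mult_left_mono) auto
      then show "\<exists>k. d m \<le> B * (cmod (b k) * exp (- (\<epsilon>' / 2) * \<bar>of_int k - of_int m\<bar>))"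
        by (intro exI[of _ k]) (simp add: B_def mult.assoc)
    qed auto
    also have "\<dots> = ennreal C * lp_norm p (range l) w"
      using C1(1) C2(1) B by (simp add: C_def ennreal_mult[symmetric] mult.assoc[symmetric] lpb)
    finally have le: "fock_norm \<alpha> p f \<le> ennreal C * lp_norm p (range l) w" .
    have "f \<in> fock_space \<alpha> p"
    proof (rule fock_spaceI[OF hol f0])
      show "fock_norm \<alpha> p f < \<infinity>"
        using le fin lpb by (auto simp: ennreal_mult_less_top intro: le_less_trans)
    qed
    moreover have "restriction_op (range l) \<alpha> p f = w"
    proof
      fix z
      show "restriction_op (range l) \<alpha> p f z = w z"
      proof (cases "z \<in> range l")
        case True
        then obtain m where m: "z = l m" by blast
        then show ?thesis using wt_pos[OF l0[of m]] restriction_op_eq_V[OF True, of f] by (simp add: fl b_def)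
      next
        case False
        then show ?thesis using w by (simp add: restriction_op_outside lp_space_def)
      qed
    qed
    ultimately show ?thesis using le by blast
  qed
  show ?thesis by (rule that[OF Cpos main])
qed

theorem complete_interpolating_range: "complete_interpolating \<alpha> p (range l)"
proof -
  define R where "R = restriction_op (range l) \<alpha> p"
  obtain C where C: "C > 0" "\<And>w. w \<in> lp_space p (range l) \<Longrightarrow> \<exists>f\<in>fock_space \<alpha> p. R f = w \<and>
        fock_norm \<alpha> p f \<le> ennreal C * lp_norm p (range l) w"
    unfolding R_def by (rule interpolate) blast
  obtain C3 where C3: "C3 > 0" "\<And>(I::int set) w f. window_bounded I (\<lambda>i. lx (w i)) K \<Longrightarrow> (\<And>i. i \<in> I \<Longrightarrow> w i \<noteq> 0) \<Longrightarrow>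
      f holomorphic_on -{0} \<Longrightarrow> lp_norm p I (\<lambda>i. of_real (V f (w i))) \<le> ennreal C3 * fock_norm \<alpha> p f"
    by (rule lp_norm_V_le_fock_norm[of K, where 'i = int]) (rule that; blast)
  have bdd: "lp_norm p (range l) (R f) \<le> ennreal C3 * fock_norm \<alpha> p f" if f: "f \<in> fock_space \<alpha> p" for f
  proof -
    have "bij_betw l UNIV (range l)" using inj_l by (simp add: bij_betw_def)
    then have "lp_norm p (range l) (R f) = lp_norm p UNIV (R f \<circ> l)" by (rule lp_norm_bij)
    also have "\<dots> = lp_norm p UNIV (\<lambda>i. of_real (V f (l i)))"
      by (rule lp_norm_cong_norm) (simp add: R_def norm_restriction_op V_nonneg)
    also have "\<dots> \<le> ennreal C3 * fock_norm \<alpha> p f"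
      by (rule C3(2)[OF win l0 fock_spaceD(1)[OF f]])
    finally show ?thesis .
  qed
  \<comment> \<open>Functions in the space have bounded \<open>V\<close>, and \<open>V\<close> is
    subadditive, so uniqueness applies to a difference without a triangle inequality for the
    norm.\<close>
  have inj: "f = h" if f: "f \<in> fock_space \<alpha> p" and h: "h \<in> fock_space \<alpha> p" and eq: "R f = R h" for f h
  proof
    fix z
    show "f z = h z"
    proof (cases "z = 0")
      case True then show ?thesis using fock_spaceD(2)[OF f] fock_spaceD(2)[OF h] by simp
    next
      case False
      obtain M1 where M1: "M1 \<ge> 0" "\<And>z. z \<noteq> 0 \<Longrightarrow> V f z \<le> M1" by (rule fock_space_V_bounded[OF f]) blast
      obtain M2 where M2: "M2 \<ge> 0" "\<And>z. z \<noteq> 0 \<Longrightarrow> V h z \<le> M2" by (rule fock_space_V_bounded[OF h]) blast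
      have "(\<lambda>z. f z - h z) z = 0"
      proof (rule uniqueness[OF _ _ _ False])
        show "(\<lambda>z. f z - h z) holomorphic_on -{0}"
          by (intro holomorphic_intros fock_spaceD(1) f h)
        show "f (l m) - h (l m) = 0" for m
        proof -
          have "R f (l m) = R h (l m)" using eq by simp
          then show ?thesis using wt_pos[OF l0[of m]] by (simp add: R_def restriction_op_eq_V)
        qed
        show "V (\<lambda>z. f z - h z) z \<le> M1 + M2" if "z \<noteq> 0" for z
          using V_diff_le[of f h z] M1(2)[OF that] M2(2)[OF that] by linarith
      qed
      then show ?thesis by simp
    qed
  qed
  have injon: "inj_on R (fock_space \<alpha> p)" by (rule inj_onI) (rule inj)
  have maps: "R f \<in> lp_space p (range l)" if f: "f \<in> fock_space \<alpha> p" for f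
    using bdd[OF f] fock_spaceD(3)[OF f]
    by (auto simp: lp_space_def R_def restriction_op_outside ennreal_mult_less_top intro: le_less_trans)
  have bij: "bij_betw R (fock_space \<alpha> p) (lp_space p (range l))"
    unfolding bij_betw_def using injon maps C(2) by blast
  have inv: "fock_norm \<alpha> p (inv_into (fock_space \<alpha> p) R w) \<le> ennreal C * lp_norm p (range l) w"
    if w: "w \<in> lp_space p (range l)" for w
  proof -
    obtain f where f: "f \<in> fock_space \<alpha> p" "R f = w" "fock_norm \<alpha> p f \<le> ennreal C * lp_norm p (range l) w"
      using C(2)[OF w] by blast
    then show ?thesis using inv_into_f_f[OF injon f(1)] by simp
  qed
  have lin: "linear_between (fock_space \<alpha> p) R"
    unfolding linear_between_def R_def restriction_op_def by (auto simp: fun_eq_iff algebra_simps)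
  show ?thesis
    unfolding complete_interpolating_def isomorphism_between_def bounded_between_def R_def[symmetric]
    using lin bij bdd inv by blast
qed

end

section \<open>Complete interpolating sets\<close>

text \<open>Repeatedly removing a minimiser exhausts \<open>S\<close>: an element never chosen would
  have infinitely many chosen values at or below its own.\<close>

lemma exists_mono_enumeration:
  fixes f :: "'a \<Rightarrow> real"
  assumes inf: "infinite S" and fin: "\<And>r. finite {x\<in>S. f x \<le> r}"
  obtains e :: "nat \<Rightarrow> 'a" where "bij_betw e UNIV S" "\<And>n. f (e n) \<le> f (e (Suc n))"
proof -
  define pick where "pick = (\<lambda>T. SOME x. x \<in> T \<and> (\<forall>y\<in>T. f x \<le> f y))"
  have pick: "pick T \<in> T \<and> (\<forall>y\<in>T. f (pick T) \<le> f y)" if T: "T \<subseteq> S" "T \<noteq> {}" for T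
    unfolding pick_def
  proof (rule someI_ex)
    obtain x0 where x0: "x0 \<in> T" using T by blast
    define W where "W = {x\<in>T. f x \<le> f x0}"
    have W: "finite W" "x0 \<in> W" using fin[of "f x0"] finite_subset[of W "{x\<in>S. f x \<le> f x0}"] T x0 by (auto simp: W_def)
    define x1 where "x1 = arg_min_on f W"
    have x1: "x1 \<in> W" "\<And>y. y \<in> W \<Longrightarrow> f x1 \<le> f y"
      unfolding x1_def using W arg_min_if_finite(1)[of W f] arg_min_least[of W _ f] by auto
    have "f x1 \<le> f y" if "y \<in> T" for y
      using x1 that by (cases "y \<in> W") (auto simp: W_def)
    then show "\<exists>x. x \<in> T \<and> (\<forall>y\<in>T. f x \<le> f y)"
      using x1(1) by (auto simp: W_def)
  qed
  define Q where "Q = rec_nat {} (\<lambda>_ A. insert (pick (S - A)) A)"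
  define e where "e = (\<lambda>n. pick (S - Q n))"
  have Q0: "Q 0 = {}" and QS: "Q (Suc n) = insert (e n) (Q n)" for n by (simp_all add: Q_def e_def)
  have Qfin: "finite (Q n)" for n by (induction n) (simp_all add: Q0 QS)
  have ne: "S - Q n \<noteq> {}" for n using inf Qfin[of n] by (metis Diff_infinite_finite finite.emptyI)
  have e: "e n \<in> S - Q n" "\<And>y. y \<in> S - Q n \<Longrightarrow> f (e n) \<le> f y" for n
    using pick[of "S - Q n"] ne[of n] by (auto simp: e_def)
  have Qe: "Q n = e ` {..<n}" for n by (induction n) (auto simp: Q0 QS lessThan_Suc)
  have inj: "inj e"
  proof (rule linorder_injI)
    fix m n :: nat assume "m < n"
    then have "e m \<in> Q n" by (auto simp: Qe)
    then show "e m \<noteq> e n" using e(1)[of n] by auto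
  qed
  have mono: "f (e n) \<le> f (e (Suc n))" for n
    using e(1)[of "Suc n"] by (intro e(2)) (auto simp: QS)
  have "range e = S"
  proof
    show "range e \<subseteq> S" using e(1) by auto
    show "S \<subseteq> range e"
    proof
      fix y assume y: "y \<in> S"
      show "y \<in> range e"
      proof (rule ccontr)
        assume "y \<notin> range e"
        then have "f (e n) \<le> f y" for n using y by (intro e(2)) (auto simp: Qe)
        then have "range e \<subseteq> {x\<in>S. f x \<le> f y}" using e(1) by auto
        then have "finite (range e)" using fin finite_subset by blast
        then show False using range_inj_infinite[OF inj] by simp
      qed
    qed
  qed
  then have "bij_betw e UNIV S" using inj by (simp add: bij_betw_def)
  then show ?thesis using mono by (rule that)
qed

lemma (in fock) lp_norm_unit: "lp_norm p I (\<lambda>z. if z = i then b else 0) \<le> ennreal (cmod b)"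
proof (cases "p = \<infinity>")
  case True
  show ?thesis unfolding True lp_norm_infty_le_iff by simp
next
  case False
  show ?thesis unfolding lp_norm_def
  proof (subst Lp_norm_le_iff[OF p False])
    have "(\<integral>\<^sup>+z. ennreal (cmod (if z = i then b else 0) powr enn2real p) \<partial>count_space I)
       \<le> (\<integral>\<^sup>+z. ennreal (cmod (if z = i then b else 0) powr enn2real p) \<partial>count_space (insert i I))"
      by (subst (1 2) nn_integral_count_space_indicator) (auto intro!: nn_integral_mono simp: indicator_def)
    also have "\<dots> = (\<Sum>z\<in>{i}. ennreal (cmod (if z = i then b else 0) powr enn2real p))"
      using q_pos[OF False] by (intro nn_integral_count_space') auto
    finally show "(\<integral>\<^sup>+z. ennreal (cmod (if z = i then b else 0) powr enn2real p) \<partial>count_space I) \<le> ennreal (cmod b powr enn2real p)"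
      by simp
  qed auto
qed

lemma (in fock) monomial_in_fock:
  fixes n :: int
  shows "\<exists>f\<in>fock_space \<alpha> p. \<forall>z. z \<noteq> 0 \<longrightarrow> V f z = exp (- ((lx z - of_int n)\<^sup>2 / (4 * \<alpha>)))"
proof -
  define s where "s = 1 / (4 * \<alpha>)"
  have s: "s > 0" using alpha by (simp add: s_def)
  obtain C1 where C1: "C1 > 0" "\<And>F d. F holomorphic_on -{0} \<Longrightarrow> F 0 = 0 \<Longrightarrow> (\<And>m. d m \<ge> 0) \<Longrightarrow> (\<And>z. z \<noteq> 0 \<Longrightarrow> V F z \<le> d \<lfloor>lx z\<rfloor>) \<Longrightarrow>
      fock_norm \<alpha> p F \<le> ennreal C1 * lp_norm p (UNIV :: int set) (\<lambda>m. of_real (d m))"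
    by (rule fock_norm_le_lp_norm) (rule that; blast)
  obtain C2 where C2: "C2 > 0" "\<And>(d::int \<Rightarrow> real) (a::int \<Rightarrow> complex) B. B > 0 \<Longrightarrow> (\<And>m. d m \<ge> 0) \<Longrightarrow>
       (\<And>m. \<exists>k. d m \<le> B * (cmod (a k) * exp (- s * \<bar>of_int k - of_int m\<bar>))) \<Longrightarrow>
      lp_norm p UNIV (\<lambda>m. of_real (d m)) \<le> ennreal (C2 * B) * lp_norm p UNIV a"
    by (rule lp_norm_exp_decay_point[OF s]) (rule that; blast)
  show ?thesis
  proof -
    define b where "b = exp (- ((of_int n + c)\<^sup>2 / (4 * \<alpha>)))"
    define f where "f = (\<lambda>z::complex. if z = 0 then 0 else of_real b * z powi n)"
    have Vf: "V f z = exp (- ((lx z - of_int n)\<^sup>2 / (4 * \<alpha>)))" if z: "z \<noteq> 0" for z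
    proof -
      have "V f z = b * (cmod z powi n * wt z)" using z by (simp add: V_def f_def norm_mult norm_power_int b_def)
      also have "\<dots> = exp (- ((lx z - of_int n)\<^sup>2 / (4 * \<alpha>)))"
        unfolding norm_powi_wt[OF z] b_def mult.assoc[symmetric] exp_add[symmetric] by simp
      finally show ?thesis .
    qed
    have hol: "f holomorphic_on -{0}"
      by (rule holomorphic_transform[of "\<lambda>z. of_real b * z powi n"]) (auto simp: f_def intro!: holomorphic_intros)
    \<comment> \<open>A Gaussian lies below an exponential, by \<open>|y| \<le> y^2 + 1\<close>; the
      other unit in \<open>2 * s\<close> comes from the integer part.\<close>
    define d where "d = (\<lambda>m::int. exp (2 * s) * exp (- s * \<bar>of_int n - of_int m\<bar>))"
    have "fock_norm \<alpha> p f \<le> ennreal C1 * lp_norm p UNIV (\<lambda>m. of_real (d m))"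
    proof (rule C1(2)[OF hol])
      fix z :: complex assume z: "z \<noteq> 0"
      define y where "y = lx z - of_int n"
      have "\<bar>of_int n - of_int \<lfloor>lx z\<rfloor>\<bar> \<le> \<bar>y\<bar> + 1" unfolding y_def by linarith
      moreover have "\<bar>y\<bar> \<le> y\<^sup>2 + 1"
        using zero_le_power2[of "\<bar>y\<bar> - 1"] by (simp add: power2_eq_square algebra_simps)
      ultimately have "s * (\<bar>of_int n - of_int \<lfloor>lx z\<rfloor>\<bar> - 2) \<le> s * y\<^sup>2" using s by (intro mult_left_mono) auto
      then have "exp (- (s * y\<^sup>2)) \<le> d \<lfloor>lx z\<rfloor>" unfolding d_def exp_add[symmetric] by (simp add: algebra_simps)
      then show "V f z \<le> d \<lfloor>lx z\<rfloor>" unfolding Vf[OF z] y_def s_def by simp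
    qed (auto simp: f_def d_def)
    also have "\<dots> \<le> ennreal C1 * (ennreal (C2 * exp (2 * s)) * lp_norm p UNIV (\<lambda>k::int. if k = n then 1 else 0))"
    proof (intro mult_left_mono C2(2))
      fix m :: int
      show "\<exists>k. d m \<le> exp (2 * s) * (cmod (if k = n then 1 else 0) * exp (- s * \<bar>of_int k - of_int m\<bar>))"
        by (intro exI[of _ n]) (simp add: d_def)
    qed (auto simp: d_def)
    also have "\<dots> \<le> ennreal C1 * (ennreal (C2 * exp (2 * s)) * ennreal (cmod 1))"
      by (intro mult_left_mono lp_norm_unit) auto
    also have "\<dots> < \<infinity>" by (simp add: ennreal_mult_less_top)
    finally have "fock_norm \<alpha> p f < \<infinity>" .
    then have "f \<in> fock_space \<alpha> p" by (intro fock_spaceI hol) (auto simp: f_def)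
    then show ?thesis using Vf by (intro bexI[of _ f]) auto
  qed
qed

section \<open>What complete interpolation forces on the set\<close>

locale complete_interp = fock \<alpha> p for \<alpha> p +
  fixes \<Lambda> :: "complex set"
  assumes \<Lambda>0: "\<Lambda> \<subseteq> -{0}" and compl: "complete_interpolating \<alpha> p \<Lambda>"
begin

abbreviation R where "R \<equiv> restriction_op \<Lambda> \<alpha> p"

lemma nz: "z \<in> \<Lambda> \<Longrightarrow> z \<noteq> 0" using \<Lambda>0 by auto

lemma R_bij: "bij_betw R (fock_space \<alpha> p) (lp_space p \<Lambda>)"
  using compl by (simp add: complete_interpolating_def isomorphism_between_def)

lemma R_inj: "f \<in> fock_space \<alpha> p \<Longrightarrow> h \<in> fock_space \<alpha> p \<Longrightarrow> R f = R h \<Longrightarrow> f = h"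
  using R_bij by (auto simp: bij_betw_def inj_on_def)

lemma R_inverse_bound:
  obtains C where "C > 0"
    "\<And>f. f \<in> fock_space \<alpha> p \<Longrightarrow> fock_norm \<alpha> p f \<le> ennreal C * lp_norm p \<Lambda> (R f)"
proof -
  obtain C :: real where C: "\<forall>w\<in>lp_space p \<Lambda>. fock_norm \<alpha> p (inv_into (fock_space \<alpha> p) R w) \<le> ennreal C * lp_norm p \<Lambda> w"
    using compl unfolding complete_interpolating_def isomorphism_between_def bounded_between_def by blast
  show ?thesis
  proof (rule that[of "max C 1"])
    fix f assume f: "f \<in> fock_space \<alpha> p"
    have "R f \<in> lp_space p \<Lambda>" using R_bij f by (auto simp: bij_betw_def)
    then have "fock_norm \<alpha> p (inv_into (fock_space \<alpha> p) R (R f)) \<le> ennreal C * lp_norm p \<Lambda> (R f)" using C by blast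
    also have "\<dots> \<le> ennreal (max C 1) * lp_norm p \<Lambda> (R f)" by (intro mult_right_mono ennreal_leI) auto
    also have "inv_into (fock_space \<alpha> p) R (R f) = f" using R_bij f by (auto simp: bij_betw_def)
    finally show "fock_norm \<alpha> p f \<le> ennreal (max C 1) * lp_norm p \<Lambda> (R f)" .
  qed auto
qed

lemma R_eqI:
  assumes "\<And>z. z \<in> \<Lambda> \<Longrightarrow> f z * of_real (wt z) = w z" "\<And>z. z \<notin> \<Lambda> \<Longrightarrow> w z = 0"
  shows "R f = w"
proof
  fix z
  show "R f z = w z"
    using assms by (cases "z \<in> \<Lambda>") (auto simp: restriction_op_eq_V restriction_op_outside)
qed

text \<open>The dual functions, normalised in the weighted sense:
  \<open>V (basis b) b = 1\<close>.\<close>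

definition basis :: "complex \<Rightarrow> complex \<Rightarrow> complex" where
  "basis b = inv_into (fock_space \<alpha> p) R (\<lambda>z. if z = b then 1 else 0)"

lemma basis:
  assumes b: "b \<in> \<Lambda>"
  shows "basis b \<in> fock_space \<alpha> p" "R (basis b) = (\<lambda>z. if z = b then 1 else 0)"
    "basis b b * of_real (wt b) = 1" "\<And>z. z \<in> \<Lambda> \<Longrightarrow> z \<noteq> b \<Longrightarrow> basis b z = 0"
proof -
  have "lp_norm p \<Lambda> (\<lambda>z. if z = b then 1 else 0) \<le> ennreal (cmod 1)" by (rule lp_norm_unit)
  also have "\<dots> < \<infinity>" by simp
  finally have mem: "(\<lambda>z. if z = b then 1 else 0) \<in> lp_space p \<Lambda>" using b by (auto simp: lp_space_def)
  then show 1: "basis b \<in> fock_space \<alpha> p" and 2: "R (basis b) = (\<lambda>z. if z = b then 1 else 0)"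
    using R_bij unfolding basis_def by (auto simp: bij_betw_def inv_into_into f_inv_into_f)
  have 3: "R (basis b) z = (if z = b then 1 else 0)" for z using 2 by simp
  show "basis b b * of_real (wt b) = 1" using 3[of b] restriction_op_eq_V[OF b, of "basis b"] by simp
  fix z assume z: "z \<in> \<Lambda>" "z \<noteq> b"
  then have "basis b z * of_real (wt z) = 0" using 3[of z] restriction_op_eq_V[OF z(1), of "basis b"] by simp
  then show "basis b z = 0" using wt_pos[OF nz[OF z(1)]] by simp
qed

lemma basis_norm_bound:
  obtains C where "C > 0" "\<And>b. b \<in> \<Lambda> \<Longrightarrow> fock_norm \<alpha> p (basis b) \<le> ennreal C"
proof -
  obtain C where C: "C > 0" "\<And>f. f \<in> fock_space \<alpha> p \<Longrightarrow> fock_norm \<alpha> p f \<le> ennreal C * lp_norm p \<Lambda> (R f)"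
    by (rule R_inverse_bound) (rule that; blast)
  have "fock_norm \<alpha> p (basis b) \<le> ennreal C" if b: "b \<in> \<Lambda>" for b
  proof -
    have "fock_norm \<alpha> p (basis b) \<le> ennreal C * lp_norm p \<Lambda> (R (basis b))" by (rule C(2)[OF basis(1)[OF b]])
    also have "\<dots> \<le> ennreal C * ennreal (cmod 1)" unfolding basis(2)[OF b] by (intro mult_left_mono lp_norm_unit) auto
    finally show ?thesis by simp
  qed
  then show ?thesis using C(1) that by blast
qed

lemma basis_V_bound:
  obtains M where "M > 0" "\<And>b z. b \<in> \<Lambda> \<Longrightarrow> z \<noteq> 0 \<Longrightarrow> V (basis b) z \<le> M"
proof -
  obtain C where C: "C > 0" "\<And>b. b \<in> \<Lambda> \<Longrightarrow> fock_norm \<alpha> p (basis b) \<le> ennreal C"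
    by (rule basis_norm_bound) (rule that; blast)
  obtain C' where C': "C' > 0" "\<And>f w. f holomorphic_on -{0} \<Longrightarrow> w \<noteq> 0 \<Longrightarrow> ennreal (V f w) \<le> ennreal C' * fock_norm \<alpha> p f"
    by (rule V_le_fock_norm) blast
  have "V (basis b) z \<le> C' * C" if b: "b \<in> \<Lambda>" and z: "z \<noteq> 0" for b z
  proof -
    have "ennreal (V (basis b) z) \<le> ennreal C' * fock_norm \<alpha> p (basis b)"
      by (rule C'(2)[OF fock_spaceD(1)[OF basis(1)[OF b]] z])
    also have "\<dots> \<le> ennreal C' * ennreal C" by (intro mult_left_mono C b) auto
    finally show ?thesis using C(1) C'(1) by (simp add: ennreal_mult[symmetric])
  qed
  then show ?thesis using C(1) C'(1) that[of "C' * C"] by simp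
qed

text \<open>Injectivity of \<open>R\<close>; this later identifies the explicit product functions
  with multiples of the dual ones.\<close>

lemma unique_multiple:
  assumes F: "F \<in> fock_space \<alpha> p" and b: "b \<in> \<Lambda>" and zero: "\<And>z. z \<in> \<Lambda> \<Longrightarrow> z \<noteq> b \<Longrightarrow> F z = 0"
  shows "F z = F b * of_real (wt b) * basis b z"
proof -
  have "F = (\<lambda>z. F b * of_real (wt b) * basis b z)"
  proof (rule R_inj[OF F])
    show "(\<lambda>z. F b * of_real (wt b) * basis b z) \<in> fock_space \<alpha> p"
      by (rule fock_space_cmult[OF basis(1)[OF b]])
    have "R F = (\<lambda>z. if z = b then F b * of_real (wt b) else 0)"
      using b zero by (intro R_eqI) auto
    moreover have "R (\<lambda>z. F b * of_real (wt b) * basis b z) = (\<lambda>z. if z = b then F b * of_real (wt b) else 0)"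
      using b basis(3,4)[OF b] by (intro R_eqI) (auto simp: mult.assoc)
    ultimately show "R F = R (\<lambda>z. F b * of_real (wt b) * basis b z)" by simp
  qed
  then show ?thesis by (rule fun_cong)
qed

lemma V_basis_self: "b \<in> \<Lambda> \<Longrightarrow> V (basis b) b = 1"
  using norm_restriction_op[of b \<Lambda> "basis b"] basis(2)[of b] by simp

text \<open>The weighted modulus of \<open>basis b\<close> is 1 at \<open>b\<close>, 0 at
  \<open>d\<close>, and bounded by \<open>M\<close> around. By a Cauchy estimate at scale
  \<open>|b|\<close>, falling from 1 to 0 takes a distance proportional to
  \<open>|b|\<close>.\<close>

lemma separated:
  obtains k where "k > 0" "\<And>b d. b \<in> \<Lambda> \<Longrightarrow> d \<in> \<Lambda> \<Longrightarrow> b \<noteq> d \<Longrightarrow> k * max (cmod b) (cmod d) \<le> cmod (b - d)"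
proof -
  obtain M where M: "M > 0" "\<And>b z. b \<in> \<Lambda> \<Longrightarrow> z \<noteq> 0 \<Longrightarrow> V (basis b) z \<le> M"
    by (rule basis_V_bound) (rule that; blast)
  define A where "A = ann_const half_width * M"
  have A: "A > 0" using M(1) by (simp add: A_def)
  define k where "k = min (1 / 4) (1 / (4 * A))"
  have k: "k > 0" using A by (simp add: k_def)
  have main: "k * cmod b \<le> cmod (b - d)" if b: "b \<in> \<Lambda>" and d: "d \<in> \<Lambda>" and bd: "b \<noteq> d" for b d
  proof (cases "cmod (b - d) \<le> cmod b / 4")
    case False
    have "k * cmod b \<le> 1 / 4 * cmod b" by (intro mult_right_mono) (auto simp: k_def)
    then show ?thesis using False by simp
  next
    case True
    have b0: "b \<noteq> 0" by (rule nz[OF b])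
    \<comment> \<open>The companion \<open>h\<close> keeps the zero at \<open>d\<close> and has
      \<open>|h b| \<ge> 1\<close>; being holomorphic, it admits the derivative estimate.\<close>
    obtain h n where h: "h = (\<lambda>z. of_real (exp ((of_int n + c)\<^sup>2 / (4 * \<alpha>))) * (basis b z * z powi (- n)))"
      "\<And>z. z \<noteq> 0 \<Longrightarrow> V (basis b) z \<le> cmod (h z)"
      "\<And>z. z \<noteq> 0 \<Longrightarrow> \<bar>lx z - lx b\<bar> \<le> half_width \<Longrightarrow> cmod (h z) \<le> ann_const half_width * V (basis b) z"
      by (rule V_local[of "basis b" "lx b" half_width]) blast
    have hol: "h holomorphic_on -{0}" by (rule V_local_holomorphic[OF fock_spaceD(1)[OF basis(1)[OF b]] h(1)])
    have hA: "cmod (h z) \<le> A" if "z \<in> cball b (cmod b / 2)" for z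
    proof -
      note nb = near_ball[OF b0 that]
      have "cmod (h z) \<le> ann_const half_width * V (basis b) z" by (rule h(3)[OF nb(1,2)])
      also have "\<dots> \<le> A" unfolding A_def using M(2)[OF b nb(1)] by (intro mult_left_mono) (auto simp: less_imp_le)
      finally show ?thesis .
    qed
    have der: "cmod (deriv h z) \<le> A / (cmod b / 4)" if z: "z \<in> cball b (cmod b / 4)" for z
    proof -
      have sub: "cball z (cmod b / 4) \<subseteq> cball b (cmod b / 2)"
      proof
        fix u assume "u \<in> cball z (cmod b / 4)"
        then show "u \<in> cball b (cmod b / 2)" using z dist_triangle[of b u z] by simp
      qed
      have sub0: "cball z (cmod b / 4) \<subseteq> -{0}" using near_ball(1)[OF b0] sub by blast
      have "cmod ((deriv ^^ 1) h z) \<le> fact 1 * A / (cmod b / 4) ^ 1"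
      proof (rule Cauchy_inequality)
        show "h holomorphic_on ball z (cmod b / 4)" using hol sub0 ball_subset_cball holomorphic_on_subset by blast
        show "continuous_on (cball z (cmod b / 4)) h"
          using holomorphic_on_imp_continuous_on[OF holomorphic_on_subset[OF hol sub0]] .
        show "0 < cmod b / 4" using b0 by simp
        show "cmod (h u) \<le> A" if "cmod (z - u) = cmod b / 4" for u
        proof -
          have "u \<in> cball z (cmod b / 4)" using that by (simp add: dist_norm)
          then show ?thesis using sub by (intro hA) blast
        qed
      qed
      then show ?thesis by simp
    qed
    have "cmod (h b - h d) \<le> A / (cmod b / 4) * cmod (b - d)"
    proof (rule field_differentiable_bound[where S = "cball b (cmod b / 4)" and f' = "deriv h"])
      fix z assume z: "z \<in> cball b (cmod b / 4)"
      have "dist b z \<le> cmod b / 2" using z norm_ge_zero[of b] unfolding mem_cball by linarith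
      then have "z \<noteq> 0" using near_ball(1)[OF b0, of z] by simp
      then have "h field_differentiable (at z)" by (intro holomorphic_on_imp_differentiable_at[OF hol]) auto
      then show "(h has_field_derivative deriv h z) (at z within cball b (cmod b / 4))"
        by (rule has_field_derivative_at_within[OF DERIV_deriv_iff_field_differentiable[THEN iffD2]])
    qed (use der True in \<open>auto simp: dist_norm\<close>)
    moreover have "h d = 0" using basis(4)[OF b d] bd by (simp add: h(1))
    moreover have "1 \<le> cmod (h b)" using h(2)[OF b0] V_basis_self[OF b] by simp
    ultimately have "1 \<le> A / (cmod b / 4) * cmod (b - d)" by simp
    then have "cmod b \<le> 4 * A * cmod (b - d)" using b0 by (simp add: field_simps)
    then have "1 / (4 * A) * cmod b \<le> cmod (b - d)" using A by (simp add: field_simps)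
    moreover have "k * cmod b \<le> 1 / (4 * A) * cmod b" by (intro mult_right_mono) (auto simp: k_def)
    ultimately show ?thesis by linarith
  qed
  have "k * max (cmod b) (cmod d) \<le> cmod (b - d)" if "b \<in> \<Lambda>" "d \<in> \<Lambda>" "b \<noteq> d" for b d
    using main[OF that] main[OF that(2,1)] that(3) by (auto simp: max_def norm_minus_commute)
  then show ?thesis using k that by blast
qed

text \<open>Division by \<open>rad t\<close> maps every unit annulus into the same compact set, and
  separation, being invariant under scaling, allows at most one node per small ball of a finite
  cover.\<close>

lemma window_bounded_\<Lambda>: obtains K where "window_bounded \<Lambda> lx K"
proof -
  obtain k where k: "k > 0" "\<And>b d. b \<in> \<Lambda> \<Longrightarrow> d \<in> \<Lambda> \<Longrightarrow> b \<noteq> d \<Longrightarrow> k * max (cmod b) (cmod d) \<le> cmod (b - d)"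
    by (rule separated) (rule that; blast)
  define S where "S = cball (0::complex) (exp (1 / (2 * \<alpha>))) - ball 0 1"
  have "compact S" unfolding S_def by (intro compact_diff) auto
  then obtain T where T: "finite T" "S \<subseteq> (\<Union>u\<in>T. ball u (k / 2))"
    using k(1) unfolding compact_eq_totally_bounded by (meson half_gt_zero)
  have "finite {b\<in>\<Lambda>. t \<le> lx b \<and> lx b \<le> t + 1} \<and> card {b\<in>\<Lambda>. t \<le> lx b \<and> lx b \<le> t + 1} \<le> card T" for t
  proof -
    define W where "W = {b\<in>\<Lambda>. t \<le> lx b \<and> lx b \<le> t + 1}"
    have W: "rad t \<le> cmod b" "cmod b \<le> rad t * exp (1 / (2 * \<alpha>))" if "b \<in> W" for b
    proof -
      have b: "cmod b = rad (lx b)" using norm_eq_rad nz that by (auto simp: W_def)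
      show "rad t \<le> cmod b" unfolding b using that alpha by (simp add: W_def rad_def divide_right_mono)
      have "cmod b \<le> rad (t + 1)" unfolding b using that alpha by (simp add: W_def rad_def divide_right_mono)
      then show "cmod b \<le> rad t * exp (1 / (2 * \<alpha>))" by (simp add: rad_add_1)
    qed
    have "\<exists>u\<in>T. b / of_real (rad t) \<in> ball u (k / 2)" if "b \<in> W" for b
    proof -
      have "b / of_real (rad t) \<in> S"
        using W[OF that] by (simp add: S_def norm_divide abs_of_pos[OF rad_pos] pos_divide_le_eq pos_divide_less_eq not_less mult.commute)
      then show ?thesis using T(2) by blast
    qed
    then obtain u where u: "\<And>b. b \<in> W \<Longrightarrow> u b \<in> T" "\<And>b. b \<in> W \<Longrightarrow> b / of_real (rad t) \<in> ball (u b) (k / 2)" by metis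
    have inj: "inj_on u W"
    proof (rule inj_onI, rule ccontr)
      fix b d assume bd: "b \<in> W" "d \<in> W" "u b = u d" "b \<noteq> d"
      have "dist (b / of_real (rad t)) (d / of_real (rad t)) < k"
        by (rule dist_triangle_half_r[of "u b"]) (use u(2)[OF bd(1)] u(2)[OF bd(2)] bd(3) in simp_all)
      then have "cmod (b - d) < k * rad t"
        by (simp add: dist_norm diff_divide_distrib[symmetric] norm_divide pos_divide_less_eq abs_of_pos[OF rad_pos])
      moreover have "k * rad t \<le> k * max (cmod b) (cmod d)"
        using W(1)[OF bd(1)] k(1) by (intro mult_left_mono) auto
      moreover have "k * max (cmod b) (cmod d) \<le> cmod (b - d)"
        using bd by (intro k(2)) (auto simp: W_def)
      ultimately show False by linarith
    qed
    have "u ` W \<subseteq> T" using u(1) by auto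
    then show ?thesis
      using T(1) inj unfolding W_def[symmetric] by (auto intro: inj_on_finite card_inj_on_le)
  qed
  then show ?thesis using that[of "card T"] by (simp add: window_bounded_def)
qed

text \<open>Testing the lower bound of the restriction operator on normalised monomials shows that
  every long annulus contains a point of \<open>\<Lambda>\<close>.\<close>

lemma relatively_dense: obtains X where "\<And>n::int. \<exists>b\<in>\<Lambda>. \<bar>lx b - of_int n\<bar> \<le> X"
proof -
  obtain K where K: "window_bounded \<Lambda> lx K" by (rule window_bounded_\<Lambda>)
  obtain C where C: "C > 0" "\<And>f. f \<in> fock_space \<alpha> p \<Longrightarrow> fock_norm \<alpha> p f \<le> ennreal C * lp_norm p \<Lambda> (R f)"
    by (rule R_inverse_bound) (rule that; blast)
  obtain C' where C': "C' > 0" "\<And>f w. f holomorphic_on -{0} \<Longrightarrow> w \<noteq> 0 \<Longrightarrow> ennreal (V f w) \<le> ennreal C' * fock_norm \<alpha> p f"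
    by (rule V_le_fock_norm) blast
  \<comment> \<open>Half the constant of the Gaussian:
    \<open>y^2 / (4 * \<alpha>) \<ge> s * X + s * y\<close> once \<open>y \<ge> X \<ge> 1\<close>,
    the first part giving smallness, the second summability.\<close>
  define s where "s = 1 / (8 * \<alpha>)"
  have s: "s > 0" using alpha by (simp add: s_def)
  have "\<exists>D>0. \<forall>x. lp_norm p \<Lambda> (\<lambda>b. of_real (exp (- s * \<bar>lx b - x\<bar>))) \<le> ennreal D"
  proof (cases "p = \<infinity>")
    case True
    show ?thesis unfolding True lp_norm_infty_le_iff using s by (intro exI[of _ 1]) (auto intro!: ennreal_leI)
  next
    case False
    define q where "q = enn2real p"
    have q: "q > 0" using q_pos[OF False] by (simp add: q_def)
    have qs: "q * s > 0" using q s by simp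
    obtain D where D: "D > 0" "exp_sum_bound (q * s) K \<le> D powr q"
      unfolding q_def using powr_cancel_const[OF False, of "exp_sum_bound (q * s) K"] exp_sum_bound_nonneg[OF qs]
      unfolding q_def by blast
    have "lp_norm p \<Lambda> (\<lambda>b. of_real (exp (- s * \<bar>lx b - x\<bar>))) \<le> ennreal D" for x
      unfolding lp_norm_def
    proof (subst Lp_norm_le_iff[OF p False], fold q_def)
      have "(\<integral>\<^sup>+b. ennreal (cmod (of_real (exp (- s * \<bar>lx b - x\<bar>))) powr q) \<partial>count_space \<Lambda>)
          = (\<integral>\<^sup>+b. ennreal (exp (- (q * s) * \<bar>lx b - x\<bar>)) \<partial>count_space \<Lambda>)"
        by (intro nn_integral_cong) (simp add: exp_powr_real mult_ac)
      also have "\<dots> \<le> ennreal (exp_sum_bound (q * s) K)" by (rule exp_nn_integral_le[OF K qs])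
      also have "\<dots> \<le> ennreal (D powr q)" by (rule ennreal_leI[OF D(2)])
      finally show "(\<integral>\<^sup>+b. ennreal (cmod (of_real (exp (- s * \<bar>lx b - x\<bar>))) powr q) \<partial>count_space \<Lambda>) \<le> ennreal (D powr q)" .
    qed (use D in auto)
    then show ?thesis using D(1) by blast
  qed
  then obtain D where D: "D > 0" "\<And>x. lp_norm p \<Lambda> (\<lambda>b. of_real (exp (- s * \<bar>lx b - x\<bar>))) \<le> ennreal D" by blast
  \<comment> \<open>Chosen so that \<open>exp (s * X)\<close> exceeds \<open>C' * C * D\<close>,
    which contradicts the lower bound of the restriction operator.\<close>
  define X where "X = max 1 ((1 + C' * C * D) / s)"
  have "\<exists>b\<in>\<Lambda>. \<bar>lx b - of_int n\<bar> \<le> X" for n :: int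
  proof (rule ccontr)
    assume no: "\<not> ?thesis"
    obtain f where f: "f \<in> fock_space \<alpha> p" "\<And>z. z \<noteq> 0 \<Longrightarrow> V f z = exp (- ((lx z - of_int n)\<^sup>2 / (4 * \<alpha>)))"
      using monomial_in_fock by blast
    define d where "d = exp (- s * X)"
    define e where "e = (\<lambda>b. of_real (exp (- s * \<bar>lx b - of_int n\<bar>)) :: complex)"
    have le: "cmod (R f b) \<le> d * cmod (e b)" if b: "b \<in> \<Lambda>" for b
    proof -
      define y where "y = \<bar>lx b - of_int n\<bar>"
      have y: "X < y" "1 \<le> X" using no b by (auto simp: y_def X_def not_le)
      have "X * 1 \<le> y * y" "1 * y \<le> y * y" using y by (intro mult_mono; simp)+
      then have "s * (X + y) \<le> s * (2 * (y * y))" using s by (intro mult_left_mono) auto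
      also have "s * (2 * (y * y)) = (lx b - of_int n)\<^sup>2 / (4 * \<alpha>)" by (simp add: s_def y_def power2_eq_square)
      finally have "exp (- ((lx b - of_int n)\<^sup>2 / (4 * \<alpha>))) \<le> d * exp (- s * y)"
        unfolding d_def exp_add[symmetric] by (simp add: algebra_simps)
      then show ?thesis using f(2)[OF nz[OF b]] b by (simp add: norm_restriction_op e_def y_def)
    qed
    have "lp_norm p \<Lambda> (R f) \<le> ennreal d * lp_norm p \<Lambda> e"
    proof (cases "p = \<infinity>")
      case True
      show ?thesis unfolding True lp_norm_infty_le_iff
      proof
        fix b assume b: "b \<in> \<Lambda>"
        have "ennreal (cmod (R f b)) \<le> ennreal d * ennreal (cmod (e b))"
          using le[OF b] by (simp add: d_def ennreal_mult[symmetric] ennreal_leI)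
        also have "\<dots> \<le> ennreal d * lp_norm \<infinity> \<Lambda> e" using norm_le_lp_norm[of \<infinity> b \<Lambda> e] b by (intro mult_left_mono) auto
        finally show "ennreal (cmod (restriction_op \<Lambda> \<alpha> \<infinity> f b)) \<le> ennreal d * lp_norm \<infinity> \<Lambda> e" using True by simp
      qed
    next
      case False
      show ?thesis unfolding lp_norm_def
      proof (rule Lp_norm_le_multI[OF p False])
        have "(\<integral>\<^sup>+b. ennreal (cmod (R f b) powr enn2real p) \<partial>count_space \<Lambda>)
            \<le> (\<integral>\<^sup>+b. ennreal (d powr enn2real p) * ennreal (cmod (e b) powr enn2real p) \<partial>count_space \<Lambda>)"
        proof (intro nn_integral_mono)
          fix b assume "b \<in> space (count_space \<Lambda>)"
          then have "cmod (R f b) powr enn2real p \<le> (d * cmod (e b)) powr enn2real p"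
            using le q_pos[OF False] by (intro powr_mono2) auto
          then show "ennreal (cmod (R f b) powr enn2real p) \<le> ennreal (d powr enn2real p) * ennreal (cmod (e b) powr enn2real p)"
            by (simp add: powr_mult ennreal_mult[symmetric] ennreal_leI)
        qed
        also have "\<dots> = ennreal (d powr enn2real p) * (\<integral>\<^sup>+b. ennreal (cmod (e b) powr enn2real p) \<partial>count_space \<Lambda>)"
          by (rule nn_integral_cmult) simp
        finally show "(\<integral>\<^sup>+b. ennreal (cmod (R f b) powr enn2real p) \<partial>count_space \<Lambda>)
            \<le> ennreal (d powr enn2real p) * (\<integral>\<^sup>+b. ennreal (cmod (e b) powr enn2real p) \<partial>count_space \<Lambda>)" .
      qed (simp add: d_def)
    qed
    also have "\<dots> \<le> ennreal d * ennreal D" unfolding e_def by (intro mult_left_mono D(2)) auto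
    finally have R: "lp_norm p \<Lambda> (R f) \<le> ennreal d * ennreal D" .
    define w where "w = complex_of_real (rad (of_int n))"
    have w: "w \<noteq> 0" "lx w = of_int n" by (auto simp: w_def abs_of_pos[OF rad_pos] intro!: lx_eqI)
    have "ennreal (V f w) \<le> ennreal C' * fock_norm \<alpha> p f" by (rule C'(2)[OF fock_spaceD(1)[OF f(1)] w(1)])
    also have "\<dots> \<le> ennreal C' * (ennreal C * (ennreal d * ennreal D))"
      by (rule mult_left_mono[OF order_trans[OF C(2)[OF f(1)] mult_left_mono[OF R]]]) auto
    also have "\<dots> = ennreal (C' * (C * (d * D)))" using C'(1) C(1) D(1) by (simp add: ennreal_mult d_def)
    finally have "1 \<le> C' * (C * (d * D))"
      using C'(1) C(1) D(1) f(2)[OF w(1)] w(2) by (simp add: d_def)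
    then have "exp (s * X) * 1 \<le> exp (s * X) * (C' * (C * (d * D)))" by (intro mult_left_mono) auto
    also have "\<dots> = (exp (s * X) * d) * (C' * C * D)" by simp
    also have "exp (s * X) * d = 1" by (simp add: d_def exp_add[symmetric])
    finally have "exp (s * X) \<le> C' * C * D" by simp
    moreover have "(1 + C' * C * D) / s \<le> X" by (simp add: X_def)
    then have "1 + C' * C * D \<le> s * X" using s by (simp add: pos_divide_le_eq mult.commute)
    ultimately show False using exp_ge_add_one_self[of "s * X"] by linarith
  qed
  then show ?thesis by (rule that)
qed

text \<open>Relative density makes both parts of \<open>\<Lambda>\<close>, split at
  \<open>lx = 0\<close>, infinite; bounded density lets each be listed monotonically, one towards
  infinity and one towards the origin.\<close>

lemma enumeration:
  obtains l :: "int \<Rightarrow> complex" where "bij_betw l UNIV \<Lambda>" "\<And>k. cmod (l k) \<le> cmod (l (k + 1))"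
proof -
  obtain K where K: "window_bounded \<Lambda> lx K" by (rule window_bounded_\<Lambda>)
  obtain X where X: "\<And>n::int. \<exists>b\<in>\<Lambda>. \<bar>lx b - of_int n\<bar> \<le> X" by (rule relatively_dense) (rule that; blast)
  define S1 where "S1 = {b\<in>\<Lambda>. 0 \<le> lx b}"
  define S2 where "S2 = {b\<in>\<Lambda>. lx b < 0}"
  have f1: "finite {b\<in>S1. lx b \<le> r}" for r
    by (rule finite_subset[OF _ window_bounded_near(1)[OF K, of 0 r]]) (auto simp: S1_def)
  have f2: "finite {b\<in>S2. - lx b \<le> r}" for r
    by (rule finite_subset[OF _ window_bounded_near(1)[OF K, of 0 r]]) (auto simp: S2_def)
  have i1: "infinite S1"
  proof
    assume fin: "finite S1"
    define r where "r = Max (insert 0 (lx ` S1))"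
    obtain b where b: "b \<in> \<Lambda>" "\<bar>lx b - of_int \<lceil>\<bar>X\<bar> + r + 1\<rceil>\<bar> \<le> X" using X by blast
    have r0: "0 \<le> r" unfolding r_def using fin by (intro Max_ge) auto
    have "lx b \<ge> r + 1" using b(2) by linarith
    then have "b \<in> S1" using r0 b by (simp add: S1_def)
    then have "lx b \<le> r" unfolding r_def using fin by (intro Max_ge) auto
    then show False using \<open>lx b \<ge> r + 1\<close> by simp
  qed
  have i2: "infinite S2"
  proof
    assume fin: "finite S2"
    define r where "r = Max (insert 0 ((\<lambda>b. - lx b) ` S2))"
    obtain b where b: "b \<in> \<Lambda>" "\<bar>lx b - of_int (- \<lceil>\<bar>X\<bar> + r + 1\<rceil>)\<bar> \<le> X" using X by blast
    have r0: "0 \<le> r" unfolding r_def using fin by (intro Max_ge) auto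
    have "- lx b \<ge> r + 1" using b(2) by linarith
    then have "b \<in> S2" using r0 b by (simp add: S2_def)
    then have "- lx b \<le> r" unfolding r_def using fin by (intro Max_ge) auto
    then show False using \<open>- lx b \<ge> r + 1\<close> by simp
  qed
  obtain e1 where e1: "bij_betw e1 UNIV S1" "\<And>n. lx (e1 n) \<le> lx (e1 (Suc n))"
    by (rule exists_mono_enumeration[OF i1 f1]) (erule that, assumption)
  obtain e2 where e2: "bij_betw e2 UNIV S2" "\<And>n. - lx (e2 n) \<le> - lx (e2 (Suc n))"
    by (rule exists_mono_enumeration[OF i2 f2]) (erule that, assumption)
  define l where "l = (\<lambda>k::int. if 0 \<le> k then e1 (nat k) else e2 (nat (- k - 1)))"
  have m1: "e1 n \<in> S1" and m2: "e2 n \<in> S2" for n using e1(1) e2(1) by (auto simp: bij_betw_def)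
  have "bij_betw l ({0..} \<union> {..<0}) (S1 \<union> S2)"
  proof (rule bij_betw_combine)
    have "bij_betw (e1 \<circ> nat) {0..} S1"
      by (rule bij_betw_trans[OF _ e1(1)]) (rule bij_betwI[where g = int], auto)
    then show "bij_betw l {0..} S1" by (rule bij_betw_cong[THEN iffD1, rotated]) (auto simp: l_def)
    have "bij_betw (e2 \<circ> (\<lambda>k. nat (- k - 1))) {..<0} S2"
      by (rule bij_betw_trans[OF _ e2(1)]) (rule bij_betwI[where g = "\<lambda>n. - int n - 1"], auto)
    then show "bij_betw l {..<0} S2" by (rule bij_betw_cong[THEN iffD1, rotated]) (auto simp: l_def)
    show "S1 \<inter> S2 = {}" by (auto simp: S1_def S2_def)
  qed
  moreover have "{0..} \<union> {..<0} = (UNIV :: int set)" "S1 \<union> S2 = \<Lambda>" by (auto simp: S1_def S2_def)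
  ultimately have bij: "bij_betw l UNIV \<Lambda>" by simp
  have "cmod (l k) \<le> cmod (l (k + 1))" for k
  proof -
    have lk: "l j \<noteq> 0" for j using bij nz by (auto simp: bij_betw_def)
    have "lx (l k) \<le> lx (l (k + 1))"
    proof (cases "0 \<le> k")
      case True
      then show ?thesis using e1(2)[of "nat k"] by (simp add: l_def nat_add_distrib)
    next
      case False
      show ?thesis
      proof (cases "k = -1")
        case True
        then show ?thesis using m1[of 0] m2[of 0] by (simp add: l_def S1_def S2_def)
      next
        case False
        then have "nat (- k - 1) = Suc (nat (- (k + 1) - 1))" using \<open>\<not> 0 \<le> k\<close> by auto
        then show ?thesis using e2(2)[of "nat (- (k + 1) - 1)"] \<open>\<not> 0 \<le> k\<close> False by (simp add: l_def)
      qed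
    qed
    then show ?thesis using norm_le_iff_lx[OF lk lk] by simp
  qed
  with bij show ?thesis by (rule that)
qed

end

text \<open>If the tails \<open>T k\<close> of the sum satisfy \<open>T (k - 1) = 1 + exp (w k) * T k \<le> C + 1\<close>, then
  \<open>exp (w k) * T k \<le> (1 - 1 / (C + 1)) * T (k - 1)\<close>, and iterating this gives geometric decay.\<close>

lemma exp_sums_decay:
  fixes w :: "int \<Rightarrow> real"
  assumes C: "\<And>k M. k \<le> M \<Longrightarrow> (\<Sum>m=k..M. exp (\<Sum>j=k+1..m. w j)) \<le> C"
  shows "\<exists>C' \<eta>. \<eta> > 0 \<and> (\<forall>k m. k \<le> m \<longrightarrow> (\<Sum>j=k+1..m. w j) \<le> C' - \<eta> * of_int (m - k))"
proof -
  have C1: "C \<ge> 1" using C[of 0 0] by simp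
  define \<rho> where "\<rho> = 1 - 1 / (C + 1)"
  have \<rho>: "0 < \<rho>" "\<rho> < 1" using C1 by (auto simp: \<rho>_def)
  define T where "T = (\<lambda>M k. \<Sum>m=k..M. exp (\<Sum>j=k+1..m. w j))"
  have T0: "T M k \<ge> 0" for M k unfolding T_def by (intro sum_nonneg) auto
  have Tstep: "T M (k - 1) = 1 + exp (w k) * T M k" if "k \<le> M" for M k
  proof -
    have s: "{k-1..M} = insert (k - 1) {k..M}" using that by auto
    have "T M (k - 1) = exp (\<Sum>j=k..k-1. w j) + (\<Sum>m=k..M. exp (\<Sum>j=k..m. w j))"
      unfolding T_def s by (subst sum.insert) auto
    also have "(\<Sum>m=k..M. exp (\<Sum>j=k..m. w j)) = (\<Sum>m=k..M. exp (w k) * exp (\<Sum>j=k+1..m. w j))"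
    proof (intro sum.cong refl)
      fix m assume m: "m \<in> {k..M}"
      then have s2: "{k..m} = insert k {k+1..m}" by auto
      show "exp (\<Sum>j=k..m. w j) = exp (w k) * exp (\<Sum>j=k+1..m. w j)"
        unfolding s2 by (subst sum.insert) (auto simp: exp_add)
    qed
    finally show ?thesis by (simp add: T_def sum_distrib_left)
  qed
  have main: "exp (\<Sum>j=k+1..M. w j) \<le> \<rho> ^ nat (M - k) * T M k" if "k \<le> M" for k M
    using that
  proof (induction k rule: int_le_induct)
    case base
    show ?case by (simp add: T_def)
  next
    case (step i)
    have s: "{i..M} = insert i {i+1..M}" using step.hyps by auto
    have "exp (\<Sum>j=i-1+1..M. w j) = exp (w i) * exp (\<Sum>j=i+1..M. w j)"
      using s by (simp add: exp_add)
    also have "\<dots> \<le> exp (w i) * (\<rho> ^ nat (M - i) * T M i)" using step.IH by (intro mult_left_mono) auto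
    also have "\<dots> = \<rho> ^ nat (M - i) * (exp (w i) * T M i)" by simp
    also have "\<dots> \<le> \<rho> ^ nat (M - i) * (\<rho> * T M (i - 1))"
    proof (intro mult_left_mono)
      have "T M (i - 1) \<le> C + 1" using C[of "i - 1" M] step.hyps by (simp add: T_def)
      then have "T M (i - 1) / (C + 1) \<le> 1" using C1 by simp
      then show "exp (w i) * T M i \<le> \<rho> * T M (i - 1)"
        unfolding Tstep[OF step.hyps(1)] \<rho>_def by (simp add: algebra_simps add_divide_distrib)
    qed (use \<rho> in auto)
    also have "\<dots> = \<rho> ^ nat (M - (i - 1)) * T M (i - 1)"
    proof -
      have "nat (M - (i - 1)) = Suc (nat (M - i))" using step.hyps by simp
      then show ?thesis by simp
    qed
    finally show ?case .
  qed
  have "(\<Sum>j=k+1..m. w j) \<le> ln C - (- ln \<rho>) * of_int (m - k)" if km: "k \<le> m" for k m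
  proof -
    have "exp (\<Sum>j=k+1..m. w j) \<le> \<rho> ^ nat (m - k) * T m k" by (rule main[OF km])
    also have "\<dots> \<le> \<rho> ^ nat (m - k) * C" using C[OF km] \<rho> by (intro mult_left_mono) (auto simp: T_def)
    also have "\<dots> = exp (ln C - (- ln \<rho>) * of_int (m - k))"
    proof -
      define n where "n = nat (m - k)"
      have n: "of_int (m - k) = real n" using km by (simp add: n_def)
      have "exp (ln C - (- ln \<rho>) * real n) = exp (ln C) * exp (ln \<rho>) ^ n"
        by (simp add: exp_add exp_of_nat_mult[symmetric] mult.commute)
      then show ?thesis unfolding n n_def[symmetric] using C1 \<rho> by simp
    qed
    finally show ?thesis by simp
  qed
  then show ?thesis using \<rho> by (intro exI[of _ "ln C"] exI[of _ "- ln \<rho>"]) auto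
qed

text \<open>The reflection \<open>j \<mapsto> 1 - j\<close> exchanges the two endpoints; the 1 keeps
  ranges of the form \<open>k + 1..m\<close>.\<close>

lemma exp_sums_decay_dual:
  fixes w :: "int \<Rightarrow> real"
  assumes C: "\<And>k M. k \<le> M \<Longrightarrow> (\<Sum>n=k..M. exp (\<Sum>j=n+1..M. w j)) \<le> C"
  shows "\<exists>C' \<eta>. \<eta> > 0 \<and> (\<forall>k m. k \<le> m \<longrightarrow> (\<Sum>j=k+1..m. w j) \<le> C' - \<eta> * of_int (m - k))"
proof -
  define w' where "w' = (\<lambda>j. w (1 - j))"
  have r: "(\<Sum>j=k+1..m. w' j) = (\<Sum>j=-m+1..-k. w j)" for k m
    unfolding w'_def
    by (rule sum.reindex_bij_witness[where i = "\<lambda>j. 1 - j" and j = "\<lambda>j. 1 - j"]) auto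
  have "(\<Sum>m=k..M. exp (\<Sum>j=k+1..m. w' j)) \<le> C" if "k \<le> M" for k M
  proof -
    have "(\<Sum>m=k..M. exp (\<Sum>j=k+1..m. w' j)) = (\<Sum>n=-M..-k. exp (\<Sum>j=n+1..-k. w j))"
      unfolding r by (rule sum.reindex_bij_witness[where i = "\<lambda>j. - j" and j = "\<lambda>j. - j"]) auto
    also have "\<dots> \<le> C" using that by (intro C) auto
    finally show ?thesis .
  qed
  then obtain C' \<eta> where *: "\<eta> > 0" "\<And>k m. k \<le> m \<Longrightarrow> (\<Sum>j=k+1..m. w' j) \<le> C' - \<eta> * of_int (m - k)"
    using exp_sums_decay[of w' C] by blast
  have "(\<Sum>j=k+1..m. w j) \<le> C' - \<eta> * of_int (m - k)" if "k \<le> m" for k m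
    using *(2)[of "- m" "- k"] r[of "- m" "- k"] that by simp
  then show ?thesis using *(1) by blast
qed

section \<open>Finding the right numbering\<close>

locale complete_interp_enum = complete_interp \<alpha> p \<Lambda> + interp \<alpha> p l K \<kappa> for \<alpha> p \<Lambda> l K \<kappa> +
  assumes range_l: "range l = \<Lambda>"
begin

text \<open>The power \<open>j\<close> is kept free because the indexing of \<open>l\<close> is so
  far arbitrary up to a shift; \<open>g n\<close> is a multiple of \<open>Q n n\<close>.\<close>

definition Q :: "int \<Rightarrow> int \<Rightarrow> complex \<Rightarrow> complex" where
  "Q n j z = (if z = 0 then 0 else z powi j * P n z)"

lemma l_in: "l k \<in> \<Lambda>" using range_l by auto

lemma holomorphic_Q: "Q n j holomorphic_on -{0}"
  by (rule holomorphic_transform[of "\<lambda>z. z powi j * P n z"])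
     (auto simp: Q_def intro!: holomorphic_intros holomorphic_P)

lemma wt_cong: "z \<noteq> 0 \<Longrightarrow> w \<noteq> 0 \<Longrightarrow> lx z = lx w \<Longrightarrow> wt z = wt w"
  by (simp add: wt_eq_lx)

lemma gap_circle:
  fixes m :: int
  obtains y where "of_int m \<le> y" "y \<le> of_int m + 1" "\<And>j. \<eta> \<le> \<bar>y - x j\<bar>"
  using exists_gap[of "of_int m"] by blast

definition circle_const :: real where "circle_const = exp (2 * E + 2 * low_const \<rho> * E)"

lemma V_Q_circle:
  assumes "z \<noteq> 0" "w \<noteq> 0" "lx z = lx w" "\<And>j. \<eta> \<le> \<bar>lx w - x j\<bar>"
  shows "V (Q n j) z \<le> circle_const * V (Q n j) w"
proof -
  have nz: "cmod z = cmod w" using norm_eq_lx assms by metis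
  have "cmod (P n z) \<le> circle_const * cmod (P n w)" unfolding circle_const_def
    by (rule P_circle_compare[OF good_gap(1)[OF assms(2,4)] assms(1,3)])
  then have "cmod z powi j * wt z * cmod (P n z) \<le> cmod z powi j * wt z * (circle_const * cmod (P n w))"
    using wt_pos[OF assms(1)] by (intro mult_left_mono) auto
  then show ?thesis
    using assms(1,2) wt_cong[OF assms(1-3)] by (simp add: V_def Q_def norm_mult norm_power_int nz mult_ac)
qed

text \<open>The dual function at \<open>l 0\<close> is \<open>P 0\<close> times a Laurent function, whose modulus is at least a
  constant times a fixed monomial somewhere on every circle, while \<open>P 0\<close> has essentially constant
  modulus on the circles that avoid the zeros. So \<open>P 0\<close> times that monomial is in the space.\<close>

lemma exists_Q_0_in_fock: "\<exists>j. Q 0 j \<in> fock_space \<alpha> p"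
proof -
  define f where "f = basis (l 0)"
  have f: "f \<in> fock_space \<alpha> p" "f (l 0) * of_real (wt (l 0)) = 1" "\<And>m. m \<noteq> 0 \<Longrightarrow> f (l m) = 0"
    unfolding f_def using basis[OF l_in[of 0]] l_in inj_l by (auto simp: inj_eq)
  have fh: "f holomorphic_on -{0}" by (rule fock_spaceD(1)[OF f(1)])
  obtain h where h: "h holomorphic_on -{0}" "\<And>z. z \<noteq> 0 \<Longrightarrow> (z - l 0) * f z = G 0 z * h z"
  proof (rule divide_by_G)
    show "(\<lambda>z. (z - l 0) * f z) holomorphic_on -{0}" by (intro holomorphic_intros fh)
    show "(l m - l 0) * f (l m) = 0" for m using f(3) by (cases "m = 0") auto
  qed blast
  \<comment> \<open>Otherwise \<open>f\<close> would be nonzero exactly at \<open>l 0\<close>,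
    although the set where it is nonzero is open.\<close>
  have "\<exists>z1. z1 \<noteq> 0 \<and> z1 \<noteq> l 0 \<and> f z1 \<noteq> 0"
  proof (rule ccontr)
    assume no: "\<not> ?thesis"
    have "open ((-{0}) \<inter> f -` (-{0}))"
      by (rule continuous_open_preimage[OF holomorphic_on_imp_continuous_on[OF fh]]) auto
    moreover have "(-{0}) \<inter> f -` (-{0}) = {l 0}" using no f(2) l0[of 0] by auto
    ultimately show False using not_open_singleton by metis
  qed
  then obtain z1 where z1: "z1 \<noteq> 0" "z1 \<noteq> l 0" "f z1 \<noteq> 0" by blast
  have "h z1 \<noteq> 0" using h(2)[OF z1(1)] z1 by auto
  then obtain j d where d: "d > 0" "\<And>r. r > 0 \<Longrightarrow> \<exists>z. cmod z = r \<and> d * r powi j \<le> cmod (h z)"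
    using laurent_lower_bound[OF h(1) z1(1)] by blast
  obtain C where C: "C > 0" "\<And>F f K. F holomorphic_on -{0} \<Longrightarrow> f holomorphic_on -{0} \<Longrightarrow> F 0 = 0 \<Longrightarrow> K > 0 \<Longrightarrow>
      (\<And>m::int. \<exists>w. w \<noteq> 0 \<and> of_int m \<le> lx w \<and> lx w \<le> of_int m + 1 \<and>
         (\<forall>z. z \<noteq> 0 \<longrightarrow> lx z = lx w \<longrightarrow> V F z \<le> K * V f w)) \<Longrightarrow>
      fock_norm \<alpha> p F \<le> ennreal (C * K) * fock_norm \<alpha> p f"
    by (rule fock_norm_le_of_circles) (rule that; blast)
  have Cd: "circle_const / d > 0" using d(1) by (simp add: circle_const_def)
  \<comment> \<open>The degree drops by one because \<open>f = P 0 * h / z\<close>.\<close>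
  have "fock_norm \<alpha> p (Q 0 (j - 1)) \<le> ennreal (C * (circle_const / d)) * fock_norm \<alpha> p f"
  proof (rule C(2)[OF holomorphic_Q fh _ Cd])
    fix m :: int
    obtain y where y: "of_int m \<le> y" "y \<le> of_int m + 1" "\<And>j. \<eta> \<le> \<bar>y - x j\<bar>" by (rule gap_circle) (rule that; blast)
    obtain w where w: "cmod w = rad y" "d * rad y powi j \<le> cmod (h w)" using d(2)[of "rad y"] by auto
    have w0: "w \<noteq> 0" using w(1) rad_nonzero[of y] by auto
    have lw: "lx w = y" using w(1) by (rule lx_eqI)
    have gap: "\<And>j. \<eta> \<le> \<bar>lx w - x j\<bar>" using y(3) lw by simp
    have wl: "w \<noteq> l 0" using gap[of 0] eta_pos by (auto simp: x_def)
    have "f w = P 0 w * h w / w"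
    proof -
      have "(w - l 0) * f w = (w - l 0) * (P 0 w * h w / w)"
        unfolding h(2)[OF w0] using w0 by (simp add: G_def field_simps)
      moreover have "w - l 0 \<noteq> 0" using wl by simp
      ultimately show ?thesis by (metis mult_left_cancel)
    qed
    then have Vf: "V f w = cmod (P 0 w) * cmod (h w) / cmod w * wt w" by (simp add: V_def norm_mult norm_divide)
    have "d * V (Q 0 (j - 1)) w = cmod (P 0 w) * (d * cmod w powi j) / cmod w * wt w"
      using w0 power_int_diff[of "cmod w" j 1] by (simp add: V_def Q_def norm_mult norm_power_int)
    also have "\<dots> \<le> cmod (P 0 w) * cmod (h w) / cmod w * wt w"
      using w wt_pos[OF w0] less_imp_le[OF rad_pos[of y]] by (intro mult_right_mono divide_right_mono mult_left_mono) auto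
    also have "\<dots> = V f w" by (rule Vf[symmetric])
    finally have le: "d * V (Q 0 (j - 1)) w \<le> V f w" .
    have "V (Q 0 (j - 1)) z \<le> circle_const / d * V f w" if z: "z \<noteq> 0" "lx z = lx w" for z
    proof -
      have "V (Q 0 (j - 1)) z \<le> circle_const * V (Q 0 (j - 1)) w" by (rule V_Q_circle[OF z(1) w0 z(2) gap])
      also have "\<dots> = circle_const / d * (d * V (Q 0 (j - 1)) w)" using d(1) by simp
      also have "\<dots> \<le> circle_const / d * V f w" using Cd le by (intro mult_left_mono) auto
      finally show ?thesis .
    qed
    then show "\<exists>w. w \<noteq> 0 \<and> of_int m \<le> lx w \<and> lx w \<le> of_int m + 1 \<and>
         (\<forall>z. z \<noteq> 0 \<longrightarrow> lx z = lx w \<longrightarrow> V (Q 0 (j - 1)) z \<le> circle_const / d * V f w)"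
      using w0 lw y by (intro exI[of _ w]) auto
  qed (simp add: Q_def)
  also have "\<dots> < \<infinity>" using fock_spaceD(3)[OF f(1)] by (simp add: ennreal_mult_less_top)
  finally have "Q 0 (j - 1) \<in> fock_space \<alpha> p" by (intro fock_spaceI holomorphic_Q) (auto simp: Q_def)
  then show ?thesis by blast
qed

text \<open>Since \<open>G 0\<close> is a multiple of \<open>G n\<close>, exchanging
  \<open>P 0\<close> for \<open>P n\<close> together with \<open>n\<close> further powers of
  \<open>z\<close> costs only a bounded factor on gap circles.\<close>

lemma Q_in_fock:
  assumes Q0: "Q 0 j \<in> fock_space \<alpha> p"
  shows "Q n (j + n) \<in> fock_space \<alpha> p"
proof -
  obtain C where C: "C > 0" "\<And>F f K. F holomorphic_on -{0} \<Longrightarrow> f holomorphic_on -{0} \<Longrightarrow> F 0 = 0 \<Longrightarrow> K > 0 \<Longrightarrow>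
      (\<And>m::int. \<exists>w. w \<noteq> 0 \<and> of_int m \<le> lx w \<and> lx w \<le> of_int m + 1 \<and>
         (\<forall>z. z \<noteq> 0 \<longrightarrow> lx z = lx w \<longrightarrow> V F z \<le> K * V f w)) \<Longrightarrow>
      fock_norm \<alpha> p F \<le> ennreal (C * K) * fock_norm \<alpha> p f"
    by (rule fock_norm_le_of_circles) (rule that; blast)
  obtain d where d: "d \<noteq> 0" "\<And>z. z \<noteq> 0 \<Longrightarrow> G 0 z = d * G n z" using G_eq_mult by blast
  define k where "k = (1 + cmod (l 0 / l n)) / (\<rho> * cmod d)"
  have k: "k > 0" using rho_pos d(1) by (simp add: k_def add_pos_nonneg)
  have kc: "k * circle_const > 0" using k by (simp add: circle_const_def)
  have "fock_norm \<alpha> p (Q n (j + n)) \<le> ennreal (C * (k * circle_const)) * fock_norm \<alpha> p (Q 0 j)"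
  proof (rule C(2)[OF holomorphic_Q holomorphic_Q _ kc])
    fix m :: int
    obtain y where y: "of_int m \<le> y" "y \<le> of_int m + 1" "\<And>j. \<eta> \<le> \<bar>y - x j\<bar>" by (rule gap_circle) (rule that; blast)
    define w where "w = complex_of_real (rad y)"
    have w0: "w \<noteq> 0" by (simp add: w_def)
    have lw: "lx w = y" by (rule lx_eqI) (simp add: w_def abs_of_pos[OF rad_pos])
    have "V (Q n (j + n)) z \<le> (k * circle_const) * V (Q 0 j) w" if z: "z \<noteq> 0" "lx z = lx w" for z
    proof -
      have gap: "\<And>j. \<eta> \<le> \<bar>lx z - x j\<bar>" using y(3) lw z by simp
      define M where "M = max 1 (cmod (l n / z))"
      have M: "M > 0" by (simp add: M_def less_max_iff_disj)
      \<comment> \<open>Index \<open>n + 1\<close> is the exempt one, so that \<open>l n\<close> is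
        covered.\<close>
      have a1: "\<rho> * M \<le> cmod (1 - l n / z)"
        unfolding M_def by (rule good_quot(2)[OF good_gap(1)[OF z(1) gap, of "n + 1"]]) simp
      have a2: "cmod (1 - l 0 / z) \<le> (1 + cmod (l 0 / l n)) * M"
      proof -
        have "cmod (1 - l 0 / z) \<le> 1 + cmod (l 0 / z)" using norm_triangle_ineq4[of 1 "l 0 / z"] by simp
        also have "cmod (l 0 / z) = cmod (l 0 / l n) * cmod (l n / z)" using l0[of n] by (simp add: norm_mult[symmetric])
        also have "1 + cmod (l 0 / l n) * cmod (l n / z) \<le> M + cmod (l 0 / l n) * M"
          by (intro add_mono mult_left_mono) (auto simp: M_def)
        finally show ?thesis by (simp add: algebra_simps)
      qed
      have eq: "(1 - l 0 / z) * P 0 z = d * (z powi n * ((1 - l n / z) * P n z))"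
        using d(2)[OF z(1)] by (simp add: G_def)
      have "cmod d * (\<rho> * M) * cmod (z powi n * P n z) \<le> cmod d * cmod (1 - l n / z) * cmod (z powi n * P n z)"
        using a1 by (intro mult_left_mono mult_right_mono) auto
      also have "\<dots> = cmod (1 - l 0 / z) * cmod (P 0 z)"
        using arg_cong[OF eq, of cmod] by (simp add: norm_mult mult_ac)
      also have "\<dots> \<le> (1 + cmod (l 0 / l n)) * M * cmod (P 0 z)" using a2 by (intro mult_right_mono) auto
      finally have "cmod d * \<rho> * cmod (z powi n * P n z) * M \<le> (1 + cmod (l 0 / l n)) * cmod (P 0 z) * M"
        by (simp add: mult_ac)
      then have "cmod d * \<rho> * cmod (z powi n * P n z) \<le> (1 + cmod (l 0 / l n)) * cmod (P 0 z)"
        using M by (rule mult_right_le_imp_le)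
      then have "cmod (z powi n * P n z) \<le> k * cmod (P 0 z)"
        using d(1) rho_pos unfolding k_def by (simp add: field_simps)
      then have "cmod z powi j * wt z * cmod (z powi n * P n z) \<le> cmod z powi j * wt z * (k * cmod (P 0 z))"
        using wt_pos[OF z(1)] by (intro mult_left_mono) auto
      then have "V (Q n (j + n)) z \<le> k * V (Q 0 j) z"
        using z(1) by (simp add: V_def Q_def norm_mult norm_power_int power_int_add mult_ac)
      also have "\<dots> \<le> k * (circle_const * V (Q 0 j) w)"
        using k V_Q_circle[OF z(1) w0 z(2), of 0 j] y(3) lw by (intro mult_left_mono) auto
      finally show ?thesis by (simp add: mult.assoc)
    qed
    then show "\<exists>w. w \<noteq> 0 \<and> of_int m \<le> lx w \<and> lx w \<le> of_int m + 1 \<and>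
         (\<forall>z. z \<noteq> 0 \<longrightarrow> lx z = lx w \<longrightarrow> V (Q n (j + n)) z \<le> (k * circle_const) * V (Q 0 j) w)"
      using w0 lw y by (intro exI[of _ w]) auto
  qed (simp add: Q_def)
  also have "\<dots> < \<infinity>" using fock_spaceD(3)[OF Q0] by (simp add: ennreal_mult_less_top)
  finally show ?thesis by (intro fock_spaceI holomorphic_Q) (auto simp: Q_def)
qed

end

section \<open>Decay of the dual functions\<close>

text \<open>\<open>base\<close> fixes the shift of the enumeration: with it every \<open>g k\<close>
  lies in the space and can be compared with a dual function.\<close>

locale complete_interp_normalized = complete_interp_enum +
  assumes base: "Q 0 0 \<in> fock_space \<alpha> p"
begin

lemma g_in_fock: "g k \<in> fock_space \<alpha> p"
proof -
  have "g k = (\<lambda>z. inverse (l k powi k * P k (l k)) * Q k k z)"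
    by (rule ext) (simp add: g_def Q_def power_int_divide_distrib field_simps)
  then show ?thesis using fock_space_cmult[OF Q_in_fock[OF base, of k]] by simp
qed

lemma V_g_basis: "V (g k) z = wt (l k) * V (basis (l k)) z"
proof -
  have "g k z = g k (l k) * of_real (wt (l k)) * basis (l k) z"
  proof (rule unique_multiple[OF g_in_fock l_in])
    fix u assume "u \<in> \<Lambda>" "u \<noteq> l k"
    then obtain i where "u = l i" "i \<noteq> k" using range_l by auto
    then show "g k u = 0" using g_other[of i k] by simp
  qed
  then show ?thesis using wt_pos[OF l0[of k]] by (simp add: V_def g_self norm_mult)
qed

definition lower_const :: real where "lower_const = exp (- 2 * low_const \<rho> * E - 2 * E)"

lemma V_basis_lower:
  assumes "wt (l k) * (lower_const * exp (a * e)) \<le> V (g k) z"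
  shows "lower_const * exp (a * e) \<le> V (basis (l k)) z"
  using assms wt_pos[OF l0[of k]] unfolding V_g_basis by (rule mult_left_le_imp_le)

text \<open>At distance \<open>t\<close> from \<open>x k\<close> the dual function of
  \<open>l k\<close> has weighted modulus at least a constant times
  \<open>exp (a * (- \<delta> k * t - t^2 / 2))\<close>, and at most \<open>M\<close>. Gap circles
  with \<open>1 \<le> |t| \<le> 2\<close> on either side of \<open>l k\<close> then bound
  \<open>\<delta> k\<close> from above and below.\<close>

lemma delta_bounded: obtains D where "\<And>k. \<bar>\<delta> k\<bar> \<le> D"
proof -
  obtain M where M: "M > 0" "\<And>b z. b \<in> \<Lambda> \<Longrightarrow> z \<noteq> 0 \<Longrightarrow> V (basis b) z \<le> M"
    by (rule basis_V_bound) (rule that; blast)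
  define L where "L = max 0 (ln (M / lower_const) / a)"
  have lower_const: "lower_const > 0" by (simp add: lower_const_def)
  have key: "- \<delta> k * t - t\<^sup>2 / 2 \<le> L" if gap: "\<And>j. \<eta> \<le> \<bar>(x k + t) - x j\<bar>" for k t
  proof -
    define z where "z = complex_of_real (rad (x k + t))"
    have z: "z \<noteq> 0" by (simp add: z_def)
    have lz: "lx z = x k + t" by (rule lx_eqI) (simp add: z_def abs_of_pos[OF rad_pos])
    have gd: "good k \<rho> z" by (rule good_gap(1)[OF z]) (simp add: lz gap)
    have "wt (l k) * (lower_const * exp (a * (- \<delta> k * t - t\<^sup>2 / 2))) \<le> V (g k) z"
      unfolding lower_const_def
      by (rule V_g_lower[OF z P_lower_right[OF gd order_refl]])
         (simp add: lz \<delta>_def power2_eq_square field_simps)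
    then have "lower_const * exp (a * (- \<delta> k * t - t\<^sup>2 / 2)) \<le> M"
      using V_basis_lower M(2)[OF l_in z] order_trans by blast
    then have "exp (a * (- \<delta> k * t - t\<^sup>2 / 2)) \<le> M / lower_const" using lower_const by (simp add: pos_le_divide_eq mult.commute)
    also have "M / lower_const = exp (ln (M / lower_const))" using M(1) lower_const by simp
    finally have "a * (- \<delta> k * t - t\<^sup>2 / 2) \<le> ln (M / lower_const)" by simp
    then have "- \<delta> k * t - t\<^sup>2 / 2 \<le> ln (M / lower_const) / a" using a_pos by (simp add: pos_le_divide_eq mult.commute)
    then show ?thesis by (simp add: L_def)
  qed
  \<comment> \<open>The 2 bounds \<open>t^2 / 2\<close> for \<open>|t| \<le> 2\<close>;
    \<open>|t| \<ge> 1\<close> lets the factor \<open>t\<close> be dropped.\<close>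
  have "\<bar>\<delta> k\<bar> \<le> L + 2" for k
  proof -
    have L0: "L \<ge> 0" by (simp add: L_def)
    have sq: "t\<^sup>2 \<le> 4" if "\<bar>t\<bar> \<le> 2" for t :: real using power_mono[OF that, of 2] by simp
    obtain y where y: "x k + 1 \<le> y" "y \<le> x k + 1 + 1" "\<And>j. \<eta> \<le> \<bar>y - x j\<bar>" using exists_gap by blast
    obtain y' where y': "x k - 2 \<le> y'" "y' \<le> x k - 2 + 1" "\<And>j. \<eta> \<le> \<bar>y' - x j\<bar>" using exists_gap by blast
    have "- \<delta> k * (y - x k) \<le> L + 2" using key[of k "y - x k"] y sq[of "y - x k"] by simp
    moreover have "- \<delta> k \<le> - \<delta> k * (y - x k)" if "\<delta> k \<le> 0"
      using mult_left_mono[of 1 "y - x k" "- \<delta> k"] that y by simp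
    ultimately have 1: "- \<delta> k \<le> L + 2" using L0 by (cases "\<delta> k \<le> 0") auto
    have "\<delta> k * (x k - y') \<le> L + 2"
      using key[of k "y' - x k"] y' sq[of "y' - x k"] by (simp add: right_diff_distrib)
    moreover have "\<delta> k \<le> \<delta> k * (x k - y')" if "\<delta> k \<ge> 0"
      using mult_left_mono[of 1 "x k - y'" "\<delta> k"] that y' by simp
    ultimately have 2: "\<delta> k \<le> L + 2" using L0 by (cases "\<delta> k \<ge> 0") auto
    show ?thesis using 1 2 by simp
  qed
  then show ?thesis by (rule that)
qed

text \<open>Linearise: choosing unimodular coefficients that align all terms at \<open>z\<close> turns the sum into
  \<open>V f z\<close> for a function \<open>f\<close> with restriction bounded by \<open>1\<close>.\<close>

lemma sum_V_basis_infty: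
  assumes inf: "p = \<infinity>"
  obtains C where "\<And>F z. finite F \<Longrightarrow> z \<noteq> 0 \<Longrightarrow> (\<Sum>k\<in>F. V (basis (l k)) z) \<le> C"
proof -
  obtain M where M: "M > 0" "\<And>b z. b \<in> \<Lambda> \<Longrightarrow> z \<noteq> 0 \<Longrightarrow> V (basis b) z \<le> M"
    by (rule basis_V_bound) (rule that; blast)
  obtain C where C: "C > 0" "\<And>f. f \<in> fock_space \<alpha> p \<Longrightarrow> fock_norm \<alpha> p f \<le> ennreal C * lp_norm p \<Lambda> (R f)"
    by (rule R_inverse_bound) (rule that; blast)
  obtain C1 where C1: "C1 > 0" "\<And>F d. F holomorphic_on -{0} \<Longrightarrow> F 0 = 0 \<Longrightarrow> (\<And>m. d m \<ge> 0) \<Longrightarrow> (\<And>z. z \<noteq> 0 \<Longrightarrow> V F z \<le> d \<lfloor>lx z\<rfloor>) \<Longrightarrow>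
      fock_norm \<alpha> p F \<le> ennreal C1 * lp_norm p (UNIV :: int set) (\<lambda>m. of_real (d m))"
    by (rule fock_norm_le_lp_norm) (rule that; blast)
  have "(\<Sum>k\<in>F. V (basis (l k)) z) \<le> C" if F: "finite F" and z: "z \<noteq> 0" for F z
  proof -
    define s where "s = (\<lambda>k. cnj (sgn (basis (l k) z)))"
    have s: "cmod (s k) \<le> 1" "s k * basis (l k) z = of_real (cmod (basis (l k) z))" for k
      by (auto simp: s_def sgn_eq norm_divide complex_norm_square[symmetric] power2_eq_square mult.commute[of "cnj _"])
    define f where "f = (\<lambda>u. \<Sum>k\<in>F. s k * basis (l k) u)"
    have bh: "basis (l k) \<in> fock_space \<alpha> p" for k by (rule basis(1)[OF l_in])
    have fh: "f holomorphic_on -{0}" unfolding f_def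
      by (intro holomorphic_intros fock_spaceD(1)[OF bh])
    have f0: "f 0 = 0" by (simp add: f_def fock_spaceD(2)[OF bh])
    have Vf: "V f u \<le> (\<Sum>k\<in>F. V (basis (l k)) u)" if u: "u \<noteq> 0" for u
    proof -
      have "cmod (f u) \<le> (\<Sum>k\<in>F. cmod (s k * basis (l k) u))" unfolding f_def by (rule norm_sum)
      also have "\<dots> \<le> (\<Sum>k\<in>F. cmod (basis (l k) u))"
        using s(1) by (intro sum_mono) (simp add: norm_mult mult_left_le_one_le)
      finally show ?thesis using wt_pos[OF u] by (simp add: V_def sum_distrib_right[symmetric])
    qed
    \<comment> \<open>A crude bound that depends on \<open>F\<close>; it only serves to see that
      \<open>f\<close> lies in the space.\<close>
    have "fock_norm \<alpha> p f \<le> ennreal C1 * lp_norm p (UNIV :: int set) (\<lambda>m. of_real (card F * M))"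
    proof (rule C1(2)[OF fh f0])
      show "V f u \<le> card F * M" if "u \<noteq> 0" for u
        using Vf[OF that] sum_bounded_above[of F "\<lambda>k. V (basis (l k)) u" M] M(2)[OF l_in that] by force
    qed (use M in auto)
    also have "\<dots> \<le> ennreal C1 * ennreal (card F * M)"
      unfolding inf using M
      by (intro mult_left_mono lp_norm_infty_le_iff[THEN iffD2]) (auto simp: norm_mult intro!: ennreal_leI)
    also have "\<dots> < \<infinity>" by (simp add: ennreal_mult_less_top)
    finally have ff: "f \<in> fock_space \<alpha> p" using fh f0 by (intro fock_spaceI)
    have Rf: "cmod (R f b) \<le> 1" if b: "b \<in> \<Lambda>" for b
    proof -
      obtain j where j: "b = l j" using b range_l by auto
      have "basis (l k) (l j) = 0" if "k \<noteq> j" for k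
        using basis(4)[OF l_in[of k] l_in[of j]] inj_l that by (auto simp: inj_eq)
      then have "f b = (\<Sum>k\<in>F. if k = j then s j * basis (l j) (l j) else 0)"
        unfolding f_def j by (intro sum.cong refl) auto
      also have "\<dots> = (if j \<in> F then s j * basis (l j) (l j) else 0)" using F by simp
      finally have "cmod (f b) \<le> cmod (basis b b)"
        using s(1)[of j] by (auto simp: j norm_mult mult_left_le_one_le)
      then have "V f b \<le> V (basis b) b" using wt_pos[OF nz[OF b]] by (simp add: V_def)
      then show ?thesis using V_basis_self[OF b] norm_restriction_op[OF b] by simp
    qed
    have "ennreal (V f z) \<le> fock_norm \<alpha> p f" by (rule V_le_fock_norm_infty[OF fh z inf])
    also have "\<dots> \<le> ennreal C * lp_norm p \<Lambda> (R f)" by (rule C(2)[OF ff])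
    also have "\<dots> \<le> ennreal C * 1"
      using Rf unfolding inf
      by (intro mult_left_mono lp_norm_infty_le_iff[THEN iffD2]) (auto simp: ennreal_le_1)
    finally have "V f z \<le> C" using C(1) by simp
    moreover have "V f z = (\<Sum>k\<in>F. V (basis (l k)) z)"
    proof -
      have "f z = of_real (\<Sum>k\<in>F. cmod (basis (l k) z))" by (simp add: f_def s(2))
      then have "cmod (f z) = (\<Sum>k\<in>F. cmod (basis (l k) z))" by (simp only: norm_of_real abs_of_nonneg[OF sum_nonneg[OF norm_ge_zero]])
      then show ?thesis by (simp add: V_def sum_distrib_right)
    qed
    ultimately show ?thesis by simp
  qed
  then show ?thesis by (rule that)
qed

text \<open>The sampling inequality at one point per annulus, applied to the dual functions, whose
  norms are uniformly bounded.\<close>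

lemma sum_V_basis_finite:
  fixes w :: "int \<Rightarrow> complex"
  assumes fin: "p \<noteq> \<infinity>" and w: "\<And>m. w m \<noteq> 0" "\<And>m. \<bar>lx (w m) - of_int m\<bar> \<le> 1"
  obtains C where "\<And>F k. finite F \<Longrightarrow> (\<Sum>m\<in>F. V (basis (l k)) (w m) powr enn2real p) \<le> C"
proof -
  obtain C where C: "C > 0" "\<And>b. b \<in> \<Lambda> \<Longrightarrow> fock_norm \<alpha> p (basis b) \<le> ennreal C"
    by (rule basis_norm_bound) (rule that; blast)
  obtain C1 where C1: "C1 > 0"
    "\<And>(I::int set) w f. window_bounded I (\<lambda>i. lx (w i)) (2 * (nat \<lceil>2 * (1 + 1 :: real)\<rceil> + 1)) \<Longrightarrow> (\<And>i. i \<in> I \<Longrightarrow> w i \<noteq> 0) \<Longrightarrow>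
      f holomorphic_on -{0} \<Longrightarrow> lp_norm p I (\<lambda>i. of_real (V f (w i))) \<le> ennreal C1 * fock_norm \<alpha> p f"
    by (rule lp_norm_V_le_fock_norm[of "2 * (nat \<lceil>2 * (1 + 1 :: real)\<rceil> + 1)", where 'i = int]) (rule that; blast)
  have "(\<Sum>m\<in>F. V (basis (l k)) (w m) powr enn2real p) \<le> (C1 * C) powr enn2real p"
    if F: "finite F" for F k
  proof -
    have "lp_norm p F (\<lambda>i. of_real (V (basis (l k)) (w i))) \<le> ennreal C1 * fock_norm \<alpha> p (basis (l k))"
      by (rule C1(2)[OF window_bounded_close[OF w(2)] w(1) fock_spaceD(1)[OF basis(1)[OF l_in]]])
    also have "\<dots> \<le> ennreal C1 * ennreal C" by (intro mult_left_mono C(2)[OF l_in]) auto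
    also have "\<dots> = ennreal (C1 * C)" using C C1 by (simp add: ennreal_mult)
    finally have "(\<integral>\<^sup>+m. ennreal (cmod (of_real (V (basis (l k)) (w m)) :: complex) powr enn2real p) \<partial>count_space F)
        \<le> ennreal ((C1 * C) powr enn2real p)"
      unfolding lp_norm_def using C C1 by (subst (asm) Lp_norm_le_iff[OF p fin]) auto
    also have "(\<integral>\<^sup>+m. ennreal (cmod (of_real (V (basis (l k)) (w m)) :: complex) powr enn2real p) \<partial>count_space F)
        = (\<Sum>m\<in>F. ennreal (V (basis (l k)) (w m) powr enn2real p))"
      using F by (subst nn_integral_count_space_finite) (auto simp: V_nonneg)
    also have "\<dots> = ennreal (\<Sum>m\<in>F. V (basis (l k)) (w m) powr enn2real p)" by (rule sum_ennreal) auto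
    finally show ?thesis by simp
  qed
  then show ?thesis by (rule that)
qed

text \<open>The lower bounds for the dual functions on gap circles, raised to the power
  \<open>q\<close>, are exponentials of multiples of partial sums of
  \<open>- 1/2 - \<delta> j\<close> to the right and of \<open>- 1/2 + \<delta> j\<close> to the
  left. Boundedness of their sums along one index makes both exponents decay linearly.\<close>

lemma delta_sums:
  obtains e C where "e > 0" "\<And>n m. n \<le> m \<Longrightarrow> \<bar>\<Sum>j=n+1..m. \<delta> j\<bar> \<le> (1/2 - e) * of_int (m - n) + C"
proof -
  have "\<forall>m::int. \<exists>y. of_int m \<le> y \<and> y \<le> of_int m + 1 \<and> (\<forall>j. \<eta> \<le> \<bar>y - x j\<bar>)" using exists_gap by blast
  then obtain y where y: "\<And>m::int. of_int m \<le> y m \<and> y m \<le> of_int m + 1 \<and> (\<forall>j. \<eta> \<le> \<bar>y m - x j\<bar>)" by metis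
  define w where "w = (\<lambda>m. complex_of_real (rad (y m)))"
  have w0: "w m \<noteq> 0" and lw: "lx (w m) = y m" for m
    by (auto simp: w_def abs_of_pos[OF rad_pos] intro!: lx_eqI)
  have w1: "\<bar>lx (w m) - of_int m\<bar> \<le> 1" for m using y[of m] by (simp add: lw abs_le_iff)
  have sq: "(lx (w m) - of_int m)\<^sup>2 / 2 \<le> 1 / 2" for m using power_mono[OF w1[of m], of 2] by simp
  have gd: "good k \<rho> (w m)" for k m by (rule good_gap(1)[OF w0]) (use y lw in simp)
  \<comment> \<open>For \<open>p = \<infinity>\<close> the weighted moduli themselves are summed, so
    the power is 1.\<close>
  define q where "q = (if p = \<infinity> then 1 else enn2real p)"
  have q: "q > 0" using q_pos by (simp add: q_def)
  define b where "b = a * q"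
  have b: "b > 0" using a_pos q by (simp add: b_def)
  define T where "T = (\<lambda>k m. V (basis (l k)) (w m) powr q)"
  define c1 where "c1 = (lower_const * exp (- a / 2)) powr q"
  have c1: "c1 > 0" by (simp add: c1_def lower_const_def)
  have T: "exp (b * e) \<le> T k m / c1" if "lower_const * exp (a * (e - 1/2)) \<le> V (basis (l k)) (w m)" for e k m
  proof -
    have "(lower_const * exp (a * (e - 1/2))) powr q \<le> T k m"
      unfolding T_def using that q by (intro powr_mono2) (auto simp: lower_const_def)
    also have "lower_const * exp (a * (e - 1/2)) = (lower_const * exp (- a / 2)) * exp (a * e)"
      by (simp add: exp_add[symmetric] right_diff_distrib)
    also have "((lower_const * exp (- a / 2)) * exp (a * e)) powr q = c1 * exp (b * e)"
      by (simp add: powr_mult c1_def exp_powr_real b_def mult_ac lower_const_def)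
    finally show ?thesis using c1 by (simp add: pos_le_divide_eq mult.commute)
  qed
  \<comment> \<open>To the left the sum of \<open>\<delta>\<close> covers \<open>k..m - 1\<close>;
    the shifted index \<open>j - 1\<close> brings it to the form \<open>k + 1..m\<close>.\<close>
  have sumR: "(\<Sum>j=k+1..m. b * (- 1 / 2 - \<delta> j)) = b * (- (of_int (m - k) / 2) - (\<Sum>j=k+1..m. \<delta> j))"
    and sumL: "(\<Sum>j=k+1..m. b * (- 1 / 2 + \<delta> (j - 1))) = b * (- (of_int (m - k) / 2) + (\<Sum>j=k..m-1. \<delta> j))"
    if "k \<le> m" for k m
  proof -
    have c: "real (card {k+1..m}) = of_int (m - k)" using that by simp
    show "(\<Sum>j=k+1..m. b * (- 1 / 2 - \<delta> j)) = b * (- (of_int (m - k) / 2) - (\<Sum>j=k+1..m. \<delta> j))"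
      unfolding sum_distrib_left[symmetric] sum_subtractf sum_constant c by simp
    have "(\<Sum>j=k+1..m. \<delta> (j - 1)) = (\<Sum>j=k..m-1. \<delta> j)"
      by (rule sum.reindex_bij_witness[where i = "\<lambda>j. j + 1" and j = "\<lambda>j. j - 1"]) auto
    then show "(\<Sum>j=k+1..m. b * (- 1 / 2 + \<delta> (j - 1))) = b * (- (of_int (m - k) / 2) + (\<Sum>j=k..m-1. \<delta> j))"
      unfolding sum_distrib_left[symmetric] sum.distrib sum_constant c by simp
  qed
  have TR: "exp (\<Sum>j=k+1..m. b * (- 1 / 2 - \<delta> j)) \<le> T k m / c1" if km: "k \<le> m" for k m
    unfolding sumR[OF km]
  proof (rule T)
    have "lower_const * exp (a * (- (of_int (m - k) / 2) - (\<Sum>j=k+1..m. \<delta> j) - (lx (w m) - of_int m)\<^sup>2 / 2))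
        \<le> V (basis (l k)) (w m)"
      using V_basis_lower[OF V_g_lower_right[OF gd km, folded lower_const_def]] .
    moreover have "exp (a * (- (of_int (m - k) / 2) - (\<Sum>j=k+1..m. \<delta> j) - 1 / 2))
       \<le> exp (a * (- (of_int (m - k) / 2) - (\<Sum>j=k+1..m. \<delta> j) - (lx (w m) - of_int m)\<^sup>2 / 2))"
      using a_pos sq[of m] by simp
    ultimately show "lower_const * exp (a * (- (of_int (m - k) / 2) - (\<Sum>j=k+1..m. \<delta> j) - 1 / 2)) \<le> V (basis (l k)) (w m)"
      by (rule order_trans[OF mult_left_mono, rotated 2]) (auto simp: lower_const_def)
  qed
  have TL: "exp (\<Sum>j=m+1..k. b * (- 1 / 2 + \<delta> (j - 1))) \<le> T k m / c1" if mk: "m \<le> k" for k m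
    unfolding sumL[OF mk]
  proof (rule T)
    have "lower_const * exp (a * (- (of_int (k - m) / 2) + (\<Sum>j=m..k-1. \<delta> j) - (lx (w m) - of_int m)\<^sup>2 / 2))
        \<le> V (basis (l k)) (w m)"
      using V_basis_lower[OF V_g_lower_left[OF gd mk, folded lower_const_def]] .
    moreover have "exp (a * (- (of_int (k - m) / 2) + (\<Sum>j=m..k-1. \<delta> j) - 1 / 2))
       \<le> exp (a * (- (of_int (k - m) / 2) + (\<Sum>j=m..k-1. \<delta> j) - (lx (w m) - of_int m)\<^sup>2 / 2))"
      using a_pos sq[of m] by simp
    ultimately show "lower_const * exp (a * (- (of_int (k - m) / 2) + (\<Sum>j=m..k-1. \<delta> j) - 1 / 2)) \<le> V (basis (l k)) (w m)"
      by (rule order_trans[OF mult_left_mono, rotated 2]) (auto simp: lower_const_def)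
  qed
  \<comment> \<open>Which of the two decay lemmas applies to which side depends on the summation
    index: \<open>m\<close> for finite \<open>p\<close>, \<open>k\<close> for
    \<open>p = \<infinity>\<close>.\<close>
  have "(\<exists>C h. h > 0 \<and> (\<forall>k m. k \<le> m \<longrightarrow> (\<Sum>j=k+1..m. b * (- 1 / 2 - \<delta> j)) \<le> C - h * of_int (m - k))) \<and>
    (\<exists>C h. h > 0 \<and> (\<forall>k m. k \<le> m \<longrightarrow> (\<Sum>j=k+1..m. b * (- 1 / 2 + \<delta> (j - 1))) \<le> C - h * of_int (m - k)))"
  proof (cases "p = \<infinity>")
    case True
    obtain C where C: "\<And>F z. finite F \<Longrightarrow> z \<noteq> 0 \<Longrightarrow> (\<Sum>k\<in>F. V (basis (l k)) z) \<le> C"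
      by (rule sum_V_basis_infty[OF True]) (rule that; blast)
    have q1: "q = 1" by (simp add: q_def True)
    have T1: "T k m = V (basis (l k)) (w m)" for k m unfolding T_def q1 by (simp add: V_nonneg)
    have S: "(\<Sum>k\<in>F. T k m / c1) \<le> C / c1" if "finite F" for F m
      using C[OF that w0] c1 unfolding sum_divide_distrib[symmetric]
      by (intro divide_right_mono) (simp_all add: T1)
    show ?thesis
    proof (intro conjI)
      show "\<exists>C h. h > 0 \<and> (\<forall>k m. k \<le> m \<longrightarrow> (\<Sum>j=k+1..m. b * (- 1 / 2 - \<delta> j)) \<le> C - h * of_int (m - k))"
      proof (rule exp_sums_decay_dual[where C = "C / c1"])
        fix k M :: int assume "k \<le> M"
        have "(\<Sum>n=k..M. exp (\<Sum>j=n+1..M. b * (- 1 / 2 - \<delta> j))) \<le> (\<Sum>n=k..M. T n M / c1)"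
          by (intro sum_mono TR) auto
        also have "\<dots> \<le> C / c1" by (rule S) simp
        finally show "(\<Sum>n=k..M. exp (\<Sum>j=n+1..M. b * (- 1 / 2 - \<delta> j))) \<le> C / c1" .
      qed
      show "\<exists>C h. h > 0 \<and> (\<forall>k m. k \<le> m \<longrightarrow> (\<Sum>j=k+1..m. b * (- 1 / 2 + \<delta> (j - 1))) \<le> C - h * of_int (m - k))"
      proof (rule exp_sums_decay[where C = "C / c1"])
        fix k M :: int assume "k \<le> M"
        have "(\<Sum>m=k..M. exp (\<Sum>j=k+1..m. b * (- 1 / 2 + \<delta> (j - 1)))) \<le> (\<Sum>m=k..M. T m k / c1)"
          by (intro sum_mono TL) auto
        also have "\<dots> \<le> C / c1" by (rule S) simp
        finally show "(\<Sum>m=k..M. exp (\<Sum>j=k+1..m. b * (- 1 / 2 + \<delta> (j - 1)))) \<le> C / c1" .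
      qed
    qed
  next
    case False
    obtain C where C: "\<And>F k. finite F \<Longrightarrow> (\<Sum>m\<in>F. V (basis (l k)) (w m) powr enn2real p) \<le> C"
      by (rule sum_V_basis_finite[OF False w0 w1]) (rule that; blast)
    have S: "(\<Sum>m\<in>F. T k m / c1) \<le> C / c1" if "finite F" for F k
      using C[OF that] c1 unfolding sum_divide_distrib[symmetric]
      by (intro divide_right_mono) (simp_all add: T_def q_def False[simplified])
    show ?thesis
    proof (intro conjI)
      show "\<exists>C h. h > 0 \<and> (\<forall>k m. k \<le> m \<longrightarrow> (\<Sum>j=k+1..m. b * (- 1 / 2 - \<delta> j)) \<le> C - h * of_int (m - k))"
      proof (rule exp_sums_decay[where C = "C / c1"])
        fix k M :: int assume "k \<le> M"
        have "(\<Sum>m=k..M. exp (\<Sum>j=k+1..m. b * (- 1 / 2 - \<delta> j))) \<le> (\<Sum>m=k..M. T k m / c1)"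
          by (intro sum_mono TR) auto
        also have "\<dots> \<le> C / c1" by (rule S) simp
        finally show "(\<Sum>m=k..M. exp (\<Sum>j=k+1..m. b * (- 1 / 2 - \<delta> j))) \<le> C / c1" .
      qed
      show "\<exists>C h. h > 0 \<and> (\<forall>k m. k \<le> m \<longrightarrow> (\<Sum>j=k+1..m. b * (- 1 / 2 + \<delta> (j - 1))) \<le> C - h * of_int (m - k))"
      proof (rule exp_sums_decay_dual[where C = "C / c1"])
        fix k M :: int assume "k \<le> M"
        have "(\<Sum>n=k..M. exp (\<Sum>j=n+1..M. b * (- 1 / 2 + \<delta> (j - 1)))) \<le> (\<Sum>n=k..M. T M n / c1)"
          by (intro sum_mono TL) auto
        also have "\<dots> \<le> C / c1" by (rule S) simp
        finally show "(\<Sum>n=k..M. exp (\<Sum>j=n+1..M. b * (- 1 / 2 + \<delta> (j - 1)))) \<le> C / c1" .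
      qed
    qed
  qed
  then obtain C1 h1 C2 h2 where h: "h1 > 0" "h2 > 0"
    and R1: "\<And>k m. k \<le> m \<Longrightarrow> (\<Sum>j=k+1..m. b * (- 1 / 2 - \<delta> j)) \<le> C1 - h1 * of_int (m - k)"
    and L1: "\<And>k m. k \<le> m \<Longrightarrow> (\<Sum>j=k+1..m. b * (- 1 / 2 + \<delta> (j - 1))) \<le> C2 - h2 * of_int (m - k)" by blast
  define e where "e = min h1 h2 / b"
  define C where "C = max C1 C2 / b"
  have e: "e > 0" using h b by (simp add: e_def)
  have div: "S \<le> C - e * N" if "b * S \<le> Ci - hi * N" "Ci \<le> max C1 C2" "min h1 h2 \<le> hi" "N \<ge> 0" for S Ci hi N
  proof -
    have "b * S \<le> max C1 C2 - min h1 h2 * N" using that mult_right_mono[OF that(3,4)] by linarith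
    then have "S \<le> (max C1 C2 - min h1 h2 * N) / b" using b by (simp add: pos_le_divide_eq mult.commute)
    then show ?thesis by (simp add: C_def e_def diff_divide_distrib)
  qed
  have "\<bar>\<Sum>j=n+1..m. \<delta> j\<bar> \<le> (1/2 - e) * of_int (m - n) + C" if nm: "n \<le> m" for n m
  proof -
    define N :: real where "N = of_int (m - n)"
    have N: "N \<ge> 0" using nm by (simp add: N_def)
    have "- (N / 2) - (\<Sum>j=n+1..m. \<delta> j) \<le> C - e * N"
      by (rule div[OF _ _ _ N, of _ C1 h1]) (use R1[OF nm] sumR[OF nm] in \<open>simp_all add: N_def\<close>)
    moreover have "- (N / 2) + (\<Sum>j=n+1..m. \<delta> j) \<le> C - e * N"
    proof (rule div[OF _ _ _ N, of _ C2 h2])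
      \<comment> \<open>Moving the range by one undoes the shift in \<open>sumL\<close>.\<close>
      have "n + 1 \<le> m + 1" using nm by simp
      from L1[OF this] sumL[OF this]
      show "b * (- (N / 2) + (\<Sum>j=n+1..m. \<delta> j)) \<le> C2 - h2 * N" by (simp add: N_def)
    qed simp_all
    ultimately show ?thesis unfolding N_def[symmetric] left_diff_distrib by (simp add: abs_le_iff)
  qed
  with e show ?thesis by (rule that)
qed

end

text \<open>The exponent in the admissible function \<open>Q 0 j\<close> is removed by renumbering:
  \<open>Q (- j) 0\<close> is admissible too, and the index \<open>- j\<close> becomes 0 for
  \<open>l (k - j)\<close>.\<close>

lemma (in complete_interp) complete_interp_normalized_exists: "\<exists>l K \<kappa>. complete_interp_normalized \<alpha> p \<Lambda> l K \<kappa>"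
proof -
  obtain l :: "int \<Rightarrow> complex" where l: "bij_betw l UNIV \<Lambda>" "\<And>k. cmod (l k) \<le> cmod (l (k + 1))"
    by (rule enumeration) (erule that, assumption)
  obtain \<kappa> where \<kappa>: "\<kappa> > 0" "\<And>b d. b \<in> \<Lambda> \<Longrightarrow> d \<in> \<Lambda> \<Longrightarrow> b \<noteq> d \<Longrightarrow> \<kappa> * max (cmod b) (cmod d) \<le> cmod (b - d)"
    by (rule separated) (rule that; blast)
  obtain K where K: "window_bounded \<Lambda> lx K" by (rule window_bounded_\<Lambda>)
  have inj: "inj l" and ran: "range l = \<Lambda>" using l(1) by (auto simp: bij_betw_def)
  have enum: "complete_interp_enum \<alpha> p \<Lambda> (\<lambda>k. l (k - j)) K \<kappa>" for j
  proof unfold_locales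
    show "l (k - j) \<noteq> 0" for k using nz ran by auto
    show "cmod (l (k - j)) \<le> cmod (l (k + 1 - j))" for k using l(2)[of "k - j"] by (simp add: algebra_simps)
    show "\<kappa> > 0" by (rule \<kappa>(1))
    show "i \<noteq> k \<Longrightarrow> \<kappa> * max (cmod (l (i - j))) (cmod (l (k - j))) \<le> cmod (l (i - j) - l (k - j))" for i k
      using ran inj by (intro \<kappa>(2)) (auto simp: inj_eq)
    have inj': "inj (\<lambda>k. l (k - j))" using inj by (auto simp: inj_eq intro!: injI)
    have "b = l (b' + j - j)" if "b = l b'" for b b' using that by simp
    then show "range (\<lambda>k. l (k - j)) = \<Lambda>" using ran by blast
    show "window_bounded UNIV (\<lambda>k. lx (l (k - j))) K"
      unfolding window_bounded_def
    proof (intro allI)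
      fix t
      define S where "S = {i \<in> UNIV. t \<le> lx (l (i - j)) \<and> lx (l (i - j)) \<le> t + 1}"
      define W where "W = {b\<in>\<Lambda>. t \<le> lx b \<and> lx b \<le> t + 1}"
      have W: "finite W" "card W \<le> K" unfolding W_def by (rule window_boundedD[OF K])+
      have sub: "(\<lambda>k. l (k - j)) ` S \<subseteq> W" using ran by (auto simp: S_def W_def)
      have injS: "inj_on (\<lambda>k. l (k - j)) S" using inj' by (rule inj_on_subset) simp
      have "finite S" using inj_on_finite[OF injS sub W(1)] .
      moreover have "card S \<le> K" using card_inj_on_le[OF injS sub W(1)] W(2) by simp
      ultimately show "finite {i \<in> UNIV. t \<le> lx (l (i - j)) \<and> lx (l (i - j)) \<le> t + 1} \<and>
         card {i \<in> UNIV. t \<le> lx (l (i - j)) \<and> lx (l (i - j)) \<le> t + 1} \<le> K" by (simp add: S_def)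
    qed
  qed
  interpret e: complete_interp_enum \<alpha> p \<Lambda> l K \<kappa> using enum[of 0] by simp
  obtain j where j: "e.Q 0 j \<in> fock_space \<alpha> p" using e.exists_Q_0_in_fock by blast
  have Q: "e.Q (- j) 0 \<in> fock_space \<alpha> p" using e.Q_in_fock[OF j, of "- j"] by simp
  interpret s: complete_interp_enum \<alpha> p \<Lambda> "\<lambda>k. l (k - j)" K \<kappa> by (rule enum)
  have ix: "0 + 1 + int n - j = - j + 1 + int n" "0 - 1 - int n - j = - j - 1 - int n" for n by simp_all
  have "s.P 0 = e.P (- j)"
    by (rule ext) (simp only: s.P_def e.P_def s.PA_def e.PA_def s.PB_def e.PB_def s.A_def e.A_def s.B_def e.B_def
        s.fw_def s.bw_def ix)
  then have "s.Q 0 0 = e.Q (- j) 0" by (intro ext) (simp add: s.Q_def e.Q_def)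
  then have "complete_interp_normalized \<alpha> p \<Lambda> (\<lambda>k. l (k - j)) K \<kappa>" using Q by unfold_locales simp
  then show ?thesis by blast
qed

section \<open>The characterisation\<close>

lemma dlog_commute: "dlog z w = dlog w z"
  by (simp add: dlog_def abs_minus_commute norm_minus_commute)

lemma norm_diff_norm_le:
  assumes "z \<noteq> 0" "w \<noteq> 0"
  shows "\<bar>cmod z - cmod w\<bar> \<le> max (cmod z) (cmod w) * \<bar>ln (cmod z) - ln (cmod w)\<bar>"
proof -
  have *: "cmod v - cmod u \<le> cmod v * (ln (cmod v) - ln (cmod u))" if "u \<noteq> 0" "v \<noteq> 0" for u v :: complex
  proof -
    have "ln (cmod u / cmod v) \<le> cmod u / cmod v - 1" using that by (intro ln_le_minus_one) auto
    then have "1 - cmod u / cmod v \<le> ln (cmod v) - ln (cmod u)" using that by (simp add: ln_div)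
    then have "cmod v * (1 - cmod u / cmod v) \<le> cmod v * (ln (cmod v) - ln (cmod u))" by (intro mult_left_mono) auto
    then show ?thesis using that by (simp add: right_diff_distrib)
  qed
  show ?thesis
  proof (cases "cmod z \<le> cmod w")
    case True
    then have "ln (cmod z) \<le> ln (cmod w)" using assms by simp
    then show ?thesis using *[OF assms] True by simp
  next
    case False
    then have "ln (cmod w) \<le> ln (cmod z)" using assms by simp
    then show ?thesis using *[OF assms(2,1)] False by simp
  qed
qed

lemma norm_diff_le_dlog:
  assumes z: "z \<noteq> 0" and w: "w \<noteq> 0"
  shows "cmod (z - w) \<le> max (cmod z) (cmod w) * dlog z w"
proof -
  define u where "u = z / of_real (cmod z) - w / of_real (cmod w)"
  have "z - w = of_real (cmod z) * u + of_real (cmod z - cmod w) * (w / of_real (cmod w))"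
    using z w by (simp add: u_def field_simps)
  then have "cmod (z - w) \<le> cmod (of_real (cmod z) * u) + cmod (of_real (cmod z - cmod w) * (w / of_real (cmod w)))"
    using norm_triangle_ineq by metis
  also have "\<dots> = cmod z * cmod u + \<bar>cmod z - cmod w\<bar>" using w by (simp add: norm_mult norm_divide del: of_real_diff)
  also have "\<dots> \<le> max (cmod z) (cmod w) * cmod u + max (cmod z) (cmod w) * \<bar>ln (cmod z) - ln (cmod w)\<bar>"
    by (intro add_mono mult_right_mono norm_diff_norm_le[OF z w]) auto
  finally show ?thesis by (simp add: dlog_def u_def distrib_left)
qed

text \<open>At least half of \<open>d\<close> comes from the radial or from the angular part; the
  first case gives \<open>1 - exp (- d / 2)\<close>, the second \<open>d / 4\<close>.\<close>

lemma norm_diff_ge_of_dlog: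
  assumes z: "z \<noteq> 0" and w: "w \<noteq> 0" and d: "d > 0" "d \<le> dlog z w"
  shows "min (d / 4) (1 - exp (- d / 2)) * max (cmod z) (cmod w) \<le> cmod (z - w)"
proof -
  have *: "min (d / 4) (1 - exp (- d / 2)) * max (cmod z) (cmod w) \<le> cmod (z - w)"
    if z: "z \<noteq> 0" and w: "w \<noteq> 0" and d: "d \<le> dlog z w" and le: "cmod w \<le> cmod z" for z w
  proof (cases "d / 2 \<le> \<bar>ln (cmod z) - ln (cmod w)\<bar>")
    case True
    then have "ln (cmod w / cmod z) \<le> - d / 2" using z w le by (simp add: ln_div)
    then have "cmod w / cmod z \<le> exp (- d / 2)"
      using z w by (metis divide_pos_pos exp_ln exp_le_cancel_iff zero_less_norm_iff)
    then have "cmod w \<le> exp (- d / 2) * cmod z" using z by (simp add: divide_le_eq)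
    then have "(1 - exp (- d / 2)) * cmod z \<le> cmod z - cmod w" by (simp add: left_diff_distrib)
    also have "\<dots> \<le> cmod (z - w)" by (rule norm_triangle_ineq2)
    finally have "(1 - exp (- d / 2)) * cmod z \<le> cmod (z - w)" .
    moreover have "min (d / 4) (1 - exp (- d / 2)) * cmod z \<le> (1 - exp (- d / 2)) * cmod z"
      by (intro mult_right_mono) auto
    ultimately show ?thesis using le by (simp add: max_def)
  next
    case False
    define u where "u = z / of_real (cmod z) - w / of_real (cmod w)"
    have u: "d / 2 \<le> cmod u" using False d by (simp add: dlog_def u_def)
    have "of_real (cmod z) * u = (z - w) + of_real (cmod w - cmod z) * (w / of_real (cmod w))"
      using z w by (simp add: u_def field_simps)
    then have "cmod (of_real (cmod z) * u) \<le> cmod (z - w) + cmod (of_real (cmod w - cmod z) * (w / of_real (cmod w)))"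
      using norm_triangle_ineq by metis
    also have "\<dots> = cmod (z - w) + \<bar>cmod w - cmod z\<bar>" using w by (simp add: norm_mult norm_divide del: of_real_diff)
    also have "\<bar>cmod w - cmod z\<bar> \<le> cmod (z - w)" using norm_triangle_ineq3[of z w] by (simp add: abs_minus_commute)
    finally have "cmod z * cmod u \<le> 2 * cmod (z - w)" by (simp add: norm_mult)
    moreover have "cmod z * (d / 2) \<le> cmod z * cmod u" by (rule mult_left_mono[OF u]) simp
    ultimately have "d / 4 * cmod z \<le> cmod (z - w)" by (simp add: mult_ac)
    moreover have "min (d / 4) (1 - exp (- d / 2)) * cmod z \<le> d / 4 * cmod z"
      by (rule mult_right_mono[OF min.cobounded1]) simp
    ultimately show ?thesis using le by (simp add: max_def)
  qed
  show ?thesis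
  proof (cases "cmod w \<le> cmod z")
    case True
    then show ?thesis by (rule *[OF z w d(2)])
  next
    case False
    then show ?thesis using *[OF w z] d(2) by (simp add: dlog_commute[of w] max.commute norm_minus_commute)
  qed
qed

lemma averages_below_halfI:
  assumes e: "e > 0" and S: "\<And>n m::int. n \<le> m \<Longrightarrow> \<bar>\<Sum>j=n+1..m. \<delta> j\<bar> \<le> (1/2 - e) * of_int (m - n) + C"
  shows "averages_below_half \<delta>"
proof -
  \<comment> \<open>Long enough that \<open>C \<le> e / 2 * N\<close>, so that half of
    \<open>e\<close> absorbs the constant.\<close>
  define N where "N = nat \<lceil>2 * \<bar>C\<bar> / e\<rceil> + 1"
  have N: "N \<ge> 1" "2 * \<bar>C\<bar> / e \<le> real N" by (simp_all add: N_def) linarith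
  then have C: "C \<le> e / 2 * real N" using e by (simp add: field_simps)
  have "(SUP n::int. ereal \<bar>(1 / real N) * (\<Sum>k = n..n + int N - 1. \<delta> k)\<bar>) \<le> ereal (1/2 - e / 2)"
  proof (rule SUP_least)
    fix n :: int
    have "\<bar>\<Sum>k = n..n + int N - 1. \<delta> k\<bar> \<le> (1/2 - e) * real N + C"
      using S[of "n - 1" "n + int N - 1"] N(1) by simp
    also have "\<dots> \<le> (1/2 - e / 2) * real N" using C by (simp add: left_diff_distrib)
    finally have "\<bar>\<Sum>k = n..n + int N - 1. \<delta> k\<bar> / real N \<le> 1/2 - e / 2" using N(1) by (simp add: pos_divide_le_eq)
    then show "ereal \<bar>(1 / real N) * (\<Sum>k = n..n + int N - 1. \<delta> k)\<bar> \<le> ereal (1/2 - e / 2)"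
      by (simp add: abs_mult)
  qed
  then show ?thesis unfolding averages_below_half_def using N(1) e
    by (intro exI[of _ N] exI[of _ "e / 2"]) auto
qed

text \<open>A range is cut into blocks of length \<open>N\<close>; the last, incomplete one is
  bounded trivially by \<open>N * D\<close>.\<close>

lemma averages_below_halfE:
  assumes avg: "averages_below_half \<delta>" and D: "\<And>k. \<bar>\<delta> k\<bar> \<le> D"
  obtains e C where "e > 0" "\<And>n m::int. n \<le> m \<Longrightarrow> \<bar>\<Sum>j=n+1..m. \<delta> j\<bar> \<le> (1/2 - e) * of_int (m - n) + C"
proof -
  obtain N e where N: "N \<ge> 1" "e > 0"
    and S: "(SUP n::int. ereal \<bar>(1 / real N) * (\<Sum>k = n..n + int N - 1. \<delta> k)\<bar>) \<le> ereal (1/2 - e)"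
    using avg unfolding averages_below_half_def by blast
  have S1: "\<bar>\<Sum>k = n+1..n + int N. \<delta> k\<bar> \<le> (1/2 - e) * real N" for n
  proof -
    have "ereal \<bar>(1 / real N) * (\<Sum>k = n+1..n+1 + int N - 1. \<delta> k)\<bar> \<le> ereal (1/2 - e)"
      using order_trans[OF SUP_upper S, of "n + 1"] by simp
    then show ?thesis using N(1) by (simp add: abs_mult field_simps)
  qed
  have "0 \<le> (1/2 - e) * real N" using order_trans[OF abs_ge_zero S1[of 0]] .
  \<comment> \<open>A bound for an absolute value cannot be negative; the sign matters for ranges
    shorter than \<open>N\<close>.\<close>
  then have e2: "0 \<le> 1/2 - e" using N(1) by (simp add: zero_le_mult_iff)
  have D0: "D \<ge> 0" using D[of 0] by linarith
  have main: "\<bar>\<Sum>k = n+1..n + int j. \<delta> k\<bar> \<le> (1/2 - e) * real j + N * D" for n j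
  proof (induction j arbitrary: n rule: less_induct)
    case (less j)
    show ?case
    proof (cases "j < N")
      case True
      have "\<bar>\<Sum>k = n+1..n + int j. \<delta> k\<bar> \<le> (\<Sum>k = n+1..n + int j. \<bar>\<delta> k\<bar>)" by (rule sum_abs)
      also have "\<dots> \<le> j * D" using sum_bounded_above[of "{n+1..n + int j}" "\<lambda>k. \<bar>\<delta> k\<bar>" D] D by simp
      also have "\<dots> \<le> N * D" using True D0 by (intro mult_right_mono) auto
      finally show ?thesis using mult_nonneg_nonneg[OF e2, of "real j"] by simp
    next
      case False
      have s: "{n+1..n + int j} = {n+1..n + int N} \<union> {(n + int N)+1..(n + int N) + int (j - N)}" using False by auto
      have "(\<Sum>k = n+1..n + int j. \<delta> k)
          = (\<Sum>k = n+1..n + int N. \<delta> k) + (\<Sum>k = (n + int N)+1..(n + int N) + int (j - N). \<delta> k)"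
        unfolding s by (rule sum.union_disjoint) auto
      moreover have "\<bar>\<Sum>k = (n + int N)+1..(n + int N) + int (j - N). \<delta> k\<bar> \<le> (1/2 - e) * real (j - N) + N * D"
        using False N(1) by (intro less.IH) auto
      moreover have "(1/2 - e) * real N + (1/2 - e) * real (j - N) = (1/2 - e) * real j"
        using False by (simp add: distrib_left[symmetric] of_nat_diff)
      ultimately show ?thesis using S1[of n] by linarith
    qed
  qed
  show ?thesis
  proof (rule that[OF N(2)])
    fix n m :: int assume nm: "n \<le> m"
    show "\<bar>\<Sum>j=n+1..m. \<delta> j\<bar> \<le> (1/2 - e) * of_int (m - n) + N * D"
      using main[of n "nat (m - n)"] nm by simp
  qed
qed

lemma (in log_weight) lx_log_polar_form:
  assumes "log_polar_form \<alpha> p l \<delta> \<theta>" "c = two_over p"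
  shows "lx (l k) = of_int k + \<delta> k" "l k \<noteq> 0"
proof -
  have "l k = of_real (exp ((of_int k + two_over p + \<delta> k) / (2 * \<alpha>))) * exp (\<i> * of_real (\<theta> k))"
    using assms(1) by (simp add: log_polar_form_def)
  then have "cmod (l k) = rad (of_int k + \<delta> k)" by (simp add: norm_mult rad_def assms(2)[symmetric] add_ac)
  then show "lx (l k) = of_int k + \<delta> k" "l k \<noteq> 0" using lx_eqI rad_pos by force+
qed

theorem theorem2:
  fixes p :: ennreal and \<alpha> :: real and \<Lambda> :: "complex set"
  assumes "0 < p" and "0 < \<alpha>" and "\<Lambda> \<subseteq> - {0}"
  shows "complete_interpolating \<alpha> p \<Lambda> \<longleftrightarrow>
    dlog_separated \<Lambda> \<and>
    (\<exists>l \<delta> \<theta>.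
       monotone_enumeration \<Lambda> l \<and>
       log_polar_form \<alpha> p l \<delta> \<theta> \<and>
       bounded (range \<delta>) \<and>
       (\<exists>(s::int) \<delta>' \<theta>'.
          log_polar_form \<alpha> p (\<lambda>k. l (k + s)) \<delta>' \<theta>' \<and>
          averages_below_half \<delta>'))"
proof (intro iffI, goal_cases)
  case 1
  then interpret complete_interp \<alpha> p \<Lambda> using assms by unfold_locales
  obtain l K \<kappa> where "complete_interp_normalized \<alpha> p \<Lambda> l K \<kappa>" using complete_interp_normalized_exists by blast
  then interpret e: complete_interp_normalized \<alpha> p \<Lambda> l K \<kappa> .
  have "dlog_separated \<Lambda>"
    unfolding dlog_separated_def
  proof (intro exI[of _ \<kappa>] conjI ballI impI)
    fix z w assume zw: "z \<in> \<Lambda>" "w \<in> \<Lambda>" "z \<noteq> w"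
    then obtain j k where jk: "z = l j" "w = l k" "j \<noteq> k" using e.range_l by blast
    have "max (cmod z) (cmod w) * \<kappa> \<le> max (cmod z) (cmod w) * dlog z w"
      using e.sep[OF jk(3)] norm_diff_le_dlog[OF nz[OF zw(1)] nz[OF zw(2)]] by (simp add: jk mult.commute)
    then show "\<kappa> \<le> dlog z w" by (rule mult_left_le_imp_le) (use nz[OF zw(1)] in \<open>simp add: less_max_iff_disj\<close>)
  qed (rule e.\<kappa>)
  moreover have "monotone_enumeration \<Lambda> l"
    using e.inj_l e.range_l e.mono_step by (auto simp: monotone_enumeration_def bij_betw_def)
  moreover have polar: "log_polar_form \<alpha> p l e.\<delta> (\<lambda>k. Arg (l k))"
    unfolding log_polar_form_def
  proof
    fix k
    have "exp ((of_int k + two_over p + e.\<delta> k) / (2 * \<alpha>)) = cmod (l k)"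
      unfolding norm_eq_lx[OF e.l0] by (simp add: e.\<delta>_def e.x_def add_ac)
    then show "l k = of_real (exp ((of_int k + two_over p + e.\<delta> k) / (2 * \<alpha>))) * exp (\<i> * of_real (Arg (l k)))"
      using Arg_eq[OF e.l0] by simp
  qed
  moreover have "bounded (range e.\<delta>)" using e.delta_bounded by (auto simp: bounded_iff)
  moreover have "averages_below_half e.\<delta>"
  proof -
    obtain h C where "h > 0" "\<And>n m. n \<le> m \<Longrightarrow> \<bar>\<Sum>j=n+1..m. e.\<delta> j\<bar> \<le> (1/2 - h) * of_int (m - n) + C"
      by (rule e.delta_sums) (erule that, assumption)
    then show ?thesis by (rule averages_below_halfI)
  qed
  \<comment> \<open>This numbering already satisfies (iii), so the shift is 0.\<close>
  moreover have "log_polar_form \<alpha> p (\<lambda>k. l (k + 0)) e.\<delta> (\<lambda>k. Arg (l k))" using polar by simp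
  ultimately show ?case by blast
next
  case 2
  then obtain l \<delta> \<theta> s \<delta>' \<theta>' where sep: "dlog_separated \<Lambda>" and l: "monotone_enumeration \<Lambda> l"
    and pol: "log_polar_form \<alpha> p l \<delta> \<theta>" "log_polar_form \<alpha> p (\<lambda>k. l (k + s)) \<delta>' \<theta>'"
    and bd: "bounded (range \<delta>)" and avg: "averages_below_half \<delta>'" by blast
  interpret fock \<alpha> p using assms by unfold_locales
  have bij: "inj l" "range l = \<Lambda>" and mono: "cmod (l k) \<le> cmod (l (k + 1))" for k
    using l by (auto simp: monotone_enumeration_def bij_betw_def)
  obtain D0 where D0: "\<And>k. \<bar>\<delta> k\<bar> \<le> D0" using bd by (auto simp: bounded_iff)
  define D where "D = D0 + \<bar>of_int s\<bar>"
  \<comment> \<open>Renumbering by \<open>s\<close> adds a constant to the shifted sequence, so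
    \<open>\<delta>'\<close> stays bounded.\<close>
  have "\<delta>' k = \<delta> (k + s) + of_int s" for k
    using lx_log_polar_form(1)[OF pol(1), of "k + s"] lx_log_polar_form(1)[OF pol(2), of k] by simp
  then have D: "\<bar>\<delta>' k\<bar> \<le> D" for k using D0[of "k + s"] by (simp add: D_def)
  have x: "lx (l (k + s)) = of_int k + \<delta>' k" for k using lx_log_polar_form(1)[OF pol(2)] by simp
  obtain d where d: "d > 0" "\<And>z w. z \<in> \<Lambda> \<Longrightarrow> w \<in> \<Lambda> \<Longrightarrow> z \<noteq> w \<Longrightarrow> d \<le> dlog z w"
    using sep unfolding dlog_separated_def by blast
  obtain e C where e: "e > 0" "\<And>n m::int. n \<le> m \<Longrightarrow> \<bar>\<Sum>j=n+1..m. \<delta>' j\<bar> \<le> (1/2 - e) * of_int (m - n) + C"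
    by (rule averages_below_halfE[OF avg D]) (erule that, assumption)
  interpret i: interp \<alpha> p "\<lambda>k. l (k + s)" "2 * (nat \<lceil>2 * (D + 1)\<rceil> + 1)" "min (d / 4) (1 - exp (- d / 2))"
  proof unfold_locales
    show "l (k + s) \<noteq> 0" for k using lx_log_polar_form(2)[OF pol(2), of k] by simp
    then show "j \<noteq> k \<Longrightarrow> min (d / 4) (1 - exp (- d / 2)) * max (cmod (l (j + s))) (cmod (l (k + s)))
        \<le> cmod (l (j + s) - l (k + s))" for j k
      using bij by (intro norm_diff_ge_of_dlog d) (auto simp: inj_eq)
    show "cmod (l (k + s)) \<le> cmod (l (k + 1 + s))" for k using mono[of "k + s"] by (simp add: algebra_simps)
    show "window_bounded UNIV (\<lambda>k. lx (l (k + s))) (2 * (nat \<lceil>2 * (D + 1)\<rceil> + 1))"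
      by (rule window_bounded_close) (simp add: x D)
    show "min (d / 4) (1 - exp (- d / 2)) > 0" using d(1) by simp
  qed
  have \<delta>: "i.\<delta> = \<delta>'" by (rule ext) (simp add: i.\<delta>_def i.x_def x)
  interpret i: interp_suff \<alpha> p "\<lambda>k. l (k + s)" "2 * (nat \<lceil>2 * (D + 1)\<rceil> + 1)" "min (d / 4) (1 - exp (- d / 2))" D C e
    by unfold_locales (use D e in \<open>simp_all add: \<delta>\<close>)
  have "range (\<lambda>k. l (k + s)) = \<Lambda>"
    using bij(2) by (metis add.commute diff_add_cancel surj_def image_image surj_plus_right)
  then show ?case using i.complete_interpolating_range by simp
qed

end
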